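(* If $\mathcal A$ is a small associative category, then $K\mathcal A$ is a strict ring symmetric spectrum; that is, applying the $K$-theory multifunctor $K$ to the structure multifunctor $\Sigma_*\to\mathbf P$ of $\mathcal A$ makes $K\mathcal A$ a monoid in the symmetric monoidal category of symmetric spectra.
   Context: **Permutative categories.** A permutative category is a category $\mathcal C$ with a functor $\oplus$, an object $0$ and a natural isomorphism $\gamma:a\oplus b\cong b\oplus a$ such that $\oplus$ is strictly associative, $0$ is a strict unit, $\gamma_{a,0}=\mathrm{id}$, $\gamma_{b,a}\gamma_{a,b}=\mathrm{id}$, $\gamma_{a\oplus b,c}=(\gamma_{a,c}\oplus 1)(1\oplus\gamma_{b,c})$. **The multicategory $\mathbf P$** (a multicategory is a symmetric colored operad; multifunctors preserve symmetric group actions, units, multiproducts and enrichment). Objects: small permutative categories. An object of the category $\mathbf P_k(\mathcal C_1,\dots,\mathcal C_k;\mathcal D)$ of $k$-morphisms (a $k$-linear map) is a functor $f:\mathcal C_1\times\dots\times\mathcal C_k\to\mathcal D$ with $f(c_1,\dots,c_k)=0$ if any of the $c_i$ is $0$, with natural transformations $\delta_i:f(c_i)\oplus f(c_i')\to f(c_i\oplus c_i')$ in each variable (fixed variables suppressed), with $\delta_i=\mathrm{id}$ if $c_i$, $c_i'$ or any other $c_j$ is $0$, and $f(\gamma)\delta_i=\delta_i\gamma$; $\delta_i(\delta_i\oplus1)=\delta_i(1\oplus\delta_i)$; for $i\ne j$, $\delta_j(\delta_i\oplus\delta_i)=\delta_i(\delta_j\oplus\delta_j)(1\oplus\gamma\oplus1)$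 as maps $f(c_i,c_j)\oplus f(c_i',c_j)\oplus f(c_i,c_j')\oplus f(c_i',c_j')\to f(c_i\oplus c_i',c_j\oplus c_j')$. Morphisms $\phi:f\to g$ are natural transformations with $\phi\,\delta_i^f=\delta_i^g(\phi\oplus\phi)$. $\sigma^*f(c_{\sigma(1)},\dots,c_{\sigma(k)})=f(c_1,\dots,c_k)$; the multiproduct is $g\circ(f_1\times\dots\times f_n)$ with distributivity maps $g(\delta_i^{f_j})\circ\delta_j^g$. A $0$-linear map to $\mathcal D$ is an object of $\mathcal D$. **Associative category:** a permutative category $\mathcal A$ with a functor $\otimes:\mathcal A\times\mathcal A\to\mathcal A$, strictly associative with strict unit object $1$, and natural distributivity maps $d_l(a,a';b):(a\otimes b)\oplus(a'\otimes b)\to(a\oplus a')\otimes b$ and $d_r(a;b,b'):(a\otimes b)\oplus(a\otimes b')\to a\otimes(b\oplus b')$ such that: (a) $a\otimes0=0\otimes a=0$ for all $a$; (b) $d_l(d_l\oplus1)=d_l(1\oplus d_l)$, and similarly for $d_r$; (c) $(\gamma\otimes1)d_l=d_l\gamma$, $(1\otimes\gamma)d_r=d_r\gamma$; (d) $d_l(a,a';b\otimes c)=(d_l(a,a';b)\otimes1_c)d_l(a\otimes b,a'\otimes b;c)$, $d_r(a\otimes b;c,c')=(1_a\otimes d_r(b;c,c'))d_r(a;b\otimes c,b\otimes c')$; (e) $(d_r(a;b,b')\otimes1_c)d_l(a\otimes b,a\otimes b';c)=(1_a\otimes d_l(b,b';c))d_r(a;b\otimes c,b'\otimes c)$; (f)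 $d_l(a,a';b\oplus b')(d_r(a;b,b')\oplus d_r(a';b,b'))=d_r(a\oplus a';b,b')(d_l(a,a';b)\oplus d_l(a,a';b'))(1\oplus\gamma\oplus1)$. **Structure multifunctor.** $\Sigma_*$ is the associative operad ($k$-th set $\Sigma_k$), whose algebras in a symmetric monoidal category are the monoids. The structure multifunctor $\Sigma_*\to\mathbf P$ of $\mathcal A$ sends $\sigma\in\Sigma_k$ to the functor $(a_1,\dots,a_k)\mapsto a_{\sigma^{-1}(1)}\otimes\dots\otimes a_{\sigma^{-1}(k)}$ with distributivity maps composed from $d_l$ and $d_r$; so $\otimes$ (with $\delta_1=d_l$, $\delta_2=d_r$) is the image of the identity of $\Sigma_2$ and $1$ is the image of the element of $\Sigma_0$. **The $K$-theory multifunctor** (from $\mathbf P$ to symmetric spectra of simplicial sets). For a small permutative category $\mathcal C$ and finite based sets $A_1,\dots,A_n$, let $\overline{\mathcal C}_{(A_1,\dots,A_n)}$ be the category whose objects are systems $\{C_{\langle S\rangle},\rho_{\langle S\rangle;i,T,U}\}$, where $\langle S\rangle=(S_1,\dots,S_n)$ runs over $n$-tuples of subsets $S_i\subset A_i$ not containing the basepoint, $1\le i\le n$, $T,U$ are disjoint with $T\cup U=S_i$, $C_{\langle S\rangle}$ is an object of $\mathcal C$ and $\rho_{\langle S\rangle;i,T,U}:C_{\langle S|_iT\rangle}\oplus C_{\langle S|_iU\rangle}\to C_{\langle S\rangle}$ is a morphism ($\langle S|_iT\rangle$ is $\langle S\rangle$ with $S_i$ replaced by $T$), such that: $C_{\langle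 S\rangle}=0$ if some $S_k=\emptyset$; $\rho=\mathrm{id}$ if any of the $S_k$, $T$, $U$ is empty; $\rho_{\langle S\rangle;i,U,T}\gamma=\rho_{\langle S\rangle;i,T,U}$; $\rho_{\langle S\rangle;i,T\cup U,V}(\rho_{\langle S|_i(T\cup U)\rangle;i,T,U}\oplus\mathrm{id})=\rho_{\langle S\rangle;i,T,U\cup V}(\mathrm{id}\oplus\rho_{\langle S|_i(U\cup V)\rangle;i,U,V})$; and for $i\neq j$, $\rho_{\langle S\rangle;j,V,W}(\rho_{\langle S|_jV\rangle;i,T,U}\oplus\rho_{\langle S|_jW\rangle;i,T,U})=\rho_{\langle S\rangle;i,T,U}(\rho_{\langle S|_iT\rangle;j,V,W}\oplus\rho_{\langle S|_iU\rangle;j,V,W})(\mathrm{id}\oplus\gamma\oplus\mathrm{id})$. Morphisms are families $C_{\langle S\rangle}\to C'_{\langle S\rangle}$ that are $\mathrm{id}_0$ when some $S_i=\emptyset$ and commute with the $\rho$'s. For $n=0$ put $\overline{\mathcal C}_{()}=\mathcal C$ (canonically isomorphic to $\overline{\mathcal C}_{(\{0,1\})}$). This is functorial in based maps of the $A_i$ by taking preimages of subsets. Let $S^1_\bullet$ be the simplicial circle with $S^1_q=\{0,\dots,q\}$ based at $0$. $K\mathcal C$ is (up to canonical isomorphism) the symmetric spectrum whose $n$-th simplicial set has $q$-simplices $N_q\overline{\mathcal C}_{(S^1_q,\dots,S^1_q)}$ ($n$ entries, $N$ the nerve), based at the zero system, with $\sigma\in\Sigma_n$ acting by $(\sigma_!C)_{\langle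 S\rangle}=C_{(S_{\sigma(1)},\dots,S_{\sigma(n)})}$, and structure map sending $(C,x)$, $x\in S^1_q\setminus\{0\}$, to the system $C'_{(S_1,\dots,S_n,S)}=C_{(S_1,\dots,S_n)}$ if $x\in S$ and $0$ otherwise. A $k$-linear map $f$ induces $K\mathcal C_1\wedge\dots\wedge K\mathcal C_k\to K\mathcal D$ by the functors sending $(C_1,\dots,C_k)$, with $C_i$ in $\overline{\mathcal C_i}_{(S^1_q,\dots,S^1_q)}$ ($p_i$ entries), to the system $(\langle T_1\rangle,\dots,\langle T_k\rangle)\mapsto f(C_{1,\langle T_1\rangle},\dots,C_{k,\langle T_k\rangle})$ with structure maps $f(\rho)\circ\delta_i$ in the $i$-th block; a $0$-linear map (object $d$ of $\mathcal D$) induces the map from the sphere spectrum to $K\mathcal D$ given by the vertex $d$ of $N\mathcal D$.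
   Formalization: Associative categories are also required to satisfy f⊗id_0 = id_0 = id_0⊗f on morphisms, d_l and d_r = id when an argument is 0, and d_l(a,a';1) = id, d_r(1;b,b') = id; these do not follow from (a)–(f), and without them the structure multifunctor or the unit law fails. *)

theory Defs
  imports "HOL-Library.FuncSet" "HOL-Combinatorics.Permutations"
begin

section \<open>Categories, permutative categories, associative categories\<close>

text \<open>Objects and arrows are elements of sets, so every category here is small.  The composite
  of two arrows is only meaningful if they are composable.\<close>

record ('o, 'm) cat =
  Ob :: "'o set"
  Ar :: "'m set"
  Dom :: "'m \<Rightarrow> 'o"
  Cod :: "'m \<Rightarrow> 'o"
  Id :: "'o \<Rightarrow> 'm"
  Cmp :: "'m \<Rightarrow> 'm \<Rightarrow> 'm" (infixl "\<cdot>\<index>" 60)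

definition Hom :: "('o, 'm, 'z) cat_scheme \<Rightarrow> 'o \<Rightarrow> 'o \<Rightarrow> 'm set" where
  "Hom C a b = {f \<in> Ar C. Dom C f = a \<and> Cod C f = b}"

locale category =
  fixes C :: "('o, 'm, 'z) cat_scheme" (structure)
  assumes dom_cod: "f \<in> Ar C \<Longrightarrow> Dom C f \<in> Ob C \<and> Cod C f \<in> Ob C"
    and id_hom: "a \<in> Ob C \<Longrightarrow> Id C a \<in> Hom C a a"
    and cmp_hom: "\<lbrakk>f \<in> Hom C a b; g \<in> Hom C b c\<rbrakk> \<Longrightarrow> g \<cdot> f \<in> Hom C a c"
    and cmp_id: "f \<in> Hom C a b \<Longrightarrow> f \<cdot> Id C a = f \<and> Id C b \<cdot> f = f"
    and cmp_assoc: "\<lbrakk>f \<in> Hom C a b; g \<in> Hom C b c; h \<in> Hom C c d\<rbrakk>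
      \<Longrightarrow> (h \<cdot> g) \<cdot> f = h \<cdot> (g \<cdot> f)"

record ('o, 'm) perm_cat = "('o, 'm) cat" +
  osum :: "'o \<Rightarrow> 'o \<Rightarrow> 'o" (infixr "\<oplus>\<index>" 65)
  asum :: "'m \<Rightarrow> 'm \<Rightarrow> 'm" (infixr "\<boxplus>\<index>" 65)
  zobj :: 'o ("\<zero>\<index>")
  gam :: "'o \<Rightarrow> 'o \<Rightarrow> 'm" ("\<gamma>\<index>")

text \<open>\<open>\<oplus>\<close> and \<open>\<boxplus>\<close> are the object and the arrow part of one functor.\<close>

locale permutative_category = category C for C :: "('o, 'm, 'z) perm_cat_scheme" (structure) +
  assumes osum_ob: "\<lbrakk>a \<in> Ob C; b \<in> Ob C\<rbrakk> \<Longrightarrow> a \<oplus> b \<in> Ob C"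
    and asum_hom: "\<lbrakk>f \<in> Hom C a b; g \<in> Hom C c d\<rbrakk> \<Longrightarrow> f \<boxplus> g \<in> Hom C (a \<oplus> c) (b \<oplus> d)"
    and asum_id: "\<lbrakk>a \<in> Ob C; b \<in> Ob C\<rbrakk> \<Longrightarrow> Id C a \<boxplus> Id C b = Id C (a \<oplus> b)"
    and asum_cmp: "\<lbrakk>f \<in> Hom C a b; g \<in> Hom C b c; f' \<in> Hom C a' b'; g' \<in> Hom C b' c'\<rbrakk>
      \<Longrightarrow> (g \<cdot> f) \<boxplus> (g' \<cdot> f') = (g \<boxplus> g') \<cdot> (f \<boxplus> f')"
    and osum_assoc: "\<lbrakk>a \<in> Ob C; b \<in> Ob C; c \<in> Ob C\<rbrakk> \<Longrightarrow> (a \<oplus> b) \<oplus> c = a \<oplus> (b \<oplus> c)"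
    and asum_assoc: "\<lbrakk>f \<in> Ar C; g \<in> Ar C; h \<in> Ar C\<rbrakk> \<Longrightarrow> (f \<boxplus> g) \<boxplus> h = f \<boxplus> (g \<boxplus> h)"
    and zero_ob: "\<zero> \<in> Ob C"
    and osum_zero: "a \<in> Ob C \<Longrightarrow> a \<oplus> \<zero> = a \<and> \<zero> \<oplus> a = a"
    and asum_zero: "f \<in> Ar C \<Longrightarrow> f \<boxplus> Id C \<zero> = f \<and> Id C \<zero> \<boxplus> f = f"
    and gam_hom: "\<lbrakk>a \<in> Ob C; b \<in> Ob C\<rbrakk> \<Longrightarrow> \<gamma> a b \<in> Hom C (a \<oplus> b) (b \<oplus> a)"
    and gam_nat: "\<lbrakk>f \<in> Hom C a a'; g \<in> Hom C b b'\<rbrakk> \<Longrightarrow> \<gamma> a' b' \<cdot> (f \<boxplus> g) = (g \<boxplus> f) \<cdot> \<gamma> a b"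
    and gam_zero: "a \<in> Ob C \<Longrightarrow> \<gamma> a \<zero> = Id C a"
    and gam_gam: "\<lbrakk>a \<in> Ob C; b \<in> Ob C\<rbrakk> \<Longrightarrow> \<gamma> b a \<cdot> \<gamma> a b = Id C (a \<oplus> b)"
    and gam_sum: "\<lbrakk>a \<in> Ob C; b \<in> Ob C; c \<in> Ob C\<rbrakk>
      \<Longrightarrow> \<gamma> (a \<oplus> b) c = (\<gamma> a c \<boxplus> Id C b) \<cdot> (Id C a \<boxplus> \<gamma> b c)"

text \<open>\<open>1 \<oplus> \<gamma> \<oplus> 1 : a \<oplus> b \<oplus> c \<oplus> d \<rightarrow> a \<oplus> c \<oplus> b \<oplus> d\<close>\<close>

definition mid_swap :: "('o, 'm, 'z) perm_cat_scheme \<Rightarrow> 'o \<Rightarrow> 'o \<Rightarrow> 'o \<Rightarrow> 'o \<Rightarrow> 'm" where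
  "mid_swap C a b c d = Id C a \<boxplus>\<^bsub>C\<^esub> \<gamma>\<^bsub>C\<^esub> b c \<boxplus>\<^bsub>C\<^esub> Id C d"

record ('o, 'm) assoc_cat = "('o, 'm) perm_cat" +
  oten :: "'o \<Rightarrow> 'o \<Rightarrow> 'o" (infixr "\<otimes>\<index>" 70)
  aten :: "'m \<Rightarrow> 'm \<Rightarrow> 'm" (infixr "\<boxtimes>\<index>" 70)
  uobj :: 'o ("\<one>\<index>")
  dl :: "'o \<Rightarrow> 'o \<Rightarrow> 'o \<Rightarrow> 'm"
  dr :: "'o \<Rightarrow> 'o \<Rightarrow> 'o \<Rightarrow> 'm"

text \<open>\<open>dl a a' b : (a \<otimes> b) \<oplus> (a' \<otimes> b) \<rightarrow> (a \<oplus> a') \<otimes> b\<close> and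
  \<open>dr a b b' : (a \<otimes> b) \<oplus> (a \<otimes> b') \<rightarrow> a \<otimes> (b \<oplus> b')\<close>.

  The equation \<open>a \<otimes> 0 = 0 = 0 \<otimes> a\<close> is an equation between functors of \<open>a\<close>, hence \<open>zero_aten\<close>.
  The axioms \<open>dl_zero\<close>, \<open>dr_zero\<close> are the normalization that a bilinear map satisfies by
  definition (a distributivity map is the identity as soon as one of its arguments is \<open>0\<close>), and
  \<open>dl_one\<close>, \<open>dr_one\<close> say that substituting \<open>1\<close> into one variable of the bilinear map \<open>\<otimes>\<close> gives
  the identity linear map, its distributivity map included.  Both are necessary for \<open>\<otimes>\<close> and \<open>1\<close>
  to be the values of a multifunctor on the associative operad, and neither follows from the
  other axioms.  For example let \<open>e\<close> be a nontrivial idempotent of a commutative monoid \<open>M\<close>, and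
  take the natural numbers as objects, \<open>M\<close> as the endomorphisms of each \<open>n > 0\<close> and no other
  nonidentity arrows: \<open>dl = e\<close> on nonzero arguments, \<open>dr = id\<close> violates only \<open>dl_one\<close>.\<close>

locale associative_category = permutative_category A
  for A :: "('o, 'm, 'z) assoc_cat_scheme" (structure) +
  assumes oten_ob: "\<lbrakk>a \<in> Ob A; b \<in> Ob A\<rbrakk> \<Longrightarrow> a \<otimes> b \<in> Ob A"
    and aten_hom: "\<lbrakk>f \<in> Hom A a b; g \<in> Hom A c d\<rbrakk> \<Longrightarrow> f \<boxtimes> g \<in> Hom A (a \<otimes> c) (b \<otimes> d)"
    and aten_id: "\<lbrakk>a \<in> Ob A; b \<in> Ob A\<rbrakk> \<Longrightarrow> Id A a \<boxtimes> Id A b = Id A (a \<otimes> b)"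
    and aten_cmp: "\<lbrakk>f \<in> Hom A a b; g \<in> Hom A b c; f' \<in> Hom A a' b'; g' \<in> Hom A b' c'\<rbrakk>
      \<Longrightarrow> (g \<cdot> f) \<boxtimes> (g' \<cdot> f') = (g \<boxtimes> g') \<cdot> (f \<boxtimes> f')"
    and oten_assoc: "\<lbrakk>a \<in> Ob A; b \<in> Ob A; c \<in> Ob A\<rbrakk> \<Longrightarrow> (a \<otimes> b) \<otimes> c = a \<otimes> (b \<otimes> c)"
    and aten_assoc: "\<lbrakk>f \<in> Ar A; g \<in> Ar A; h \<in> Ar A\<rbrakk> \<Longrightarrow> (f \<boxtimes> g) \<boxtimes> h = f \<boxtimes> (g \<boxtimes> h)"
    and one_ob: "\<one> \<in> Ob A"
    and oten_one: "a \<in> Ob A \<Longrightarrow> a \<otimes> \<one> = a \<and> \<one> \<otimes> a = a"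
    and aten_one: "f \<in> Ar A \<Longrightarrow> f \<boxtimes> Id A \<one> = f \<and> Id A \<one> \<boxtimes> f = f"
    and dl_hom: "\<lbrakk>a \<in> Ob A; a' \<in> Ob A; b \<in> Ob A\<rbrakk>
      \<Longrightarrow> dl A a a' b \<in> Hom A ((a \<otimes> b) \<oplus> (a' \<otimes> b)) ((a \<oplus> a') \<otimes> b)"
    and dl_nat: "\<lbrakk>f \<in> Hom A a c; f' \<in> Hom A a' c'; g \<in> Hom A b d\<rbrakk>
      \<Longrightarrow> dl A c c' d \<cdot> ((f \<boxtimes> g) \<boxplus> (f' \<boxtimes> g)) = ((f \<boxplus> f') \<boxtimes> g) \<cdot> dl A a a' b"
    and dr_hom: "\<lbrakk>a \<in> Ob A; b \<in> Ob A; b' \<in> Ob A\<rbrakk>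
      \<Longrightarrow> dr A a b b' \<in> Hom A ((a \<otimes> b) \<oplus> (a \<otimes> b')) (a \<otimes> (b \<oplus> b'))"
    and dr_nat: "\<lbrakk>f \<in> Hom A a c; g \<in> Hom A b d; g' \<in> Hom A b' d'\<rbrakk>
      \<Longrightarrow> dr A c d d' \<cdot> ((f \<boxtimes> g) \<boxplus> (f \<boxtimes> g')) = (f \<boxtimes> (g \<boxplus> g')) \<cdot> dr A a b b'"
    and zero_oten: "a \<in> Ob A \<Longrightarrow> a \<otimes> \<zero> = \<zero> \<and> \<zero> \<otimes> a = \<zero>"
    and zero_aten: "f \<in> Ar A \<Longrightarrow> f \<boxtimes> Id A \<zero> = Id A \<zero> \<and> Id A \<zero> \<boxtimes> f = Id A \<zero>"
    and dl_assoc: "\<lbrakk>a \<in> Ob A; a' \<in> Ob A; a'' \<in> Ob A; b \<in> Ob A\<rbrakk>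
      \<Longrightarrow> dl A (a \<oplus> a') a'' b \<cdot> (dl A a a' b \<boxplus> Id A (a'' \<otimes> b))
        = dl A a (a' \<oplus> a'') b \<cdot> (Id A (a \<otimes> b) \<boxplus> dl A a' a'' b)"
    and dr_assoc: "\<lbrakk>a \<in> Ob A; b \<in> Ob A; b' \<in> Ob A; b'' \<in> Ob A\<rbrakk>
      \<Longrightarrow> dr A a (b \<oplus> b') b'' \<cdot> (dr A a b b' \<boxplus> Id A (a \<otimes> b''))
        = dr A a b (b' \<oplus> b'') \<cdot> (Id A (a \<otimes> b) \<boxplus> dr A a b' b'')"
    and dl_gam: "\<lbrakk>a \<in> Ob A; a' \<in> Ob A; b \<in> Ob A\<rbrakk>
      \<Longrightarrow> (\<gamma> a a' \<boxtimes> Id A b) \<cdot> dl A a a' b = dl A a' a b \<cdot> \<gamma> (a \<otimes> b) (a' \<otimes> b)"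
    and dr_gam: "\<lbrakk>a \<in> Ob A; b \<in> Ob A; b' \<in> Ob A\<rbrakk>
      \<Longrightarrow> (Id A a \<boxtimes> \<gamma> b b') \<cdot> dr A a b b' = dr A a b' b \<cdot> \<gamma> (a \<otimes> b) (a \<otimes> b')"
    and dl_ten: "\<lbrakk>a \<in> Ob A; a' \<in> Ob A; b \<in> Ob A; c \<in> Ob A\<rbrakk>
      \<Longrightarrow> dl A a a' (b \<otimes> c) = (dl A a a' b \<boxtimes> Id A c) \<cdot> dl A (a \<otimes> b) (a' \<otimes> b) c"
    and dr_ten: "\<lbrakk>a \<in> Ob A; b \<in> Ob A; c \<in> Ob A; c' \<in> Ob A\<rbrakk>
      \<Longrightarrow> dr A (a \<otimes> b) c c' = (Id A a \<boxtimes> dr A b c c') \<cdot> dr A a (b \<otimes> c) (b \<otimes> c')"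
    and dl_dr_ten: "\<lbrakk>a \<in> Ob A; b \<in> Ob A; b' \<in> Ob A; c \<in> Ob A\<rbrakk>
      \<Longrightarrow> (dr A a b b' \<boxtimes> Id A c) \<cdot> dl A (a \<otimes> b) (a \<otimes> b') c
        = (Id A a \<boxtimes> dl A b b' c) \<cdot> dr A a (b \<otimes> c) (b' \<otimes> c)"
    and dl_dr_sum: "\<lbrakk>a \<in> Ob A; a' \<in> Ob A; b \<in> Ob A; b' \<in> Ob A\<rbrakk>
      \<Longrightarrow> dl A a a' (b \<oplus> b') \<cdot> (dr A a b b' \<boxplus> dr A a' b b')
        = dr A (a \<oplus> a') b b' \<cdot> (dl A a a' b \<boxplus> dl A a a' b')
            \<cdot> mid_swap A (a \<otimes> b) (a \<otimes> b') (a' \<otimes> b) (a' \<otimes> b')"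
    and dl_zero: "\<lbrakk>a \<in> Ob A; a' \<in> Ob A; b \<in> Ob A; \<zero> \<in> {a, a', b}\<rbrakk>
      \<Longrightarrow> dl A a a' b = Id A ((a \<oplus> a') \<otimes> b)"
    and dr_zero: "\<lbrakk>a \<in> Ob A; b \<in> Ob A; b' \<in> Ob A; \<zero> \<in> {a, b, b'}\<rbrakk>
      \<Longrightarrow> dr A a b b' = Id A (a \<otimes> (b \<oplus> b'))"
    and dl_one: "\<lbrakk>a \<in> Ob A; a' \<in> Ob A\<rbrakk> \<Longrightarrow> dl A a a' \<one> = Id A (a \<oplus> a')"
    and dr_one: "\<lbrakk>b \<in> Ob A; b' \<in> Ob A\<rbrakk> \<Longrightarrow> dr A \<one> b b' = Id A (b \<oplus> b')"


section \<open>Multilinear maps and the structure multifunctor\<close>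

text \<open>The data of a \<open>k\<close>-linear map, \<open>k = lin_arity f\<close>; its arguments form a list of length \<open>k\<close>.
  \<open>lin_dist f i cs c'\<close> is the distributivity map in the \<open>i\<close>-th variable (counted from \<open>0\<close>),
  \<open>f(\<dots>, c\<^sub>i, \<dots>) \<oplus> f(\<dots>, c', \<dots>) \<rightarrow> f(\<dots>, c\<^sub>i \<oplus> c', \<dots>)\<close>, where \<open>c\<^sub>i = cs ! i\<close> and the other
  entries of \<open>cs\<close> are the fixed variables.\<close>

record ('o, 'm) lin_map =
  lin_arity :: nat
  lin_ob :: "'o list \<Rightarrow> 'o"
  lin_ar :: "'m list \<Rightarrow> 'm"
  lin_dist :: "nat \<Rightarrow> 'o list \<Rightarrow> 'o \<Rightarrow> 'm"

definition oten_list :: "('o, 'm, 'z) assoc_cat_scheme \<Rightarrow> 'o list \<Rightarrow> 'o" where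
  "oten_list A as = foldr (oten A) as \<one>\<^bsub>A\<^esub>"

definition aten_list :: "('o, 'm, 'z) assoc_cat_scheme \<Rightarrow> 'm list \<Rightarrow> 'm" where
  "aten_list A fs = foldr (aten A) fs (Id A \<one>\<^bsub>A\<^esub>)"

text \<open>The value of the structure multifunctor at \<open>\<sigma> \<in> \<Sigma>\<^sub>k\<close>, a function that permutes
  \<open>{..<k}\<close>.  The \<open>i\<close>-th variable stands in place
  \<open>\<sigma> i\<close> of the product; with \<open>L\<close> and \<open>R\<close> the products of the factors before and after it, the
  distributivity map is
  \<open>(L \<otimes> a \<otimes> R) \<oplus> (L \<otimes> a' \<otimes> R) \<rightarrow> L \<otimes> ((a \<otimes> R) \<oplus> (a' \<otimes> R)) \<rightarrow> L \<otimes> (a \<oplus> a') \<otimes> R\<close>.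
  By \<open>dl_dr_ten\<close> the other order of \<open>dl\<close> and \<open>dr\<close> gives the same map.\<close>

definition structure_mf ::
  "('o, 'm, 'z) assoc_cat_scheme \<Rightarrow> nat \<Rightarrow> (nat \<Rightarrow> nat) \<Rightarrow> ('o, 'm) lin_map" where
  "structure_mf A k \<sigma> = \<lparr>
     lin_arity = k,
     lin_ob = (\<lambda>as. oten_list A (permute_list (inv \<sigma>) as)),
     lin_ar = (\<lambda>fs. aten_list A (permute_list (inv \<sigma>) fs)),
     lin_dist = (\<lambda>i as a'.
       let bs = permute_list (inv \<sigma>) as; a = as ! i;
           L = oten_list A (take (\<sigma> i) bs); R = oten_list A (drop (Suc (\<sigma> i)) bs)
       in (Id A L \<boxtimes>\<^bsub>A\<^esub> dl A a a' R) \<cdot>\<^bsub>A\<^esub> dr A L (a \<otimes>\<^bsub>A\<^esub> R) (a' \<otimes>\<^bsub>A\<^esub> R)) \<rparr>"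


section \<open>Based simplicial sets and symmetric spectra\<close>

text \<open>\<open>sop X q r \<alpha>\<close> is the operator from \<open>q\<close>-simplices to \<open>r\<close>-simplices given by the monotone map
  \<open>\<alpha> : {0..r} \<rightarrow> {0..q}\<close>.\<close>

record 'x bsset =
  simplices :: "nat \<Rightarrow> 'x set"
  pt :: "nat \<Rightarrow> 'x"
  sop :: "nat \<Rightarrow> nat \<Rightarrow> (nat \<Rightarrow> nat) \<Rightarrow> 'x \<Rightarrow> 'x"

definition mono_map :: "nat \<Rightarrow> nat \<Rightarrow> (nat \<Rightarrow> nat) \<Rightarrow> bool" where
  "mono_map r q \<alpha> \<longleftrightarrow> \<alpha> \<in> {..r} \<rightarrow> {..q} \<and> mono_on {..r} \<alpha>"

text \<open>As \<open>\<alpha>\<close> is a total function on \<open>nat\<close>, axiom \<open>sop_cong\<close> says that only its values on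
  \<open>{..r}\<close> matter.\<close>

locale based_simplicial_set =
  fixes X :: "'x bsset"
  assumes pt_simplex: "pt X q \<in> simplices X q"
    and sop_simplex: "\<lbrakk>mono_map r q \<alpha>; x \<in> simplices X q\<rbrakk> \<Longrightarrow> sop X q r \<alpha> x \<in> simplices X r"
    and sop_pt: "mono_map r q \<alpha> \<Longrightarrow> sop X q r \<alpha> (pt X q) = pt X r"
    and sop_cong: "\<lbrakk>mono_map r q \<alpha>; \<And>i. i \<le> r \<Longrightarrow> \<alpha> i = \<beta> i; x \<in> simplices X q\<rbrakk>
      \<Longrightarrow> sop X q r \<alpha> x = sop X q r \<beta> x"
    and sop_id: "x \<in> simplices X q \<Longrightarrow> sop X q q id x = x"
    and sop_comp: "\<lbrakk>mono_map r q \<alpha>; mono_map s r \<beta>; x \<in> simplices X q\<rbrakk>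
      \<Longrightarrow> sop X q s (\<alpha> \<circ> \<beta>) x = sop X r s \<beta> (sop X q r \<alpha> x)"

text \<open>The circle has \<open>q\<close>-simplices \<open>{0..q}\<close>: \<open>x > 0\<close> stands for the monotone map from \<open>{0..q}\<close>
  to \<open>{0, 1}\<close> that is \<open>1\<close> exactly from \<open>x\<close> on, and \<open>0\<close> for the two constant maps.  The operators
  are given by composition with \<open>\<alpha> : {0..r} \<rightarrow> {0..q}\<close>.\<close>

definition circle_op :: "nat \<Rightarrow> (nat \<Rightarrow> nat) \<Rightarrow> nat \<Rightarrow> nat" where
  "circle_op r \<alpha> x = (if \<exists>i\<le>r. x \<le> \<alpha> i then LEAST i. x \<le> \<alpha> i else 0)"

text \<open>\<open>smap X n q x s\<close> is the value of the structure map \<open>X\<^sub>n \<and> S\<^sup>1 \<rightarrow> X\<^sub>n\<^sub>+\<^sub>1\<close> on the pair of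
  \<open>q\<close>-simplices \<open>(x, s)\<close>.\<close>

record 'x spectrum =
  lev :: "nat \<Rightarrow> 'x bsset"
  sact :: "nat \<Rightarrow> (nat \<Rightarrow> nat) \<Rightarrow> nat \<Rightarrow> 'x \<Rightarrow> 'x"
  smap :: "nat \<Rightarrow> nat \<Rightarrow> 'x \<Rightarrow> nat \<Rightarrow> 'x"

primrec iter_smap :: "'x spectrum \<Rightarrow> nat \<Rightarrow> nat \<Rightarrow> 'x \<Rightarrow> nat list \<Rightarrow> 'x" where
  "iter_smap X n q x [] = x"
| "iter_smap X n q x (s # ss) = iter_smap X (Suc n) q (smap X n q x s) ss"

text \<open>\<open>\<sigma> \<oplus> \<tau> \<in> \<Sigma>\<^sub>m\<^sub>+\<^sub>n\<close> for \<open>\<sigma> \<in> \<Sigma>\<^sub>m\<close>, \<open>\<tau> \<in> \<Sigma>\<^sub>n\<close>, and the permutation that moves the first \<open>m\<close> of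
  \<open>m + n\<close> elements past the last \<open>n\<close>\<close>

definition block_sum :: "nat \<Rightarrow> (nat \<Rightarrow> nat) \<Rightarrow> (nat \<Rightarrow> nat) \<Rightarrow> nat \<Rightarrow> nat" where
  "block_sum m \<sigma> \<tau> i = (if i < m then \<sigma> i else m + \<tau> (i - m))"

definition block_swap :: "nat \<Rightarrow> nat \<Rightarrow> nat \<Rightarrow> nat" where
  "block_swap m n i = (if i < m then i + n else if i < m + n then i - m else i)"

text \<open>The \<open>n\<close>-th level of the sphere spectrum is the \<open>n\<close>-fold smash power of the circle: \<open>None\<close>
  is the basepoint, \<open>Some xs\<close> an \<open>n\<close>-tuple without basepoint entries.\<close>

definition sphere :: "nat list option spectrum" where
  "sphere = \<lparr>
     lev = (\<lambda>n. \<lparr>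
       simplices = (\<lambda>q. insert None (Some ` {xs. length xs = n \<and> set xs \<subseteq> {1..q}})),
       pt = (\<lambda>q. None),
       sop = (\<lambda>q r \<alpha> s. case s of None \<Rightarrow> None
         | Some xs \<Rightarrow> (let ys = map (circle_op r \<alpha>) xs in if 0 \<in> set ys then None else Some ys)) \<rparr>),
     sact = (\<lambda>n \<sigma> q. map_option (permute_list (inv \<sigma>))),
     smap = (\<lambda>n q s x. case s of None \<Rightarrow> None
       | Some xs \<Rightarrow> (if x = 0 then None else Some (xs @ [x]))) \<rparr>"

text \<open>The iterated structure map \<open>X\<^sub>n \<and> S\<^sup>m \<rightarrow> X\<^sub>n\<^sub>+\<^sub>m\<close>\<close>

definition sph_act :: "'x spectrum \<Rightarrow> nat \<Rightarrow> nat \<Rightarrow> nat \<Rightarrow> 'x \<Rightarrow> nat list option \<Rightarrow> 'x" where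
  "sph_act X n m q x s =
     (case s of None \<Rightarrow> pt (lev X (n + m)) q | Some xs \<Rightarrow> iter_smap X n q x xs)"

locale symmetric_spectrum =
  fixes X :: "'x spectrum"
  assumes lev_bsset: "based_simplicial_set (lev X n)"
    and sact_simplex: "\<lbrakk>\<sigma> permutes {..<n}; x \<in> simplices (lev X n) q\<rbrakk>
      \<Longrightarrow> sact X n \<sigma> q x \<in> simplices (lev X n) q"
    and sact_pt: "\<sigma> permutes {..<n} \<Longrightarrow> sact X n \<sigma> q (pt (lev X n) q) = pt (lev X n) q"
    and sact_sop: "\<lbrakk>\<sigma> permutes {..<n}; mono_map r q \<alpha>; x \<in> simplices (lev X n) q\<rbrakk>
      \<Longrightarrow> sact X n \<sigma> r (sop (lev X n) q r \<alpha> x) = sop (lev X n) q r \<alpha> (sact X n \<sigma> q x)"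
    and sact_id: "x \<in> simplices (lev X n) q \<Longrightarrow> sact X n id q x = x"
    and sact_comp: "\<lbrakk>\<sigma> permutes {..<n}; \<tau> permutes {..<n}; x \<in> simplices (lev X n) q\<rbrakk>
      \<Longrightarrow> sact X n (\<sigma> \<circ> \<tau>) q x = sact X n \<sigma> q (sact X n \<tau> q x)"
    and smap_simplex: "\<lbrakk>x \<in> simplices (lev X n) q; s \<le> q\<rbrakk>
      \<Longrightarrow> smap X n q x s \<in> simplices (lev X (Suc n)) q"
    and smap_pt: "s \<le> q \<Longrightarrow> smap X n q (pt (lev X n) q) s = pt (lev X (Suc n)) q"
    and smap_zero: "x \<in> simplices (lev X n) q \<Longrightarrow> smap X n q x 0 = pt (lev X (Suc n)) q"
    and smap_sop: "\<lbrakk>mono_map r q \<alpha>; x \<in> simplices (lev X n) q; s \<le> q\<rbrakk>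
      \<Longrightarrow> sop (lev X (Suc n)) q r \<alpha> (smap X n q x s)
        = smap X n r (sop (lev X n) q r \<alpha> x) (circle_op r \<alpha> s)"
    and sph_act_equivariant: "\<lbrakk>\<sigma> permutes {..<n}; \<tau> permutes {..<m};
        x \<in> simplices (lev X n) q; u \<in> simplices (lev sphere m) q\<rbrakk>
      \<Longrightarrow> sph_act X n m q (sact X n \<sigma> q x) (sact sphere m \<tau> q u)
        = sact X (n + m) (block_sum n \<sigma> \<tau>) q (sph_act X n m q x u)"

text \<open>A map of spectra is a family of functions, indexed by level and simplicial degree.\<close>

type_synonym ('x, 'y) smor = "nat \<Rightarrow> nat \<Rightarrow> 'x \<Rightarrow> 'y"

definition spectrum_map :: "'x spectrum \<Rightarrow> 'y spectrum \<Rightarrow> ('x, 'y) smor \<Rightarrow> bool" where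
  "spectrum_map X Y f \<longleftrightarrow>
     (\<forall>n q. \<forall>x \<in> simplices (lev X n) q. f n q x \<in> simplices (lev Y n) q)
   \<and> (\<forall>n q. f n q (pt (lev X n) q) = pt (lev Y n) q)
   \<and> (\<forall>n q r \<alpha>. \<forall>x \<in> simplices (lev X n) q. mono_map r q \<alpha> \<longrightarrow>
        f n r (sop (lev X n) q r \<alpha> x) = sop (lev Y n) q r \<alpha> (f n q x))
   \<and> (\<forall>n q \<sigma>. \<forall>x \<in> simplices (lev X n) q. \<sigma> permutes {..<n} \<longrightarrow>
        f n q (sact X n \<sigma> q x) = sact Y n \<sigma> q (f n q x))
   \<and> (\<forall>n q. \<forall>x \<in> simplices (lev X n) q. \<forall>s\<le>q.
        f (Suc n) q (smap X n q x s) = smap Y n q (f n q x) s)"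

definition eq_on_spectrum :: "'x spectrum \<Rightarrow> ('x, 'y) smor \<Rightarrow> ('x, 'y) smor \<Rightarrow> bool" where
  "eq_on_spectrum X f g \<longleftrightarrow> (\<forall>n q. \<forall>x \<in> simplices (lev X n) q. f n q x = g n q x)"

definition smor_comp :: "('y, 'z) smor \<Rightarrow> ('x, 'y) smor \<Rightarrow> ('x, 'z) smor" (infixl "\<circ>\<^sub>S" 60) where
  "(g \<circ>\<^sub>S f) n q x = g n q (f n q x)"

definition smor_id :: "('x, 'x) smor" where
  "smor_id n q x = x"


section \<open>The smash product of symmetric spectra and its monoids\<close>

text \<open>\<open>X \<and> Y\<close> is the coequalizer of the two maps \<open>X \<otimes> S \<otimes> Y \<rightarrow> X \<otimes> Y\<close> given by the (right) action
  of the sphere spectrum \<open>S\<close> on \<open>X\<close> and by the left action on \<open>Y\<close> obtained from the right one by a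
  block transposition, where \<open>(X \<otimes> Y)\<^sub>n\<close> is the wedge over \<open>p + r = n\<close> of
  \<open>(\<Sigma>\<^sub>n)\<^sub>+ \<and>\<^bsub>\<Sigma>\<^sub>p \<times> \<Sigma>\<^sub>r\<^esub> (X\<^sub>p \<and> Y\<^sub>r)\<close>.  Accordingly a \<open>q\<close>-simplex of \<open>(X \<and> Y)\<^sub>n\<close> is an equivalence
  class of tuples \<open>(\<sigma>, p, r, x, y)\<close>.  The basepoint of \<open>S\<close> need not be excluded in \<open>balance\<close>.\<close>

type_synonym ('x, 'y) smash_rep = "(nat \<Rightarrow> nat) \<times> nat \<times> nat \<times> 'x \<times> 'y"

definition smash_reps :: "'x spectrum \<Rightarrow> 'y spectrum \<Rightarrow> nat \<Rightarrow> nat \<Rightarrow> ('x, 'y) smash_rep set" where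
  "smash_reps X Y n q = {(\<sigma>, p, r, x, y). \<sigma> permutes {..<n} \<and> p + r = n
     \<and> x \<in> simplices (lev X p) q \<and> y \<in> simplices (lev Y r) q}"

definition sph_act_left :: "'y spectrum \<Rightarrow> nat \<Rightarrow> nat \<Rightarrow> nat \<Rightarrow> nat list option \<Rightarrow> 'y \<Rightarrow> 'y" where
  "sph_act_left Y m r q s y = sact Y (m + r) (block_swap r m) q (sph_act Y r m q y s)"

inductive smash_gen ::
  "'x spectrum \<Rightarrow> 'y spectrum \<Rightarrow> nat \<Rightarrow> ('x, 'y) smash_rep \<Rightarrow> ('x, 'y) smash_rep \<Rightarrow> bool"
  for X Y q where
  equivariance: "\<lbrakk>\<sigma> permutes {..<p + r}; \<tau> permutes {..<p}; \<upsilon> permutes {..<r};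
      x \<in> simplices (lev X p) q; y \<in> simplices (lev Y r) q\<rbrakk>
    \<Longrightarrow> smash_gen X Y q (\<sigma> \<circ> block_sum p \<tau> \<upsilon>, p, r, x, y)
          (\<sigma>, p, r, sact X p \<tau> q x, sact Y r \<upsilon> q y)"
| base_left: "\<lbrakk>\<sigma> permutes {..<p + r}; y \<in> simplices (lev Y r) q\<rbrakk>
    \<Longrightarrow> smash_gen X Y q (\<sigma>, p, r, pt (lev X p) q, y)
          (id, p + r, 0, pt (lev X (p + r)) q, pt (lev Y 0) q)"
| base_right: "\<lbrakk>\<sigma> permutes {..<p + r}; x \<in> simplices (lev X p) q\<rbrakk>
    \<Longrightarrow> smash_gen X Y q (\<sigma>, p, r, x, pt (lev Y r) q)
          (id, p + r, 0, pt (lev X (p + r)) q, pt (lev Y 0) q)"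
| balance: "\<lbrakk>\<sigma> permutes {..<p + m + r}; x \<in> simplices (lev X p) q;
      s \<in> simplices (lev sphere m) q; y \<in> simplices (lev Y r) q\<rbrakk>
    \<Longrightarrow> smash_gen X Y q (\<sigma>, p + m, r, sph_act X p m q x s, y)
          (\<sigma>, p, m + r, x, sph_act_left Y m r q s y)"

definition smash_class ::
  "'x spectrum \<Rightarrow> 'y spectrum \<Rightarrow> nat \<Rightarrow> ('x, 'y) smash_rep \<Rightarrow> ('x, 'y) smash_rep set" where
  "smash_class X Y q t = {u. equivclp (smash_gen X Y q) t u}"

text \<open>The functions below are defined on classes through a chosen representative; for symmetric
  spectra (and maps of such) the choice is immaterial because the formulas respect
  \<^const>\<open>smash_gen\<close>.\<close>

definition class_rep :: "'t set \<Rightarrow> 't" where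
  "class_rep c = (SOME t. t \<in> c)"

definition smash :: "'x spectrum \<Rightarrow> 'y spectrum \<Rightarrow> ('x, 'y) smash_rep set spectrum" where
  "smash X Y = \<lparr>
     lev = (\<lambda>n. \<lparr>
       simplices = (\<lambda>q. smash_class X Y q ` smash_reps X Y n q),
       pt = (\<lambda>q. smash_class X Y q (id, n, 0, pt (lev X n) q, pt (lev Y 0) q)),
       sop = (\<lambda>q r \<alpha> c. case class_rep c of (\<sigma>, p, p', x, y) \<Rightarrow>
         smash_class X Y r (\<sigma>, p, p', sop (lev X p) q r \<alpha> x, sop (lev Y p') q r \<alpha> y)) \<rparr>),
     sact = (\<lambda>n \<tau> q c. case class_rep c of (\<sigma>, p, r, x, y) \<Rightarrow>
       smash_class X Y q (\<tau> \<circ> \<sigma>, p, r, x, y)),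
     smap = (\<lambda>n q c s. case class_rep c of (\<sigma>, p, r, x, y) \<Rightarrow>
       smash_class X Y q (\<sigma>, p, Suc r, x, smap Y r q y s)) \<rparr>"

definition smash_map :: "'x' spectrum \<Rightarrow> 'y' spectrum \<Rightarrow> ('x, 'x') smor \<Rightarrow> ('y, 'y') smor
    \<Rightarrow> (('x, 'y) smash_rep set, ('x', 'y') smash_rep set) smor" where
  "smash_map X' Y' f g n q c = (case class_rep c of (\<sigma>, p, r, x, y) \<Rightarrow>
     smash_class X' Y' q (\<sigma>, p, r, f p q x, g r q y))"

text \<open>Associativity and unit isomorphisms
  \<open>(X \<and> Y) \<and> Z \<rightarrow> X \<and> (Y \<and> Z)\<close>, \<open>S \<and> X \<rightarrow> X\<close> and \<open>X \<and> S \<rightarrow> X\<close>\<close>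

definition smash_assoc :: "'x spectrum \<Rightarrow> 'y spectrum \<Rightarrow> 'z spectrum \<Rightarrow>
    ((('x, 'y) smash_rep set, 'z) smash_rep set, ('x, ('y, 'z) smash_rep set) smash_rep set) smor"
  where
  "smash_assoc X Y Z n q c = (case class_rep c of (\<sigma>, pr, t, w, z) \<Rightarrow>
     (case class_rep w of (\<tau>, p, r, x, y) \<Rightarrow>
       smash_class X (smash Y Z) q
         (\<sigma> \<circ> block_sum pr \<tau> id, p, r + t, x, smash_class Y Z q (id, r, t, y, z))))"

definition smash_unit_left ::
  "'x spectrum \<Rightarrow> ((nat list option, 'x) smash_rep set, 'x) smor" where
  "smash_unit_left X n q c = (case class_rep c of (\<sigma>, m, r, s, x) \<Rightarrow>
     sact X n \<sigma> q (sph_act_left X m r q s x))"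

definition smash_unit_right ::
  "'x spectrum \<Rightarrow> (('x, nat list option) smash_rep set, 'x) smor" where
  "smash_unit_right X n q c = (case class_rep c of (\<sigma>, p, m, x, s) \<Rightarrow>
     sact X n \<sigma> q (sph_act X p m q x s))"

text \<open>\<open>(X, \<mu>, \<eta>)\<close> is a monoid in the monoidal category of symmetric spectra.\<close>

definition ring_spectrum :: "'x spectrum \<Rightarrow> (('x, 'x) smash_rep set, 'x) smor
    \<Rightarrow> (nat list option, 'x) smor \<Rightarrow> bool" where
  "ring_spectrum X \<mu> \<eta> \<longleftrightarrow>
     symmetric_spectrum X
   \<and> spectrum_map (smash X X) X \<mu>
   \<and> spectrum_map sphere X \<eta>
   \<and> eq_on_spectrum (smash (smash X X) X)
       (\<mu> \<circ>\<^sub>S smash_map X X \<mu> smor_id)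
       (\<mu> \<circ>\<^sub>S smash_map X X smor_id \<mu> \<circ>\<^sub>S smash_assoc X X X)
   \<and> eq_on_spectrum (smash sphere X) (\<mu> \<circ>\<^sub>S smash_map X X \<eta> smor_id) (smash_unit_left X)
   \<and> eq_on_spectrum (smash X sphere) (\<mu> \<circ>\<^sub>S smash_map X X smor_id \<eta>) (smash_unit_right X)"


section \<open>The categories of systems\<close>

text \<open>The finite based sets are finite subsets of \<open>nat\<close> with basepoint \<open>0\<close>; coordinates are
  counted from \<open>0\<close>.  All components of systems are \<open>undefined\<close> outside their index sets.
  For the empty tuple \<open>[]\<close> of based sets a system is just an object of \<open>C\<close>.\<close>

type_synonym ('o, 'm) sys =
  "(nat set list \<Rightarrow> 'o) \<times> (nat set list \<Rightarrow> nat \<Rightarrow> nat set \<Rightarrow> nat set \<Rightarrow> 'm)"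

type_synonym ('o, 'm) sys_ar = "('o, 'm) sys \<times> ('o, 'm) sys \<times> (nat set list \<Rightarrow> 'm)"

definition sys_index :: "nat set list \<Rightarrow> nat set list set" where
  "sys_index As = {Ss. length Ss = length As \<and> (\<forall>i<length As. Ss ! i \<subseteq> As ! i - {0})}"

definition split_at :: "nat set list \<Rightarrow> nat \<Rightarrow> nat set \<Rightarrow> nat set \<Rightarrow> bool" where
  "split_at Ss i T U \<longleftrightarrow> i < length Ss \<and> T \<inter> U = {} \<and> T \<union> U = Ss ! i"

definition mk_sys :: "nat set list \<Rightarrow> (nat set list \<Rightarrow> 'o)
    \<Rightarrow> (nat set list \<Rightarrow> nat \<Rightarrow> nat set \<Rightarrow> nat set \<Rightarrow> 'm) \<Rightarrow> ('o, 'm) sys" where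
  "mk_sys As c \<rho> = (restrict c (sys_index As),
     \<lambda>Ss i T U. if Ss \<in> sys_index As \<and> split_at Ss i T U then \<rho> Ss i T U else undefined)"

definition is_sys ::
  "('o, 'm, 'z) perm_cat_scheme \<Rightarrow> nat set list \<Rightarrow> ('o, 'm) sys \<Rightarrow> bool" where
  "is_sys C As X \<longleftrightarrow> (case X of (c, \<rho>) \<Rightarrow>
     mk_sys As c \<rho> = (c, \<rho>)
   \<and> (\<forall>Ss \<in> sys_index As. c Ss \<in> Ob C)
   \<and> (\<forall>Ss \<in> sys_index As. {} \<in> set Ss \<longrightarrow> c Ss = \<zero>\<^bsub>C\<^esub>)
   \<and> (\<forall>Ss \<in> sys_index As. \<forall>i T U. split_at Ss i T U \<longrightarrow>
        \<rho> Ss i T U \<in> Hom C (c (Ss[i := T]) \<oplus>\<^bsub>C\<^esub> c (Ss[i := U])) (c Ss))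
   \<and> (\<forall>Ss \<in> sys_index As. \<forall>i T U. split_at Ss i T U \<longrightarrow> {} \<in> set Ss \<union> {T, U} \<longrightarrow>
        \<rho> Ss i T U = Id C (c Ss))
   \<and> (\<forall>Ss \<in> sys_index As. \<forall>i T U. split_at Ss i T U \<longrightarrow>
        \<rho> Ss i U T \<cdot>\<^bsub>C\<^esub> \<gamma>\<^bsub>C\<^esub> (c (Ss[i := T])) (c (Ss[i := U])) = \<rho> Ss i T U)
   \<and> (\<forall>Ss \<in> sys_index As. \<forall>i T U V. split_at Ss i (T \<union> U) V \<longrightarrow> T \<inter> U = {} \<longrightarrow>
        \<rho> Ss i (T \<union> U) V \<cdot>\<^bsub>C\<^esub> (\<rho> (Ss[i := T \<union> U]) i T U \<boxplus>\<^bsub>C\<^esub> Id C (c (Ss[i := V])))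
      = \<rho> Ss i T (U \<union> V) \<cdot>\<^bsub>C\<^esub> (Id C (c (Ss[i := T])) \<boxplus>\<^bsub>C\<^esub> \<rho> (Ss[i := U \<union> V]) i U V))
   \<and> (\<forall>Ss \<in> sys_index As. \<forall>i j T U V W. i \<noteq> j \<longrightarrow> split_at Ss i T U \<longrightarrow> split_at Ss j V W \<longrightarrow>
        \<rho> Ss j V W \<cdot>\<^bsub>C\<^esub> (\<rho> (Ss[j := V]) i T U \<boxplus>\<^bsub>C\<^esub> \<rho> (Ss[j := W]) i T U)
      = \<rho> Ss i T U \<cdot>\<^bsub>C\<^esub> (\<rho> (Ss[i := T]) j V W \<boxplus>\<^bsub>C\<^esub> \<rho> (Ss[i := U]) j V W)
          \<cdot>\<^bsub>C\<^esub> mid_swap C (c (Ss[i := T, j := V])) (c (Ss[i := U, j := V]))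
                         (c (Ss[i := T, j := W])) (c (Ss[i := U, j := W]))))"

definition is_sys_ar ::
  "('o, 'm, 'z) perm_cat_scheme \<Rightarrow> nat set list \<Rightarrow> ('o, 'm) sys_ar \<Rightarrow> bool" where
  "is_sys_ar C As F \<longleftrightarrow> (case F of ((c, \<rho>), (c', \<rho>'), \<phi>) \<Rightarrow>
     is_sys C As (c, \<rho>) \<and> is_sys C As (c', \<rho>')
   \<and> \<phi> \<in> extensional (sys_index As)
   \<and> (\<forall>Ss \<in> sys_index As. \<phi> Ss \<in> Hom C (c Ss) (c' Ss))
   \<and> (\<forall>Ss \<in> sys_index As. {} \<in> set Ss \<longrightarrow> \<phi> Ss = Id C \<zero>\<^bsub>C\<^esub>)
   \<and> (\<forall>Ss \<in> sys_index As. \<forall>i T U. split_at Ss i T U \<longrightarrow>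
        \<phi> Ss \<cdot>\<^bsub>C\<^esub> \<rho> Ss i T U = \<rho>' Ss i T U \<cdot>\<^bsub>C\<^esub> (\<phi> (Ss[i := T]) \<boxplus>\<^bsub>C\<^esub> \<phi> (Ss[i := U]))))"

definition sys_cat ::
  "('o, 'm, 'z) perm_cat_scheme \<Rightarrow> nat set list \<Rightarrow> (('o, 'm) sys, ('o, 'm) sys_ar) cat" where
  "sys_cat C As = \<lparr>
     Ob = {X. is_sys C As X},
     Ar = {F. is_sys_ar C As F},
     Dom = (\<lambda>(X, Y, \<phi>). X),
     Cod = (\<lambda>(X, Y, \<phi>). Y),
     Id = (\<lambda>X. (X, X, \<lambda>Ss \<in> sys_index As. Id C (fst X Ss))),
     Cmp = (\<lambda>(Y, Z, \<psi>) (X, Y', \<phi>). (X, Z, \<lambda>Ss \<in> sys_index As. \<psi> Ss \<cdot>\<^bsub>C\<^esub> \<phi> Ss)) \<rparr>"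

definition zero_sys :: "('o, 'm, 'z) perm_cat_scheme \<Rightarrow> nat set list \<Rightarrow> ('o, 'm) sys" where
  "zero_sys C As = mk_sys As (\<lambda>Ss. \<zero>\<^bsub>C\<^esub>) (\<lambda>Ss i T U. Id C \<zero>\<^bsub>C\<^esub>)"

text \<open>Functoriality in based maps \<open>gs ! i : As ! i \<rightarrow> Bs ! i\<close>\<close>

definition preimage :: "nat set list \<Rightarrow> (nat \<Rightarrow> nat) list \<Rightarrow> nat \<Rightarrow> nat set \<Rightarrow> nat set" where
  "preimage As gs i S = {a \<in> As ! i. (gs ! i) a \<in> S}"

definition preimages :: "nat set list \<Rightarrow> (nat \<Rightarrow> nat) list \<Rightarrow> nat set list \<Rightarrow> nat set list" where
  "preimages As gs Ss = map (\<lambda>i. preimage As gs i (Ss ! i)) [0..<length Ss]"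

definition push_sys :: "nat set list \<Rightarrow> nat set list \<Rightarrow> (nat \<Rightarrow> nat) list
    \<Rightarrow> ('o, 'm) sys \<Rightarrow> ('o, 'm) sys" where
  "push_sys As Bs gs = (\<lambda>(c, \<rho>). mk_sys Bs (\<lambda>Ss. c (preimages As gs Ss))
     (\<lambda>Ss i T U. \<rho> (preimages As gs Ss) i (preimage As gs i T) (preimage As gs i U)))"

definition push_ar :: "nat set list \<Rightarrow> nat set list \<Rightarrow> (nat \<Rightarrow> nat) list
    \<Rightarrow> ('o, 'm) sys_ar \<Rightarrow> ('o, 'm) sys_ar" where
  "push_ar As Bs gs = (\<lambda>(X, Y, \<phi>). (push_sys As Bs gs X, push_sys As Bs gs Y,
     \<lambda>Ss \<in> sys_index Bs. \<phi> (preimages As gs Ss)))"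


section \<open>The spectrum \<open>K C\<close>\<close>

text \<open>A \<open>q\<close>-simplex of the nerve is a functor from the poset \<open>{0..q}\<close>, given by its values \<open>f i j\<close>
  on the arrows \<open>i \<le> j\<close>.\<close>

definition mk_nerve :: "nat \<Rightarrow> (nat \<Rightarrow> nat \<Rightarrow> 'm) \<Rightarrow> nat \<Rightarrow> nat \<Rightarrow> 'm" where
  "mk_nerve q f i j = (if i \<le> j \<and> j \<le> q then f i j else undefined)"

definition nerve :: "('o, 'm, 'z) cat_scheme \<Rightarrow> nat \<Rightarrow> (nat \<Rightarrow> nat \<Rightarrow> 'm) set" where
  "nerve C q = {f. mk_nerve q f = f
     \<and> (\<exists>x. (\<forall>i\<le>q. x i \<in> Ob C \<and> f i i = Id C (x i))
          \<and> (\<forall>i j. i \<le> j \<longrightarrow> j \<le> q \<longrightarrow> f i j \<in> Hom C (x i) (x j)))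
     \<and> (\<forall>i j k. i \<le> j \<longrightarrow> j \<le> k \<longrightarrow> k \<le> q \<longrightarrow> f j k \<cdot>\<^bsub>C\<^esub> f i j = f i k)}"

type_synonym ('o, 'm) K_simplex = "nat \<Rightarrow> nat \<Rightarrow> ('o, 'm) sys_ar"

definition circles :: "nat \<Rightarrow> nat \<Rightarrow> nat set list" where
  "circles n q = replicate n {0..q}"

definition K_sact_sys :: "nat \<Rightarrow> (nat \<Rightarrow> nat) \<Rightarrow> nat \<Rightarrow> ('o, 'm) sys \<Rightarrow> ('o, 'm) sys" where
  "K_sact_sys n \<sigma> q = (\<lambda>(c, \<rho>). mk_sys (circles n q) (\<lambda>Ss. c (permute_list \<sigma> Ss))
     (\<lambda>Ss i T U. \<rho> (permute_list \<sigma> Ss) (inv \<sigma> i) T U))"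

definition K_sact_ar :: "nat \<Rightarrow> (nat \<Rightarrow> nat) \<Rightarrow> nat \<Rightarrow> ('o, 'm) sys_ar \<Rightarrow> ('o, 'm) sys_ar" where
  "K_sact_ar n \<sigma> q = (\<lambda>(X, Y, \<phi>). (K_sact_sys n \<sigma> q X, K_sact_sys n \<sigma> q Y,
     \<lambda>Ss \<in> sys_index (circles n q). \<phi> (permute_list \<sigma> Ss)))"

text \<open>In the structure map the new coordinate comes last.  For \<open>s = 0\<close> the result is the zero
  system, as no index set contains the basepoint.  In the last coordinate all structure
  morphisms of the new system are identities.\<close>

definition K_smap_sys :: "('o, 'm, 'z) perm_cat_scheme \<Rightarrow> nat \<Rightarrow> nat
    \<Rightarrow> ('o, 'm) sys \<Rightarrow> nat \<Rightarrow> ('o, 'm) sys" where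
  "K_smap_sys C n q = (\<lambda>(c, \<rho>) s.
     let c' = (\<lambda>Ss. if s \<in> last Ss then c (butlast Ss) else \<zero>\<^bsub>C\<^esub>)
     in mk_sys (circles (Suc n) q) c'
          (\<lambda>Ss i T U. if i < n \<and> s \<in> last Ss then \<rho> (butlast Ss) i T U else Id C (c' Ss)))"

definition K_smap_ar :: "('o, 'm, 'z) perm_cat_scheme \<Rightarrow> nat \<Rightarrow> nat
    \<Rightarrow> ('o, 'm) sys_ar \<Rightarrow> nat \<Rightarrow> ('o, 'm) sys_ar" where
  "K_smap_ar C n q = (\<lambda>(X, Y, \<phi>) s. (K_smap_sys C n q X s, K_smap_sys C n q Y s,
     \<lambda>Ss \<in> sys_index (circles (Suc n) q). if s \<in> last Ss then \<phi> (butlast Ss) else Id C \<zero>\<^bsub>C\<^esub>))"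

text \<open>The operators of the \<open>n\<close>-th simplicial set combine those of the nerve with the maps induced
  by the operators of the circle.\<close>

definition K_spectrum :: "('o, 'm, 'z) perm_cat_scheme \<Rightarrow> ('o, 'm) K_simplex spectrum" where
  "K_spectrum C = \<lparr>
     lev = (\<lambda>n. \<lparr>
       simplices = (\<lambda>q. nerve (sys_cat C (circles n q)) q),
       pt = (\<lambda>q. mk_nerve q (\<lambda>i j. Id (sys_cat C (circles n q)) (zero_sys C (circles n q)))),
       sop = (\<lambda>q r \<alpha> f. mk_nerve r (\<lambda>i j.
         push_ar (circles n q) (circles n r) (replicate n (circle_op r \<alpha>)) (f (\<alpha> i) (\<alpha> j)))) \<rparr>),
     sact = (\<lambda>n \<sigma> q f. mk_nerve q (\<lambda>i j. K_sact_ar n \<sigma> q (f i j))),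
     smap = (\<lambda>n q f s. mk_nerve q (\<lambda>i j. K_smap_ar C n q (f i j) s)) \<rparr>"


section \<open>\<open>K\<close> on multilinear maps\<close>

text \<open>For arities \<open>ps = [p\<^sub>1, \<dots>, p\<^sub>k]\<close> an index tuple of length \<open>p\<^sub>1 + \<dots> + p\<^sub>k\<close> is cut into \<open>k\<close>
  blocks; coordinate \<open>i\<close> lies in block number \<open>block_of ps i\<close>, which starts at
  \<open>offset ps (block_of ps i)\<close>.\<close>

definition offset :: "nat list \<Rightarrow> nat \<Rightarrow> nat" where
  "offset ps b = sum_list (take b ps)"

definition block_of :: "nat list \<Rightarrow> nat \<Rightarrow> nat" where
  "block_of ps i = (LEAST b. i < offset ps (Suc b))"

definition block :: "nat list \<Rightarrow> nat \<Rightarrow> 'a list \<Rightarrow> 'a list" where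
  "block ps b Ss = take (ps ! b) (drop (offset ps b) Ss)"

text \<open>The value of \<open>K\<close> on a \<open>k\<close>-linear map \<open>f : C\<^sub>1 \<times> \<dots> \<times> C\<^sub>k \<rightarrow> D\<close>, with \<open>Cs = [C\<^sub>1, \<dots>, C\<^sub>k]\<close>\<close>

definition K_map_ob :: "('o, 'm) lin_map \<Rightarrow> nat list \<Rightarrow> ('o, 'm) sys list
    \<Rightarrow> nat set list \<Rightarrow> 'o list" where
  "K_map_ob f ps Xs Ss = map (\<lambda>b. fst (Xs ! b) (block ps b Ss)) [0..<length ps]"

definition K_map_sys :: "('o, 'm, 'z) perm_cat_scheme list \<Rightarrow> ('o, 'm, 'z) perm_cat_scheme
    \<Rightarrow> ('o, 'm) lin_map \<Rightarrow> nat \<Rightarrow> nat list \<Rightarrow> ('o, 'm) sys list \<Rightarrow> ('o, 'm) sys" where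
  "K_map_sys Cs D f q ps Xs = mk_sys (circles (sum_list ps) q)
     (\<lambda>Ss. lin_ob f (K_map_ob f ps Xs Ss))
     (\<lambda>Ss i T U.
        let b = block_of ps i;
            ids = map (\<lambda>a. Id (Cs ! a) (K_map_ob f ps Xs Ss ! a)) [0..<length ps];
            \<rho> = snd (Xs ! b) (block ps b Ss) (i - offset ps b) T U
        in lin_ar f (ids[b := \<rho>]) \<cdot>\<^bsub>D\<^esub>
             lin_dist f b (K_map_ob f ps Xs (Ss[i := T])) (K_map_ob f ps Xs (Ss[i := U]) ! b))"

definition K_map_ar :: "('o, 'm, 'z) perm_cat_scheme list \<Rightarrow> ('o, 'm, 'z) perm_cat_scheme
    \<Rightarrow> ('o, 'm) lin_map \<Rightarrow> nat \<Rightarrow> nat list \<Rightarrow> ('o, 'm) sys_ar list \<Rightarrow> ('o, 'm) sys_ar" where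
  "K_map_ar Cs D f q ps Fs = (
     K_map_sys Cs D f q ps (map (\<lambda>(X, Y, \<phi>). X) Fs),
     K_map_sys Cs D f q ps (map (\<lambda>(X, Y, \<phi>). Y) Fs),
     \<lambda>Ss \<in> sys_index (circles (sum_list ps) q).
       lin_ar f (map (\<lambda>b. snd (snd (Fs ! b)) (block ps b Ss)) [0..<length ps]))"

definition K_map :: "('o, 'm, 'z) perm_cat_scheme list \<Rightarrow> ('o, 'm, 'z) perm_cat_scheme
    \<Rightarrow> ('o, 'm) lin_map \<Rightarrow> nat \<Rightarrow> nat list \<Rightarrow> ('o, 'm) K_simplex list \<Rightarrow> ('o, 'm) K_simplex" where
  "K_map Cs D f q ps xs = mk_nerve q (\<lambda>i j. K_map_ar Cs D f q ps (map (\<lambda>x. x i j) xs))"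

text \<open>The map \<open>X \<and> Y \<rightarrow> Z\<close> induced by maps \<open>X\<^sub>p \<and> Y\<^sub>r \<rightarrow> Z\<^sub>p\<^sub>+\<^sub>r\<close>, and the map from the sphere
  spectrum determined by a vertex of level \<open>0\<close>\<close>

definition smash_desc ::
  "'z spectrum \<Rightarrow> (nat \<Rightarrow> nat \<Rightarrow> nat \<Rightarrow> 'x \<Rightarrow> 'y \<Rightarrow> 'z) \<Rightarrow> (('x, 'y) smash_rep set, 'z) smor" where
  "smash_desc Z h n q c = (case class_rep c of (\<sigma>, p, r, x, y) \<Rightarrow> sact Z n \<sigma> q (h p r q x y))"

definition sphere_desc :: "'x spectrum \<Rightarrow> 'x \<Rightarrow> (nat list option, 'x) smor" where
  "sphere_desc X v m q s = sph_act X 0 m q (sop (lev X 0) 0 q (\<lambda>i. 0) v) s"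

text \<open>\<open>K\<close> of a bilinear map \<open>C \<times> C' \<rightarrow> D\<close> and of a \<open>0\<close>-linear map to \<open>D\<close>\<close>

definition K_bilinear :: "('o, 'm, 'z) perm_cat_scheme \<Rightarrow> ('o, 'm, 'z) perm_cat_scheme
    \<Rightarrow> ('o, 'm, 'z) perm_cat_scheme \<Rightarrow> ('o, 'm) lin_map
    \<Rightarrow> ((('o, 'm) K_simplex, ('o, 'm) K_simplex) smash_rep set, ('o, 'm) K_simplex) smor" where
  "K_bilinear C C' D f = smash_desc (K_spectrum D) (\<lambda>p r q x y. K_map [C, C'] D f q [p, r] [x, y])"

definition K_nullary :: "('o, 'm, 'z) perm_cat_scheme \<Rightarrow> ('o, 'm) lin_map
    \<Rightarrow> (nat list option, ('o, 'm) K_simplex) smor" where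
  "K_nullary D f = sphere_desc (K_spectrum D) (K_map [] D f 0 [] [])"

end

theory Submission
  imports Defs
begin

text \<open>A map out of a smash product \<open>X \<and> Y\<close> is the same thing as a family of maps
  \<open>h : X\<^sub>p \<and> Y\<^sub>r \<rightarrow> Z\<^sub>p\<^sub>+\<^sub>r\<close> that is equivariant, commutes with the structure maps of the right
  factor, and takes equal values on \<open>(x u, y)\<close> and \<open>(x, u y)\<close> for \<open>u\<close> in the sphere spectrum
  (locale \<open>bimorphism\<close>).  Hence the axioms of a monoid can be checked on \<open>h\<close> itself: \<open>h\<close> has to be
  associative, and as the sphere spectrum is free on one vertex of level \<open>0\<close>, the unit axioms say
  that a vertex of level \<open>0\<close> is a two-sided unit for \<open>h\<close> (\<open>ring_spectrumI\<close>).

  For \<open>K A\<close> the map \<open>h\<close> is the external product of systems, with value \<open>X P \<otimes> Y R\<close> at the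
  concatenation of the index tuples \<open>P\<close> and \<open>R\<close>.  Its structure maps are \<open>dl\<close> followed by those
  of \<open>X\<close>, or \<open>dr\<close> followed by those of \<open>Y\<close>, according to the block of the split coordinate.  If only
  coordinates of one block vary, it is the image of a system under one of the functors \<open>- \<otimes> b\<close> and
  \<open>a \<otimes> -\<close>; with their distributivity maps they are linear, and linear functors preserve systems
  (\<open>system_image\<close>).  If a coordinate in each block varies, the interchange law is the axiom
  \<open>dl_dr_sum\<close> (\<open>dl_dr_comm\<close>).

  The operators of the simplicial sets and the symmetric groups all act on \<open>K C\<close> by reindexing:
  a system is precomposed with an operation on index tuples that permutes the coordinates and takes
  preimages in each of them.  The iterated structure map inserts coordinates in which a system is
  zero unless given points lie in the index sets.  That \<open>K C\<close> is a symmetric spectrum, and that the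
  external product respects this structure, thus comes down to cutting index tuples into blocks;
  wherever an inserted coordinate is split, one of the two summands is zero, and the normalization
  of the distributivity maps applies.  Associativity of the external product is one of the axioms
  \<open>dl_ten\<close>, \<open>dl_dr_ten\<close>, \<open>dr_ten\<close>, depending on which of the three blocks contains the split
  coordinate, and the unit laws are \<open>dl_one\<close> and \<open>dr_one\<close>.\<close>

section \<open>The action of the sphere spectrum\<close>

text \<open>Just the closure conditions of a symmetric spectrum.  They ensure that related representatives
  are well formed simultaneously, and a smash product inherits them by inspection of a single
  representative.\<close>

locale prespectrum =
  fixes X :: "'x spectrum"
  assumes pt_in: "pt (lev X n) q \<in> simplices (lev X n) q"
    and sact_in: "\<lbrakk>\<sigma> permutes {..<n}; x \<in> simplices (lev X n) q\<rbrakk>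
      \<Longrightarrow> sact X n \<sigma> q x \<in> simplices (lev X n) q"
    and smap_in: "\<lbrakk>x \<in> simplices (lev X n) q; s \<le> q\<rbrakk>
      \<Longrightarrow> smap X n q x s \<in> simplices (lev X (Suc n)) q"
begin

lemma iter_smap_in:
  "\<lbrakk>x \<in> simplices (lev X n) q; set xs \<subseteq> {..q}\<rbrakk>
    \<Longrightarrow> iter_smap X n q x xs \<in> simplices (lev X (n + length xs)) q"
proof (induction xs arbitrary: n x)
  case (Cons s ss)
  then show ?case using Cons.IH[of "smap X n q x s" "Suc n"] smap_in by simp
qed simp

lemma sph_act_in:
  assumes "x \<in> simplices (lev X n) q" "u \<in> simplices (lev sphere m) q"
  shows "sph_act X n m q x u \<in> simplices (lev X (n + m)) q"
proof (cases u)
  case None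
  then show ?thesis by (simp add: sph_act_def pt_in)
next
  case (Some xs)
  then have "length xs = m" "set xs \<subseteq> {..q}" using assms(2) by (auto simp: sphere_def)
  then show ?thesis using iter_smap_in[OF assms(1), of xs] Some by (simp add: sph_act_def)
qed

end

lemma block_sum_comp:
  assumes "\<sigma>' permutes {..<m}"
  shows "block_sum m \<sigma> \<tau> \<circ> block_sum m \<sigma>' \<tau>' = block_sum m (\<sigma> \<circ> \<sigma>') (\<tau> \<circ> \<tau>')"
proof -
  have "\<sigma>' i < m \<longleftrightarrow> i < m" for i using permutes_in_image[OF assms, of i] by simp
  then show ?thesis by (auto simp: fun_eq_iff block_sum_def)
qed

lemma block_sum_id: "block_sum m id id = id"
  by (auto simp: fun_eq_iff block_sum_def)

lemma block_sum_inverses: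
  assumes "\<sigma> permutes {..<m}" "\<tau> permutes {..<n}"
  shows "block_sum m \<sigma> \<tau> \<circ> block_sum m (inv \<sigma>) (inv \<tau>) = id"
    and "block_sum m (inv \<sigma>) (inv \<tau>) \<circ> block_sum m \<sigma> \<tau> = id"
  using assms permutes_inv[OF assms(1)]
  by (simp_all add: block_sum_comp block_sum_id permutes_inv_o)

lemma inv_block_sum:
  "\<lbrakk>\<sigma> permutes {..<m}; \<tau> permutes {..<n}\<rbrakk>
    \<Longrightarrow> inv (block_sum m \<sigma> \<tau>) = block_sum m (inv \<sigma>) (inv \<tau>)"
  by (rule inv_unique_comp) (rule block_sum_inverses; assumption)+

lemma block_sum_permutes:
  assumes "\<sigma> permutes {..<m}" "\<tau> permutes {..<n}"
  shows "block_sum m \<sigma> \<tau> permutes {..<m + n}"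
proof -
  have "block_sum m \<sigma> \<tau> i = i" if "i \<notin> {..<m + n}" for i
    using that permutes_not_in[OF assms(2), of "i - m"] by (auto simp: block_sum_def)
  moreover have "bij (block_sum m \<sigma> \<tau>)" by (rule o_bij[OF block_sum_inverses(2,1)[OF assms]])
  ultimately show ?thesis unfolding permutes_def bij_iff by blast
qed

lemma block_swap_permutes: "block_swap m n permutes {..<m + n}"
proof (rule bij_imp_permutes)
  show "bij_betw (block_swap m n) {..<m + n} {..<m + n}"
    by (rule bij_betw_byWitness[where f' = "block_swap n m"]) (auto simp: block_swap_def)
qed (auto simp: block_swap_def)

lemma block_sum_id_right:
  "\<sigma> permutes {..<n} \<Longrightarrow> block_sum n \<sigma> id = \<sigma>"
  by (rule ext) (auto simp: block_sum_def permutes_not_in)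

lemma block_sum_0: "block_sum 0 \<sigma> \<tau> = \<tau>"
  by (rule ext) (auto simp: block_sum_def)

lemma (in prespectrum) sph_act_left_in:
  assumes "y \<in> simplices (lev X n) q" "u \<in> simplices (lev sphere m) q"
  shows "sph_act_left X m n q u y \<in> simplices (lev X (m + n)) q"
  using sact_in[OF _ sph_act_in[OF assms], of "block_swap n m"] block_swap_permutes[of n m]
  by (simp add: sph_act_left_def add.commute)

sublocale symmetric_spectrum \<subseteq> prespectrum
  using lev_bsset sact_simplex smap_simplex
  by (unfold_locales) (auto simp: based_simplicial_set_def)

lemma circle_op_le: "circle_op r \<alpha> s \<le> r"
  unfolding circle_op_def by (auto intro: order.trans[OF Least_le])

context symmetric_spectrum
begin

lemma iter_smap_pt:
  "set xs \<subseteq> {..q} \<Longrightarrow> iter_smap X n q (pt (lev X n) q) xs = pt (lev X (n + length xs)) q"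
  by (induction xs arbitrary: n) (auto simp: smap_pt)

lemma iter_smap_zero:
  "\<lbrakk>x \<in> simplices (lev X n) q; set xs \<subseteq> {..q}; 0 \<in> set xs\<rbrakk>
    \<Longrightarrow> iter_smap X n q x xs = pt (lev X (n + length xs)) q"
proof (induction xs arbitrary: n x)
  case (Cons s ss)
  show ?case
  proof (cases "s = 0")
    case True
    then show ?thesis using Cons.prems iter_smap_pt[of ss q "Suc n"] by (simp add: smap_zero)
  next
    case False
    then show ?thesis using Cons.IH[of "smap X n q x s" "Suc n"] Cons.prems smap_in by simp
  qed
qed simp

lemma sop_iter_smap:
  "\<lbrakk>mono_map r q \<alpha>; x \<in> simplices (lev X n) q; set xs \<subseteq> {..q}\<rbrakk>
    \<Longrightarrow> sop (lev X (n + length xs)) q r \<alpha> (iter_smap X n q x xs)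
      = iter_smap X n r (sop (lev X n) q r \<alpha> x) (map (circle_op r \<alpha>) xs)"
proof (induction xs arbitrary: n x)
  case (Cons s ss)
  then show ?case using Cons.IH[of "smap X n q x s" "Suc n"] smap_in by (simp add: smap_sop)
qed simp

lemma sop_sph_act:
  assumes "mono_map r q \<alpha>" "x \<in> simplices (lev X n) q" "u \<in> simplices (lev sphere m) q"
  shows "sop (lev X (n + m)) q r \<alpha> (sph_act X n m q x u)
    = sph_act X n m r (sop (lev X n) q r \<alpha> x) (sop (lev sphere m) q r \<alpha> u)"
proof (cases u)
  case None
  then show ?thesis using lev_bsset assms
    by (simp add: sph_act_def sphere_def based_simplicial_set.sop_pt)
next
  case (Some xs)
  then have xs: "length xs = m" "set xs \<subseteq> {..q}" using assms(3) by (auto simp: sphere_def)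
  have eq: "sop (lev X (n + m)) q r \<alpha> (sph_act X n m q x u)
      = iter_smap X n r (sop (lev X n) q r \<alpha> x) (map (circle_op r \<alpha>) xs)"
    using sop_iter_smap[OF assms(1,2) xs(2)] xs(1) Some by (simp add: sph_act_def)
  have "set (map (circle_op r \<alpha>) xs) \<subseteq> {..r}"
    using xs(2) circle_op_le by auto
  then show ?thesis
    using eq xs(1) Some iter_smap_zero[of "sop (lev X n) q r \<alpha> x" n r "map (circle_op r \<alpha>) xs"]
      based_simplicial_set.sop_simplex[OF lev_bsset assms(1,2)]
    by (auto simp: sph_act_def sphere_def Let_def simp del: set_map)
qed

text \<open>A single structure map is the iterated one for a simplex of the sphere with one entry; the
  basepoint of the circle is not such an entry, which accounts for the case \<open>s = 0\<close>.\<close>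

lemma smap_sact:
  assumes "\<sigma> permutes {..<n}" "x \<in> simplices (lev X n) q" "s \<le> q"
  shows "smap X n q (sact X n \<sigma> q x) s = sact X (Suc n) \<sigma> q (smap X n q x s)"
proof (cases "s = 0")
  case True
  have "\<sigma> permutes {..<Suc n}" using assms(1) by (rule permutes_subset) auto
  then show ?thesis using True assms by (simp add: smap_zero sact_in sact_pt)
next
  case False
  then have "Some [s] \<in> simplices (lev sphere 1) q" using assms(3) by (simp add: sphere_def)
  from sph_act_equivariant[OF assms(1) permutes_id assms(2) this] assms(1) show ?thesis
    by (simp add: sph_act_def sphere_def block_sum_id_right[unfolded id_def] id_def)
qed

end

interpretation sphere: prespectrum sphere
proof
  fix n q x and \<sigma> :: "nat \<Rightarrow> nat"
  assume "\<sigma> permutes {..<n}" and "x \<in> simplices (lev sphere n) q"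
  then show "sact sphere n \<sigma> q x \<in> simplices (lev sphere n) q"
    by (auto simp: sphere_def set_permute_list permutes_inv)
next
  fix n q u and s :: nat
  assume "u \<in> simplices (lev sphere n) q" "s \<le> q"
  then show "smap sphere n q u s \<in> simplices (lev sphere (Suc n)) q"
    by (cases "s = 0") (auto simp: sphere_def image_iff)
qed (simp add: sphere_def)

lemma sph_act_comp_spectrum_map:
  assumes "prespectrum X" "spectrum_map X Y f"
    and "x \<in> simplices (lev X n) q" "u \<in> simplices (lev sphere m) q"
  shows "f (n + m) q (sph_act X n m q x u) = sph_act Y n m q (f n q x) u"
proof (cases u)
  case None
  then show ?thesis using assms(2) by (simp add: sph_act_def spectrum_map_def)
next
  case (Some xs)
  interpret prespectrum X by fact
  have "set xs \<subseteq> {..q}" and m: "length xs = m" using assms(4) Some by (auto simp: sphere_def)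
  from this(1) assms(3)
  have "f (n + length xs) q (iter_smap X n q x xs) = iter_smap Y n q (f n q x) xs"
  proof (induction xs arbitrary: n x)
    case (Cons s ss)
    moreover have "f (Suc n) q (smap X n q x s) = smap Y n q (f n q x) s"
      using assms(2) Cons.prems by (auto simp: spectrum_map_def)
    ultimately show ?case using Cons.IH[of "smap X n q x s" "Suc n"] smap_in by simp
  qed simp
  then show ?thesis using Some m by (simp add: sph_act_def)
qed

lemma sph_act_left_comp_spectrum_map:
  assumes "prespectrum X" "spectrum_map X Y f"
    and "x \<in> simplices (lev X n) q" "u \<in> simplices (lev sphere m) q"
  shows "f (m + n) q (sph_act_left X m n q u x) = sph_act_left Y m n q u (f n q x)"
  using assms(2) sph_act_comp_spectrum_map[OF assms] prespectrum.sph_act_in[OF assms(1,3,4)]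
    block_swap_permutes[of n m]
  by (simp add: spectrum_map_def sph_act_left_def add.commute)


section \<open>Maps out of smash products\<close>

text \<open>Chosen representatives are therefore well formed.\<close>

lemma smash_gen_reps:
  assumes "prespectrum X" "prespectrum Y" "smash_gen X Y q t u"
  shows "t \<in> smash_reps X Y n q \<longleftrightarrow> u \<in> smash_reps X Y n q"
  using assms(3)
proof cases
  case (equivariance \<sigma> p r \<tau> \<upsilon> x y)
  interpret X: prespectrum X by fact
  interpret Y: prespectrum Y by fact
  from equivariance show ?thesis
    by (auto simp: smash_reps_def X.sact_in Y.sact_in intro!: permutes_compose block_sum_permutes)
next
  case (base_left \<sigma> p r y)
  then show ?thesis
    by (auto simp: smash_reps_def prespectrum.pt_in assms(1,2) permutes_id)
next
  case (base_right \<sigma> p r x)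
  then show ?thesis
    by (auto simp: smash_reps_def prespectrum.pt_in assms(1,2) permutes_id)
next
  case (balance \<sigma> p m r x s y)
  then show ?thesis
    by (auto simp: smash_reps_def prespectrum.sph_act_in prespectrum.sph_act_left_in assms(1,2) add.assoc)
qed

lemma equivclp_smash_reps:
  assumes "prespectrum X" "prespectrum Y" "equivclp (smash_gen X Y q) t u"
  shows "t \<in> smash_reps X Y n q \<longleftrightarrow> u \<in> smash_reps X Y n q"
  using assms(3) by (induction rule: equivclp_induct) (auto simp: smash_gen_reps[OF assms(1,2)])

lemma smash_class_eq: "equivclp (smash_gen X Y q) t u \<Longrightarrow> smash_class X Y q t = smash_class X Y q u"
  unfolding smash_class_def by (blast intro: equivclp_trans equivclp_sym)

lemma class_rep_smash_class: "equivclp (smash_gen X Y q) t (class_rep (smash_class X Y q t))"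
proof -
  have "t \<in> smash_class X Y q t" by (simp add: smash_class_def)
  then have "class_rep (smash_class X Y q t) \<in> smash_class X Y q t"
    unfolding class_rep_def by (rule someI)
  then show ?thesis by (simp add: smash_class_def)
qed

lemma equivclp_map:
  assumes "equivclp R t u" "\<And>t u. R t u \<Longrightarrow> equivclp S (F t) (F u)"
  shows "equivclp S (F t) (F u)"
  using assms(1)
proof (induction rule: equivclp_induct)
  case (step y z)
  then show ?case using assms(2) by (blast intro: equivclp_trans equivclp_sym)
qed simp

lemma smash_simplexE:
  assumes "prespectrum X" "prespectrum Y" "c \<in> simplices (lev (smash X Y) n) q"
  obtains \<sigma> p r x y where "class_rep c = (\<sigma>, p, r, x, y)" "c = smash_class X Y q (\<sigma>, p, r, x, y)"
    "\<sigma> permutes {..<n}" "p + r = n" "x \<in> simplices (lev X p) q" "y \<in> simplices (lev Y r) q"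
proof -
  from assms(3) obtain t where t: "t \<in> smash_reps X Y n q" "c = smash_class X Y q t"
    by (auto simp: smash_def)
  note eq = class_rep_smash_class[of X Y q t, folded t(2)]
  have c: "class_rep c \<in> smash_reps X Y n q"
    using t(1) equivclp_smash_reps[OF assms(1,2) eq] by blast
  obtain \<sigma> p r x y where rep: "class_rep c = (\<sigma>, p, r, x, y)" by (cases "class_rep c") auto
  have "c = smash_class X Y q (\<sigma>, p, r, x, y)"
    using smash_class_eq[OF eq] t(2) rep by simp
  then show thesis using that[OF rep] c rep by (auto simp: smash_reps_def)
qed

lemma smash_class_in:
  "\<lbrakk>\<sigma> permutes {..<n}; p + r = n; x \<in> simplices (lev X p) q; y \<in> simplices (lev Y r) q\<rbrakk>
    \<Longrightarrow> smash_class X Y q (\<sigma>, p, r, x, y) \<in> simplices (lev (smash X Y) n) q"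
  by (auto simp: smash_def smash_reps_def)

lemma prespectrum_smash:
  assumes X: "prespectrum X" and Y: "prespectrum Y"
  shows "prespectrum (smash X Y)"
proof
  interpret X: prespectrum X by fact
  interpret Y: prespectrum Y by fact
  fix n q
  have "pt (lev (smash X Y) n) q = smash_class X Y q (id, n, 0, pt (lev X n) q, pt (lev Y 0) q)"
    by (simp add: smash_def)
  then show "pt (lev (smash X Y) n) q \<in> simplices (lev (smash X Y) n) q"
    by (simp add: smash_class_in permutes_id X.pt_in Y.pt_in)
  fix c assume c: "c \<in> simplices (lev (smash X Y) n) q"
  from smash_simplexE[OF X Y c] obtain \<sigma> p r x y
    where rep: "class_rep c = (\<sigma>, p, r, x, y)" and mem: "\<sigma> permutes {..<n}" "p + r = n"
    "x \<in> simplices (lev X p) q" "y \<in> simplices (lev Y r) q" by metis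
  show "sact (smash X Y) n \<tau> q c \<in> simplices (lev (smash X Y) n) q" if "\<tau> permutes {..<n}" for \<tau>
  proof -
    have "sact (smash X Y) n \<tau> q c = smash_class X Y q (\<tau> \<circ> \<sigma>, p, r, x, y)"
      using rep by (simp add: smash_def)
    then show ?thesis using mem that by (simp add: smash_class_in permutes_compose)
  qed
  show "smap (smash X Y) n q c s \<in> simplices (lev (smash X Y) (Suc n)) q" if "s \<le> q" for s
  proof -
    have "smap (smash X Y) n q c s = smash_class X Y q (\<sigma>, p, Suc r, x, smap Y r q y s)"
      using rep by (simp add: smash_def)
    moreover have "\<sigma> permutes {..<Suc n}" using mem(1) by (rule permutes_subset) auto
    ultimately show ?thesis using mem that by (auto intro!: smash_class_in Y.smap_in)
  qed
qed

text \<open>A map of spectra commutes with all the operations out of which \<^const>\<open>smash_gen\<close> is built, so it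
  takes related representatives to related ones.\<close>

lemma smash_map_class:
  assumes X: "prespectrum X" and Y: "prespectrum Y"
    and f: "spectrum_map X X' f" and g: "spectrum_map Y Y' g"
  shows "smash_map X' Y' f g n q (smash_class X Y q (\<sigma>, p, r, x, y))
    = smash_class X' Y' q (\<sigma>, p, r, f p q x, g r q y)"
proof -
  let ?F = "\<lambda>(\<sigma>, p, r, x, y). (\<sigma>, p, r, f p q x, g r q y)"
  have "equivclp (smash_gen X' Y' q) (?F t) (?F u)" if "smash_gen X Y q t u" for t u
    using that
  proof cases
    case (equivariance \<sigma> p r \<tau> \<upsilon> x y)
    have "smash_gen X' Y' q (?F t) (?F u)"
      using equivariance f g smash_gen.equivariance[of \<sigma> p r \<tau> \<upsilon> "f p q x" X' q "g r q y" Y']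
      by (auto simp: spectrum_map_def)
    then show ?thesis by blast
  next
    case (base_left \<sigma> p r y)
    have "smash_gen X' Y' q (?F t) (?F u)"
      using base_left f g smash_gen.base_left[of \<sigma> p r "g r q y" Y' q X']
      by (auto simp: spectrum_map_def)
    then show ?thesis by blast
  next
    case (base_right \<sigma> p r x)
    have "smash_gen X' Y' q (?F t) (?F u)"
      using base_right f g smash_gen.base_right[of \<sigma> p r "f p q x" X' q Y']
      by (auto simp: spectrum_map_def)
    then show ?thesis by blast
  next
    case (balance \<sigma> p m r x s y)
    have "smash_gen X' Y' q (?F t) (?F u)"
      using balance f g smash_gen.balance[of \<sigma> p m r "f p q x" X' q s "g r q y" Y']
        sph_act_comp_spectrum_map[OF X f] sph_act_left_comp_spectrum_map[OF Y g]
      by (auto simp: spectrum_map_def)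
    then show ?thesis by blast
  qed
  then have "equivclp (smash_gen X' Y' q) (?F (\<sigma>, p, r, x, y))
      (?F (class_rep (smash_class X Y q (\<sigma>, p, r, x, y))))"
    by (rule equivclp_map[OF class_rep_smash_class])
  from smash_class_eq[OF this] show ?thesis
    by (simp add: smash_map_def split: prod.splits)
qed

text \<open>The universal property of the smash product.  Structure maps of the left factor enter through
  \<open>h_balance\<close> only, which trades them for structure maps of the right factor and a block
  transposition.\<close>

locale bimorphism = X: symmetric_spectrum X + Y: symmetric_spectrum Y + Z: symmetric_spectrum Z
  for X :: "'x spectrum" and Y :: "'y spectrum" and Z :: "'z spectrum" +
  fixes h :: "nat \<Rightarrow> nat \<Rightarrow> nat \<Rightarrow> 'x \<Rightarrow> 'y \<Rightarrow> 'z"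
  assumes h_in: "\<lbrakk>x \<in> simplices (lev X p) q; y \<in> simplices (lev Y r) q\<rbrakk>
      \<Longrightarrow> h p r q x y \<in> simplices (lev Z (p + r)) q"
    and h_pt_left: "y \<in> simplices (lev Y r) q
      \<Longrightarrow> h p r q (pt (lev X p) q) y = pt (lev Z (p + r)) q"
    and h_pt_right: "x \<in> simplices (lev X p) q
      \<Longrightarrow> h p r q x (pt (lev Y r) q) = pt (lev Z (p + r)) q"
    and h_sop: "\<lbrakk>mono_map q' q \<alpha>; x \<in> simplices (lev X p) q; y \<in> simplices (lev Y r) q\<rbrakk>
      \<Longrightarrow> h p r q' (sop (lev X p) q q' \<alpha> x) (sop (lev Y r) q q' \<alpha> y)
        = sop (lev Z (p + r)) q q' \<alpha> (h p r q x y)"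
    and h_sact: "\<lbrakk>\<sigma> permutes {..<p}; \<tau> permutes {..<r};
        x \<in> simplices (lev X p) q; y \<in> simplices (lev Y r) q\<rbrakk>
      \<Longrightarrow> h p r q (sact X p \<sigma> q x) (sact Y r \<tau> q y)
        = sact Z (p + r) (block_sum p \<sigma> \<tau>) q (h p r q x y)"
    and h_smap: "\<lbrakk>x \<in> simplices (lev X p) q; y \<in> simplices (lev Y r) q; s \<le> q\<rbrakk>
      \<Longrightarrow> h p (Suc r) q x (smap Y r q y s) = smap Z (p + r) q (h p r q x y) s"
    and h_balance: "\<lbrakk>x \<in> simplices (lev X p) q; y \<in> simplices (lev Y r) q;
        u \<in> simplices (lev sphere m) q\<rbrakk>
      \<Longrightarrow> h (p + m) r q (sph_act X p m q x u) y = h p (m + r) q x (sph_act_left Y m r q u y)"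
begin

text \<open>Each generating relation of the smash product leaves the right-hand side unchanged by one of the
  axioms on \<open>h\<close>.\<close>

lemma smash_desc_class:
  assumes "\<sigma> permutes {..<n}" "p + r = n" "x \<in> simplices (lev X p) q" "y \<in> simplices (lev Y r) q"
  shows "smash_desc Z h n q (smash_class X Y q (\<sigma>, p, r, x, y)) = sact Z n \<sigma> q (h p r q x y)"
proof -
  let ?F = "\<lambda>(\<sigma>, p, r, x, y). sact Z (p + r) \<sigma> q (h p r q x y)"
  have F: "?F t = ?F u" if "smash_gen X Y q t u" for t u
    using that
  proof cases
    case (equivariance \<sigma> p r \<tau> \<upsilon> x y)
    then show ?thesis by (simp add: h_sact Z.sact_comp block_sum_permutes h_in)
  next
    case (base_left \<sigma> p r y)
    then show ?thesis
      using h_pt_left[OF Y.pt_in[of 0 q], of "p + r"] by (simp add: h_pt_left Z.sact_pt permutes_id)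
  next
    case (base_right \<sigma> p r x)
    then show ?thesis
      using h_pt_left[OF Y.pt_in[of 0 q], of "p + r"] by (simp add: h_pt_right Z.sact_pt permutes_id)
  next
    case (balance \<sigma> p m r x s y)
    then show ?thesis by (simp add: h_balance add.assoc)
  qed
  let ?t = "(\<sigma>, p, r, x, y)"
  let ?u = "class_rep (smash_class X Y q ?t)"
  have eq: "equivclp (smash_gen X Y q) ?t ?u" by (rule class_rep_smash_class)
  then have "?F ?t = ?F ?u" by (induction rule: equivclp_induct) (use F in auto)
  moreover have "?t \<in> smash_reps X Y n q" using assms by (simp add: smash_reps_def)
  then have "?u \<in> smash_reps X Y n q"
    using equivclp_smash_reps[OF X.prespectrum_axioms Y.prespectrum_axioms eq] by blast
  ultimately show ?thesis
    using assms(2) by (auto simp: smash_desc_def smash_reps_def split: prod.splits)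
qed

text \<open>The operations of the smash product evaluate the chosen representative, and so does
  \<^const>\<open>smash_desc\<close>; by the previous lemma the representatives chosen by the two need not agree.\<close>

lemma spectrum_map_smash_desc: "spectrum_map (smash X Y) Z (smash_desc Z h)"
proof -
  note XY = X.prespectrum_axioms Y.prespectrum_axioms
  have pt: "smash_desc Z h n q (pt (lev (smash X Y) n) q) = pt (lev Z n) q" for n q
  proof -
    have "pt (lev (smash X Y) n) q = smash_class X Y q (id, n, 0, pt (lev X n) q, pt (lev Y 0) q)"
      by (simp add: smash_def)
    then show ?thesis
      using h_pt_left[OF Y.pt_in[of 0 q], of n]
      by (simp add: smash_desc_class X.pt_in Y.pt_in permutes_id Z.sact_pt)
  qed
  have "smash_desc Z h n q c \<in> simplices (lev Z n) q
      \<and> (mono_map q' q \<alpha> \<longrightarrow> smash_desc Z h n q' (sop (lev (smash X Y) n) q q' \<alpha> c)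
            = sop (lev Z n) q q' \<alpha> (smash_desc Z h n q c))
      \<and> (\<tau> permutes {..<n} \<longrightarrow> smash_desc Z h n q (sact (smash X Y) n \<tau> q c)
            = sact Z n \<tau> q (smash_desc Z h n q c))
      \<and> (s \<le> q \<longrightarrow> smash_desc Z h (Suc n) q (smap (smash X Y) n q c s)
            = smap Z n q (smash_desc Z h n q c) s)"
    if c: "c \<in> simplices (lev (smash X Y) n) q" for n q c q' \<alpha> \<tau> s
  proof -
    from smash_simplexE[OF XY c] obtain \<sigma> p r x y
      where rep: "class_rep c = (\<sigma>, p, r, x, y)" and mem: "\<sigma> permutes {..<n}" "p + r = n"
      "x \<in> simplices (lev X p) q" "y \<in> simplices (lev Y r) q" by metis
    have c: "smash_desc Z h n q c = sact Z n \<sigma> q (h p r q x y)"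
      using rep by (simp add: smash_desc_def)
    have hz: "h p r q x y \<in> simplices (lev Z n) q" using h_in mem by blast
    have "smash_desc Z h n q' (sop (lev (smash X Y) n) q q' \<alpha> c)
        = sop (lev Z n) q q' \<alpha> (smash_desc Z h n q c)" if "mono_map q' q \<alpha>"
      using rep mem that hz c h_sop[OF that mem(3,4)]
        based_simplicial_set.sop_simplex[OF X.lev_bsset that mem(3)]
        based_simplicial_set.sop_simplex[OF Y.lev_bsset that mem(4)]
      by (simp add: smash_def smash_desc_class Z.sact_sop)
    moreover have "smash_desc Z h n q (sact (smash X Y) n \<tau> q c)
        = sact Z n \<tau> q (smash_desc Z h n q c)" if "\<tau> permutes {..<n}"
      using rep mem that hz c by (simp add: smash_def smash_desc_class permutes_compose Z.sact_comp)
    moreover have "smash_desc Z h (Suc n) q (smap (smash X Y) n q c s)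
        = smap Z n q (smash_desc Z h n q c) s" if "s \<le> q"
    proof -
      have "\<sigma> permutes {..<Suc n}" using mem(1) by (rule permutes_subset) auto
      then show ?thesis
        using rep mem that hz c h_smap[OF mem(3,4) that]
        by (simp add: smash_def smash_desc_class Y.smap_in Z.smap_sact)
    qed
    ultimately show ?thesis using c hz mem(1) Z.sact_in by simp
  qed
  with pt show ?thesis by (auto simp: spectrum_map_def)
qed

end

text \<open>The vertex determines a constant simplex in each degree, and the simplices of the sphere act on
  these.  At level \<open>0\<close> equivariance of the action is equivariance in the sphere alone.\<close>

lemma (in symmetric_spectrum) spectrum_map_sphere_desc:
  assumes v: "v \<in> simplices (lev X 0) 0"
  shows "spectrum_map sphere X (sphere_desc X v)"
proof -
  let ?v = "\<lambda>q. sop (lev X 0) 0 q (\<lambda>i. 0) v"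
  have const: "mono_map q 0 (\<lambda>i. 0)" for q by (simp add: mono_map_def mono_on_def)
  have v_in: "?v q \<in> simplices (lev X 0) q" for q
    using based_simplicial_set.sop_simplex[OF lev_bsset const v] .
  have v_sop: "sop (lev X 0) q r \<alpha> (?v q) = ?v r" if "mono_map r q \<alpha>" for q r \<alpha>
    using based_simplicial_set.sop_comp[OF lev_bsset const that v] by (simp add: comp_def)
  have "sphere_desc X v m q u \<in> simplices (lev X m) q" if "u \<in> simplices (lev sphere m) q" for m q u
    using sph_act_in[OF v_in that] by (simp add: sphere_desc_def)
  moreover have "sphere_desc X v m q (pt (lev sphere m) q) = pt (lev X m) q" for m q
    by (simp add: sphere_desc_def sph_act_def sphere_def)
  moreover have "sphere_desc X v m r (sop (lev sphere m) q r \<alpha> u)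
      = sop (lev X m) q r \<alpha> (sphere_desc X v m q u)"
    if "u \<in> simplices (lev sphere m) q" "mono_map r q \<alpha>" for m q r \<alpha> u
    using sop_sph_act[OF that(2) v_in that(1)] by (simp add: sphere_desc_def v_sop that)
  moreover have "sphere_desc X v m q (sact sphere m \<tau> q u) = sact X m \<tau> q (sphere_desc X v m q u)"
    if "u \<in> simplices (lev sphere m) q" "\<tau> permutes {..<m}" for m q \<tau> u
    using sph_act_equivariant[OF permutes_id that(2) v_in that(1)] sact_id[OF v_in]
    by (simp add: sphere_desc_def block_sum_0)
  moreover have "sphere_desc X v (Suc m) q (smap sphere m q u s) = smap X m q (sphere_desc X v m q u) s"
    if "u \<in> simplices (lev sphere m) q" "s \<le> q" for m q u s
  proof (cases u)
    case None
    then show ?thesis by (simp add: sphere_desc_def sphere_def sph_act_def smap_pt that)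
  next
    case (Some xs)
    then have xs: "length xs = m" "set xs \<subseteq> {..q}" using that(1) by (auto simp: sphere_def)
    have snoc: "iter_smap X n q x (xs @ [s]) = smap X (n + length xs) q (iter_smap X n q x xs) s"
      for n x by (induction xs arbitrary: n x) auto
    show ?thesis
    proof (cases "s = 0")
      case True
      then show ?thesis
        using Some xs(1) sph_act_in[OF v_in that(1)]
        by (simp add: sphere_desc_def sphere_def sph_act_def smap_zero)
    next
      case False
      then show ?thesis using Some xs(1) snoc[of 0]
        by (simp add: sphere_desc_def sphere_def sph_act_def)
    qed
  qed
  ultimately show ?thesis by (simp add: spectrum_map_def)
qed

lemma (in bimorphism) h_sph_act:
  assumes x: "x \<in> simplices (lev X p) q" and y: "y \<in> simplices (lev Y r) q"
    and u: "u \<in> simplices (lev sphere m) q"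
  shows "h p (r + m) q x (sph_act Y r m q y u) = sph_act Z (p + r) m q (h p r q x y) u"
proof (cases u)
  case None
  then show ?thesis using x by (simp add: sph_act_def h_pt_right add.assoc)
next
  case (Some xs)
  then have xs: "length xs = m" "set xs \<subseteq> {..q}" using u by (auto simp: sphere_def)
  have "h p (r + length xs) q x (iter_smap Y r q y xs) = iter_smap Z (p + r) q (h p r q x y) xs"
    using xs(2) y
  proof (induction xs arbitrary: r y)
    case (Cons s ss)
    then show ?case using Cons.IH[of "smap Y r q y s" "Suc r"] by (simp add: h_smap[OF x] Y.smap_in)
  qed simp
  then show ?thesis using Some xs(1) by (simp add: sph_act_def)
qed

text \<open>A simplex \<open>u\<close> of the sphere is sent to \<open>v u\<close>.  In \<open>h (v u) x\<close> the factor \<open>u\<close> can be moved to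
  \<open>x\<close>, and in \<open>h x (v u)\<close> it can be pulled out of \<open>h\<close>, so that the unit axioms become statements
  about \<open>v\<close>.\<close>

lemma ring_spectrumI:
  assumes h: "bimorphism X X X h" and v: "v \<in> simplices (lev X 0) 0"
    and assoc: "\<And>p r t q x y z. \<lbrakk>x \<in> simplices (lev X p) q; y \<in> simplices (lev X r) q;
        z \<in> simplices (lev X t) q\<rbrakk>
      \<Longrightarrow> h (p + r) t q (h p r q x y) z = h p (r + t) q x (h r t q y z)"
    and vertex_left: "\<And>r q x. x \<in> simplices (lev X r) q
      \<Longrightarrow> h 0 r q (sop (lev X 0) 0 q (\<lambda>i. 0) v) x = x"
    and vertex_right: "\<And>r q x. x \<in> simplices (lev X r) q
      \<Longrightarrow> h r 0 q x (sop (lev X 0) 0 q (\<lambda>i. 0) v) = x"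
  shows "ring_spectrum X (smash_desc X h) (sphere_desc X v)"
proof -
  interpret bimorphism X X X h by fact
  let ?\<eta> = "sphere_desc X v"
  have \<eta>: "spectrum_map sphere X ?\<eta>" by (rule X.spectrum_map_sphere_desc[OF v])
  have v_in: "sop (lev X 0) 0 q (\<lambda>i. 0) v \<in> simplices (lev X 0) q" for q
    using based_simplicial_set.sop_simplex[OF X.lev_bsset _ v] by (simp add: mono_map_def mono_on_def)
  have unit_left: "h m r q (?\<eta> m q u) x = sph_act_left X m r q u x"
    if "u \<in> simplices (lev sphere m) q" "x \<in> simplices (lev X r) q" for m r q u x
    using h_balance[OF v_in that(2,1)] vertex_left[OF X.sph_act_left_in[OF that(2,1)]]
    by (simp add: sphere_desc_def)
  have unit_right: "h r m q x (?\<eta> m q u) = sph_act X r m q x u"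
    if "u \<in> simplices (lev sphere m) q" "x \<in> simplices (lev X r) q" for m r q u x
    using h_sph_act[OF that(2) v_in that(1)] vertex_right[OF that(2)]
    by (simp add: sphere_desc_def)
  let ?\<mu> = "smash_desc X h"
  note X = X.prespectrum_axioms and S = sphere.prespectrum_axioms
  note XX = prespectrum_smash[OF X X]
  have idm: "spectrum_map X X smor_id" by (simp add: spectrum_map_def smor_id_def)
  note \<mu> = spectrum_map_smash_desc
  have \<mu>_in: "?\<mu> n q c \<in> simplices (lev X n) q" if "c \<in> simplices (lev (smash X X) n) q" for n q c
    using \<mu> that by (simp add: spectrum_map_def)
  have \<eta>_in: "?\<eta> n q u \<in> simplices (lev X n) q" if "u \<in> simplices (lev sphere n) q" for n q u
    using \<eta> that by (simp add: spectrum_map_def)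
  have "(?\<mu> \<circ>\<^sub>S smash_map X X ?\<mu> smor_id) n q c
      = (?\<mu> \<circ>\<^sub>S smash_map X X smor_id ?\<mu> \<circ>\<^sub>S smash_assoc X X X) n q c"
    if "c \<in> simplices (lev (smash (smash X X) X) n) q" for n q c
  proof -
    from smash_simplexE[OF XX X that] obtain \<sigma> pr t w z
      where c: "class_rep c = (\<sigma>, pr, t, w, z)" and mem: "\<sigma> permutes {..<n}" "pr + t = n"
      "w \<in> simplices (lev (smash X X) pr) q" "z \<in> simplices (lev X t) q" by metis
    from smash_simplexE[OF X X mem(3)] obtain \<tau> p r x y
      where w: "class_rep w = (\<tau>, p, r, x, y)" and mem': "\<tau> permutes {..<pr}" "p + r = pr"
      "x \<in> simplices (lev X p) q" "y \<in> simplices (lev X r) q" by metis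
    have perm: "block_sum pr \<tau> id permutes {..<n}"
      using block_sum_permutes[OF mem'(1) permutes_id, of t] mem(2) by (simp add: id_def)
    have hxy: "h p r q x y \<in> simplices (lev X pr) q" using h_in mem' by blast
    have "?\<mu> pr q w = sact X pr \<tau> q (h p r q x y)" using w by (simp add: smash_desc_def)
    then have "(?\<mu> \<circ>\<^sub>S smash_map X X ?\<mu> smor_id) n q c
        = sact X n \<sigma> q (h pr t q (sact X pr \<tau> q (h p r q x y)) z)"
      using c mem \<mu>_in[OF mem(3)]
      by (simp add: smor_comp_def smash_map_def smash_desc_class smor_id_def)
    also have "h pr t q (sact X pr \<tau> q (h p r q x y)) z
        = sact X n (block_sum pr \<tau> id) q (h pr t q (h p r q x y) z)"
      using h_sact[OF mem'(1) permutes_id[of "{..<t}"] hxy mem(4)] mem(2,4) X.prespectrum_axioms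
        X.sact_id[OF mem(4)]
      by (simp add: id_def)
    also have "sact X n \<sigma> q \<dots> = sact X n (\<sigma> \<circ> block_sum pr \<tau> id) q (h pr t q (h p r q x y) z)"
      using X.sact_comp[OF mem(1) perm] h_in[OF hxy mem(4)] mem(2) by simp
    finally have lhs: "(?\<mu> \<circ>\<^sub>S smash_map X X ?\<mu> smor_id) n q c = \<dots>" .
    have yz: "smash_class X X q (id, r, t, y, z) \<in> simplices (lev (smash X X) (r + t)) q"
      using mem' mem by (intro smash_class_in) (auto simp: permutes_id)
    have "?\<mu> (r + t) q (smash_class X X q (id, r, t, y, z)) = h r t q y z"
      using mem'(4) mem(4) h_in[OF mem'(4) mem(4)]
      by (simp add: smash_desc_class permutes_id X.sact_id)
    then have "(?\<mu> \<circ>\<^sub>S smash_map X X smor_id ?\<mu> \<circ>\<^sub>S smash_assoc X X X) n q c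
        = ?\<mu> n q (smash_class X X q (\<sigma> \<circ> block_sum pr \<tau> id, p, r + t, x, h r t q y z))"
      using c w by (simp add: smor_comp_def smash_assoc_def smash_map_class[OF X XX idm \<mu>] smor_id_def)
    also have "\<dots> = sact X n (\<sigma> \<circ> block_sum pr \<tau> id) q (h p (r + t) q x (h r t q y z))"
      using mem mem' perm h_in by (intro smash_desc_class) (auto intro: permutes_compose)
    finally show ?thesis using lhs assoc[OF mem'(3,4) mem(4)] mem'(2) by simp
  qed
  moreover have "(?\<mu> \<circ>\<^sub>S smash_map X X ?\<eta> smor_id) n q c = smash_unit_left X n q c"
    if "c \<in> simplices (lev (smash sphere X) n) q" for n q c
  proof -
    from smash_simplexE[OF S X that] obtain \<sigma> p r x y
      where rep: "class_rep c = (\<sigma>, p, r, x, y)" and mem: "\<sigma> permutes {..<n}" "p + r = n"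
      "x \<in> simplices (lev sphere p) q" "y \<in> simplices (lev X r) q" by metis
    then show ?thesis using \<eta>_in
      by (simp add: smor_comp_def smash_map_def smash_unit_left_def smash_desc_class smor_id_def
          unit_left)
  qed
  moreover have "(?\<mu> \<circ>\<^sub>S smash_map X X smor_id ?\<eta>) n q c = smash_unit_right X n q c"
    if "c \<in> simplices (lev (smash X sphere) n) q" for n q c
  proof -
    from smash_simplexE[OF X S that] obtain \<sigma> p r x y
      where rep: "class_rep c = (\<sigma>, p, r, x, y)" and mem: "\<sigma> permutes {..<n}" "p + r = n"
      "x \<in> simplices (lev X p) q" "y \<in> simplices (lev sphere r) q" by metis
    then show ?thesis using \<eta>_in
      by (simp add: smor_comp_def smash_map_def smash_unit_right_def smash_desc_class smor_id_def
          unit_right)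
  qed
  ultimately show ?thesis
    using X.symmetric_spectrum_axioms \<mu> \<eta> by (simp add: ring_spectrum_def eq_on_spectrum_def)
qed


section \<open>Composition of arrows by rewriting\<close>

text \<open>The axioms speak of arrows between given objects.  The variants below have side conditions on
  domains and codomains, which the simplifier evaluates, so that equations between composites
  can be proved by rewriting.\<close>

context category
begin

lemma HomI: "\<lbrakk>f \<in> Ar C; Dom C f = a; Cod C f = b\<rbrakk> \<Longrightarrow> f \<in> Hom C a b"
  by (simp add: Hom_def)

lemma dom_in [simp]: "f \<in> Ar C \<Longrightarrow> Dom C f \<in> Ob C"
  and cod_in [simp]: "f \<in> Ar C \<Longrightarrow> Cod C f \<in> Ob C"
  using dom_cod by auto

lemma id_ar [simp]: "a \<in> Ob C \<Longrightarrow> Id C a \<in> Ar C"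
  and dom_id [simp]: "a \<in> Ob C \<Longrightarrow> Dom C (Id C a) = a"
  and cod_id [simp]: "a \<in> Ob C \<Longrightarrow> Cod C (Id C a) = a"
  using id_hom by (auto simp: Hom_def)

lemma cmp_ar [simp]:
  assumes "f \<in> Ar C" "g \<in> Ar C" "Dom C g = Cod C f"
  shows "g \<cdot> f \<in> Ar C" "Dom C (g \<cdot> f) = Dom C f" "Cod C (g \<cdot> f) = Cod C g"
  using assms cmp_hom[of f "Dom C f" "Cod C f" g "Cod C g"] by (auto simp: Hom_def)

lemma cmp_id_right [simp]: "\<lbrakk>f \<in> Ar C; Dom C f = a\<rbrakk> \<Longrightarrow> f \<cdot> Id C a = f"
  and cmp_id_left [simp]: "\<lbrakk>f \<in> Ar C; Cod C f = a\<rbrakk> \<Longrightarrow> Id C a \<cdot> f = f"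
  using cmp_id[of f "Dom C f" "Cod C f"] by (auto simp: Hom_def)

lemma cmp_assoc': "\<lbrakk>f \<in> Ar C; g \<in> Ar C; h \<in> Ar C; Dom C g = Cod C f; Dom C h = Cod C g\<rbrakk>
    \<Longrightarrow> (h \<cdot> g) \<cdot> f = h \<cdot> (g \<cdot> f)"
  by (rule cmp_assoc) (auto intro: HomI)

end

context permutative_category
begin

declare osum_ob [simp] zero_ob [simp]

lemma osum_zero_right [simp]: "a \<in> Ob C \<Longrightarrow> a \<oplus> \<zero> = a"
  and osum_zero_left [simp]: "a \<in> Ob C \<Longrightarrow> \<zero> \<oplus> a = a"
  using osum_zero by auto

lemma asum_zero_right [simp]: "f \<in> Ar C \<Longrightarrow> f \<boxplus> Id C \<zero> = f"
  and asum_zero_left [simp]: "f \<in> Ar C \<Longrightarrow> Id C \<zero> \<boxplus> f = f"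
  using asum_zero by auto

lemma asum_ar [simp]:
  assumes "f \<in> Ar C" "g \<in> Ar C"
  shows "f \<boxplus> g \<in> Ar C" "Dom C (f \<boxplus> g) = Dom C f \<oplus> Dom C g"
    "Cod C (f \<boxplus> g) = Cod C f \<oplus> Cod C g"
  using assms asum_hom[of f "Dom C f" "Cod C f" g "Dom C g" "Cod C g"] by (auto simp: Hom_def)

lemma gam_ar [simp]: "\<lbrakk>a \<in> Ob C; b \<in> Ob C\<rbrakk> \<Longrightarrow> \<gamma> a b \<in> Ar C"
  and dom_gam [simp]: "\<lbrakk>a \<in> Ob C; b \<in> Ob C\<rbrakk> \<Longrightarrow> Dom C (\<gamma> a b) = a \<oplus> b"
  and cod_gam [simp]: "\<lbrakk>a \<in> Ob C; b \<in> Ob C\<rbrakk> \<Longrightarrow> Cod C (\<gamma> a b) = b \<oplus> a"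
  using gam_hom[of a b] by (auto simp: Hom_def)

lemma asum_cmp_asum: "\<lbrakk>f \<in> Ar C; g \<in> Ar C; f' \<in> Ar C; g' \<in> Ar C; Dom C g = Cod C f; Dom C g' = Cod C f'\<rbrakk>
    \<Longrightarrow> (g \<boxplus> g') \<cdot> (f \<boxplus> f') = (g \<cdot> f) \<boxplus> (g' \<cdot> f')"
  by (rule asum_cmp[symmetric]) (auto intro: HomI)

declare gam_zero [simp] asum_id [simp]

lemma gam_zero_left [simp]: "a \<in> Ob C \<Longrightarrow> \<gamma> \<zero> a = Id C a"
  using gam_gam[of a \<zero>] by simp

lemma mid_swap_ar [simp]:
  assumes "a \<in> Ob C" "b \<in> Ob C" "c \<in> Ob C" "d \<in> Ob C"
  shows "mid_swap C a b c d \<in> Ar C" "Dom C (mid_swap C a b c d) = (a \<oplus> b) \<oplus> (c \<oplus> d)"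
    "Cod C (mid_swap C a b c d) = (a \<oplus> c) \<oplus> (b \<oplus> d)"
  using assms by (simp_all add: mid_swap_def osum_assoc)

lemma mid_swap_mid_swap:
  assumes "a \<in> Ob C" "b \<in> Ob C" "c \<in> Ob C" "d \<in> Ob C"
  shows "mid_swap C a c b d \<cdot> mid_swap C a b c d = Id C ((a \<oplus> b) \<oplus> (c \<oplus> d))"
  using assms by (simp add: mid_swap_def asum_cmp_asum gam_gam osum_assoc)

lemma mid_swap_zero [simp]:
  "\<lbrakk>a \<in> Ob C; b \<in> Ob C; d \<in> Ob C\<rbrakk> \<Longrightarrow> mid_swap C a b \<zero> d = Id C (a \<oplus> b \<oplus> d)"
  "\<lbrakk>a \<in> Ob C; c \<in> Ob C; d \<in> Ob C\<rbrakk> \<Longrightarrow> mid_swap C a \<zero> c d = Id C (a \<oplus> c \<oplus> d)"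
  by (simp_all add: mid_swap_def)

end


section \<open>Index tuples and systems\<close>

abbreviation tuples :: "nat \<Rightarrow> nat \<Rightarrow> nat set list set" where
  "tuples n q \<equiv> sys_index (circles n q)"

abbreviation is_system :: "('o, 'm, 'z) perm_cat_scheme \<Rightarrow> nat \<Rightarrow> nat \<Rightarrow> ('o, 'm) sys \<Rightarrow> bool" where
  "is_system C n q \<equiv> is_sys C (circles n q)"

abbreviation is_system_ar :: "('o, 'm, 'z) perm_cat_scheme \<Rightarrow> nat \<Rightarrow> nat
    \<Rightarrow> ('o, 'm) sys_ar \<Rightarrow> bool" where
  "is_system_ar C n q \<equiv> is_sys_ar C (circles n q)"

abbreviation systems :: "('o, 'm, 'z) perm_cat_scheme \<Rightarrow> nat \<Rightarrow> nat
    \<Rightarrow> (('o, 'm) sys, ('o, 'm) sys_ar) cat" where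
  "systems C n q \<equiv> sys_cat C (circles n q)"

lemma tuples_iff: "Ss \<in> tuples n q \<longleftrightarrow> length Ss = n \<and> (\<forall>S \<in> set Ss. S \<subseteq> {1..q})"
proof -
  have "{0..q} - {0} = {1..q}" by auto
  then show ?thesis by (auto simp add: sys_index_def circles_def all_set_conv_all_nth)
qed

lemma tuples_update:
  assumes "Ss \<in> tuples n q" "T \<subseteq> Ss ! i"
  shows "Ss[i := T] \<in> tuples n q"
proof (cases "i < length Ss")
  case True
  then have "T \<subseteq> {1..q}" using assms by (meson nth_mem order_trans tuples_iff)
  then show ?thesis
    using assms set_update_subset_insert[of Ss i T] unfolding tuples_iff length_list_update by blast
qed (use assms in \<open>simp add: list_update_beyond\<close>)

lemma split_atD:
  assumes "split_at Ss i T U"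
  shows "i < length Ss" "T \<subseteq> Ss ! i" "U \<subseteq> Ss ! i" "T \<inter> U = {}" "Ss ! i = T \<union> U"
  using assms by (auto simp: split_at_def)

lemma split_at_tuples [simp]:
  assumes "Ss \<in> tuples n q" "split_at Ss i T U"
  shows "Ss[i := T] \<in> tuples n q" "Ss[i := U] \<in> tuples n q"
  using assms by (auto dest: split_atD intro: tuples_update)

lemma split_at_sym: "split_at Ss i T U \<Longrightarrow> split_at Ss i U T"
  by (auto simp: split_at_def)

lemma split_at_update [simp]: "i \<noteq> j \<Longrightarrow> split_at (Ss[j := V]) i T U \<longleftrightarrow> split_at Ss i T U"
  by (simp add: split_at_def)

text \<open>A system is a pair of functions with the value \<^const>\<open>undefined\<close> outside their index sets.
  Without this convention the axioms can be stated for functions given by formulas.\<close>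

locale system = permutative_category C for C :: "('o, 'm, 'z) perm_cat_scheme" (structure) +
  fixes n q :: nat and c :: "nat set list \<Rightarrow> 'o"
    and \<rho> :: "nat set list \<Rightarrow> nat \<Rightarrow> nat set \<Rightarrow> nat set \<Rightarrow> 'm"
  assumes obj [simp]: "Ss \<in> tuples n q \<Longrightarrow> c Ss \<in> Ob C"
    and obj_zero: "\<lbrakk>Ss \<in> tuples n q; {} \<in> set Ss\<rbrakk> \<Longrightarrow> c Ss = \<zero>"
    and rho_hom: "\<lbrakk>Ss \<in> tuples n q; split_at Ss i T U\<rbrakk>
      \<Longrightarrow> \<rho> Ss i T U \<in> Hom C (c (Ss[i := T]) \<oplus> c (Ss[i := U])) (c Ss)"
    and rho_id: "\<lbrakk>Ss \<in> tuples n q; split_at Ss i T U; {} \<in> set Ss \<union> {T, U}\<rbrakk>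
      \<Longrightarrow> \<rho> Ss i T U = Id C (c Ss)"
    and rho_gam: "\<lbrakk>Ss \<in> tuples n q; split_at Ss i T U\<rbrakk>
      \<Longrightarrow> \<rho> Ss i U T \<cdot> \<gamma> (c (Ss[i := T])) (c (Ss[i := U])) = \<rho> Ss i T U"
    and rho_assoc: "\<lbrakk>Ss \<in> tuples n q; split_at Ss i (T \<union> U) V; T \<inter> U = {}\<rbrakk>
      \<Longrightarrow> \<rho> Ss i (T \<union> U) V \<cdot> (\<rho> (Ss[i := T \<union> U]) i T U \<boxplus> Id C (c (Ss[i := V])))
        = \<rho> Ss i T (U \<union> V) \<cdot> (Id C (c (Ss[i := T])) \<boxplus> \<rho> (Ss[i := U \<union> V]) i U V)"
    and rho_comm: "\<lbrakk>Ss \<in> tuples n q; i \<noteq> j; split_at Ss i T U; split_at Ss j V W\<rbrakk>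
      \<Longrightarrow> \<rho> Ss j V W \<cdot> (\<rho> (Ss[j := V]) i T U \<boxplus> \<rho> (Ss[j := W]) i T U)
        = \<rho> Ss i T U \<cdot> (\<rho> (Ss[i := T]) j V W \<boxplus> \<rho> (Ss[i := U]) j V W)
            \<cdot> mid_swap C (c (Ss[i := T, j := V])) (c (Ss[i := U, j := V]))
                         (c (Ss[i := T, j := W])) (c (Ss[i := U, j := W]))"
begin

lemma rho_ar [simp]: "\<lbrakk>Ss \<in> tuples n q; split_at Ss i T U\<rbrakk> \<Longrightarrow> \<rho> Ss i T U \<in> Ar C"
  and dom_rho [simp]: "\<lbrakk>Ss \<in> tuples n q; split_at Ss i T U\<rbrakk>
    \<Longrightarrow> Dom C (\<rho> Ss i T U) = c (Ss[i := T]) \<oplus> c (Ss[i := U])"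
  and cod_rho [simp]: "\<lbrakk>Ss \<in> tuples n q; split_at Ss i T U\<rbrakk> \<Longrightarrow> Cod C (\<rho> Ss i T U) = c Ss"
  using rho_hom by (auto simp: Hom_def)

end

text \<open>The interchange laws for \<open>(i, j)\<close> and \<open>(j, i)\<close> are equivalent because the two interchanges of the
  middle summands that occur in them are inverse to each other; hence \<open>i < j\<close> may be assumed.\<close>

lemma (in permutative_category) systemI:
  assumes obj: "\<And>Ss. Ss \<in> tuples n q \<Longrightarrow> c Ss \<in> Ob C"
    and obj_zero: "\<And>Ss. \<lbrakk>Ss \<in> tuples n q; {} \<in> set Ss\<rbrakk> \<Longrightarrow> c Ss = \<zero>"
    and rho_hom: "\<And>Ss i T U. \<lbrakk>Ss \<in> tuples n q; split_at Ss i T U\<rbrakk>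
      \<Longrightarrow> \<rho> Ss i T U \<in> Ar C \<and> Dom C (\<rho> Ss i T U) = c (Ss[i := T]) \<oplus> c (Ss[i := U])
          \<and> Cod C (\<rho> Ss i T U) = c Ss"
    and rho_id: "\<And>Ss i T U. \<lbrakk>Ss \<in> tuples n q; split_at Ss i T U; {} \<in> set Ss \<union> {T, U}\<rbrakk>
      \<Longrightarrow> \<rho> Ss i T U = Id C (c Ss)"
    and rho_gam: "\<And>Ss i T U. \<lbrakk>Ss \<in> tuples n q; split_at Ss i T U\<rbrakk>
      \<Longrightarrow> \<rho> Ss i U T \<cdot> \<gamma> (c (Ss[i := T])) (c (Ss[i := U])) = \<rho> Ss i T U"
    and rho_assoc: "\<And>Ss i T U V. \<lbrakk>Ss \<in> tuples n q; split_at Ss i (T \<union> U) V; T \<inter> U = {};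
        split_at Ss i T (U \<union> V); split_at (Ss[i := T \<union> U]) i T U; split_at (Ss[i := U \<union> V]) i U V\<rbrakk>
      \<Longrightarrow> \<rho> Ss i (T \<union> U) V \<cdot> (\<rho> (Ss[i := T \<union> U]) i T U \<boxplus> Id C (c (Ss[i := V])))
        = \<rho> Ss i T (U \<union> V) \<cdot> (Id C (c (Ss[i := T])) \<boxplus> \<rho> (Ss[i := U \<union> V]) i U V)"
    and rho_comm: "\<And>Ss i j T U V W. \<lbrakk>Ss \<in> tuples n q; i < j; split_at Ss i T U; split_at Ss j V W\<rbrakk>
      \<Longrightarrow> \<rho> Ss j V W \<cdot> (\<rho> (Ss[j := V]) i T U \<boxplus> \<rho> (Ss[j := W]) i T U)
        = \<rho> Ss i T U \<cdot> (\<rho> (Ss[i := T]) j V W \<boxplus> \<rho> (Ss[i := U]) j V W)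
            \<cdot> mid_swap C (c (Ss[i := T, j := V])) (c (Ss[i := U, j := V]))
                         (c (Ss[i := T, j := W])) (c (Ss[i := U, j := W]))"
  shows "system C n q c \<rho>"
proof
  fix Ss i T U
  assume "Ss \<in> tuples n q" "split_at Ss i T U"
  then show "\<rho> Ss i T U \<in> Hom C (c (Ss[i := T]) \<oplus> c (Ss[i := U])) (c Ss)"
    using rho_hom by (simp add: Hom_def)
next
  fix Ss i T U V
  assume "Ss \<in> tuples n q" "split_at Ss i (T \<union> U) V" "T \<inter> U = {}"
  then show "\<rho> Ss i (T \<union> U) V \<cdot> (\<rho> (Ss[i := T \<union> U]) i T U \<boxplus> Id C (c (Ss[i := V])))
        = \<rho> Ss i T (U \<union> V) \<cdot> (Id C (c (Ss[i := T])) \<boxplus> \<rho> (Ss[i := U \<union> V]) i U V)"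
    by (intro rho_assoc) (auto simp: split_at_def)
next
  fix Ss i j T U V W
  assume Ss: "Ss \<in> tuples n q" and ij: "i \<noteq> j" and s: "split_at Ss i T U" "split_at Ss j V W"
  note swap = list_update_swap[OF ij]
  have [simp]: "c (Ss[i := X, j := Y]) \<in> Ob C" if "X \<in> {T, U}" "Y \<in> {V, W}" for X Y
    using Ss s ij that by (auto intro!: obj tuples_update simp: nth_list_update_neq dest: split_atD)
  show "\<rho> Ss j V W \<cdot> (\<rho> (Ss[j := V]) i T U \<boxplus> \<rho> (Ss[j := W]) i T U)
        = \<rho> Ss i T U \<cdot> (\<rho> (Ss[i := T]) j V W \<boxplus> \<rho> (Ss[i := U]) j V W)
            \<cdot> mid_swap C (c (Ss[i := T, j := V])) (c (Ss[i := U, j := V]))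
                         (c (Ss[i := T, j := W])) (c (Ss[i := U, j := W]))"
  proof (cases "i < j")
    case True
    then show ?thesis using rho_comm Ss s by blast
  next
    case False
    then have "j < i" using ij by simp
    from rho_comm[OF Ss this s(2,1)]
    have eq: "\<rho> Ss i T U \<cdot> (\<rho> (Ss[i := T]) j V W \<boxplus> \<rho> (Ss[i := U]) j V W)
        = \<rho> Ss j V W \<cdot> (\<rho> (Ss[j := V]) i T U \<boxplus> \<rho> (Ss[j := W]) i T U)
            \<cdot> mid_swap C (c (Ss[i := T, j := V])) (c (Ss[i := T, j := W]))
                         (c (Ss[i := U, j := V])) (c (Ss[i := U, j := W]))"
      by (simp add: swap)
    have "\<rho> Ss j V W \<in> Ar C" "Dom C (\<rho> Ss j V W) = c (Ss[j := V]) \<oplus> c (Ss[j := W])"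
      "\<rho> (Ss[j := V]) i T U \<in> Ar C" "Cod C (\<rho> (Ss[j := V]) i T U) = c (Ss[j := V])"
      "Dom C (\<rho> (Ss[j := V]) i T U) = c (Ss[i := T, j := V]) \<oplus> c (Ss[i := U, j := V])"
      "\<rho> (Ss[j := W]) i T U \<in> Ar C" "Cod C (\<rho> (Ss[j := W]) i T U) = c (Ss[j := W])"
      "Dom C (\<rho> (Ss[j := W]) i T U) = c (Ss[i := T, j := W]) \<oplus> c (Ss[i := U, j := W])"
      using rho_hom[OF Ss s(2)] rho_hom[of "Ss[j := V]" i T U] rho_hom[of "Ss[j := W]" i T U] Ss s ij
      by (auto simp: swap)
    then show ?thesis unfolding eq by (simp add: cmp_assoc' mid_swap_mid_swap)
  qed
qed (use assms in auto)

lemma fst_mk_sys [simp]: "Ss \<in> sys_index As \<Longrightarrow> fst (mk_sys As c \<rho>) Ss = c Ss"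
  by (simp add: mk_sys_def)

lemma snd_mk_sys [simp]:
  "\<lbrakk>Ss \<in> sys_index As; split_at Ss i T U\<rbrakk> \<Longrightarrow> snd (mk_sys As c \<rho>) Ss i T U = \<rho> Ss i T U"
  by (simp add: mk_sys_def)

lemma mk_sys_cong:
  assumes "\<And>Ss. Ss \<in> sys_index As \<Longrightarrow> c Ss = c' Ss"
    and "\<And>Ss i T U. \<lbrakk>Ss \<in> sys_index As; split_at Ss i T U\<rbrakk> \<Longrightarrow> \<rho> Ss i T U = \<rho>' Ss i T U"
  shows "mk_sys As c \<rho> = mk_sys As c' \<rho>'"
  using assms by (auto simp: mk_sys_def fun_eq_iff restrict_def)

lemma mk_sys_mk_sys: "mk_sys As (fst (mk_sys As c \<rho>)) (snd (mk_sys As c \<rho>)) = mk_sys As c \<rho>"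
  by (rule mk_sys_cong) auto

lemma is_sys_iff:
  assumes "permutative_category C"
  shows "is_system C n q X
    \<longleftrightarrow> mk_sys (circles n q) (fst X) (snd X) = X \<and> system C n q (fst X) (snd X)"
proof
  assume X: "is_system C n q X"
  note X' = X[unfolded is_sys_def case_prod_beta prod.collapse]
  show "mk_sys (circles n q) (fst X) (snd X) = X \<and> system C n q (fst X) (snd X)"
  proof (intro conjI system.intro system_axioms.intro assms, goal_cases)
    case 1
    show ?case using X' by (elim conjE)
  qed (insert X', elim conjE, meson)+
next
  assume X: "mk_sys (circles n q) (fst X) (snd X) = X \<and> system C n q (fst X) (snd X)"
  then interpret system C n q "fst X" "snd X" by blast
  show "is_system C n q X"
    unfolding is_sys_def case_prod_beta prod.collapse
  proof (intro conjI ballI allI impI, goal_cases)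
    case 1
    show ?case using X by (elim conjE)
  qed (rule obj obj_zero rho_hom rho_id rho_gam rho_assoc rho_comm; assumption)+
qed

lemma (in system) is_sys_mk_sys: "is_system C n q (mk_sys (circles n q) c \<rho>)"
proof -
  let ?X = "mk_sys (circles n q) c \<rho>"
  have "system C n q (fst ?X) (snd ?X)"
  proof (rule systemI, goal_cases)
    case (4 Ss i T U)
    then show ?case using rho_id by simp
  next
    case (5 Ss i T U)
    then show ?case using rho_gam[OF 5] split_at_sym[OF 5(2)] by simp
  next
    case (6 Ss i T U V)
    then show ?case using rho_assoc[OF 6(1-3)] by simp
  next
    case (7 Ss i j T U V W)
    then show ?case using rho_comm[of Ss i j T U V W] by simp
  qed (simp_all add: obj_zero)
  then show ?thesis
    by (simp add: is_sys_iff permutative_category_axioms mk_sys_mk_sys)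
qed

lemma (in permutative_category) is_sys_system:
  "is_system C n q X \<Longrightarrow> system C n q (fst X) (snd X)"
  by (simp add: is_sys_iff permutative_category_axioms)

lemma is_sys_ext: "is_sys C As X \<Longrightarrow> mk_sys As (fst X) (snd X) = X"
  by (cases X) (simp add: is_sys_def)

lemma (in permutative_category) is_sys_ar_iff:
  "is_system_ar C n q (X, Y, \<phi>) \<longleftrightarrow>
     is_system C n q X \<and> is_system C n q Y \<and> \<phi> \<in> extensional (tuples n q)
   \<and> (\<forall>Ss \<in> tuples n q. \<phi> Ss \<in> Ar C \<and> Dom C (\<phi> Ss) = fst X Ss \<and> Cod C (\<phi> Ss) = fst Y Ss)
   \<and> (\<forall>Ss \<in> tuples n q. {} \<in> set Ss \<longrightarrow> \<phi> Ss = Id C \<zero>)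
   \<and> (\<forall>Ss \<in> tuples n q. \<forall>i T U. split_at Ss i T U \<longrightarrow>
        \<phi> Ss \<cdot> snd X Ss i T U = snd Y Ss i T U \<cdot> (\<phi> (Ss[i := T]) \<boxplus> \<phi> (Ss[i := U])))"
  by (cases X; cases Y) (simp add: is_sys_ar_def Hom_def)


lemma (in permutative_category) is_sys_arD:
  assumes "is_system_ar C n q (X, Y, \<phi>)"
  shows "is_system C n q X" "is_system C n q Y"
    and "\<phi> \<in> extensional (tuples n q)"
    and "Ss \<in> tuples n q \<Longrightarrow> \<phi> Ss \<in> Ar C" "Ss \<in> tuples n q \<Longrightarrow> Dom C (\<phi> Ss) = fst X Ss"
      "Ss \<in> tuples n q \<Longrightarrow> Cod C (\<phi> Ss) = fst Y Ss"
    and "\<lbrakk>Ss \<in> tuples n q; {} \<in> set Ss\<rbrakk> \<Longrightarrow> \<phi> Ss = Id C \<zero>"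
    and "\<lbrakk>Ss \<in> tuples n q; split_at Ss i T U\<rbrakk>
      \<Longrightarrow> \<phi> Ss \<cdot> snd X Ss i T U = snd Y Ss i T U \<cdot> (\<phi> (Ss[i := T]) \<boxplus> \<phi> (Ss[i := U]))"
  using assms unfolding is_sys_ar_iff by blast+

section \<open>Functors on nerves\<close>

lemma mk_nerve_apply [simp]: "\<lbrakk>i \<le> j; j \<le> q\<rbrakk> \<Longrightarrow> mk_nerve q f i j = f i j"
  by (simp add: mk_nerve_def)

lemma mk_nerve_mk_nerve [simp]: "mk_nerve q (mk_nerve q f) = mk_nerve q f"
  by (auto simp: mk_nerve_def fun_eq_iff)

lemma mk_nerve_cong:
  "(\<And>i j. \<lbrakk>i \<le> j; j \<le> q\<rbrakk> \<Longrightarrow> f i j = g i j) \<Longrightarrow> mk_nerve q f = mk_nerve q g"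
  by (auto simp: mk_nerve_def fun_eq_iff)

lemma nerve_ext: "f \<in> nerve C q \<Longrightarrow> mk_nerve q f = f"
  by (simp add: nerve_def)

lemma nerveE:
  assumes "f \<in> nerve C q"
  obtains x where "\<And>i. i \<le> q \<Longrightarrow> x i \<in> Ob C" "\<And>i. i \<le> q \<Longrightarrow> f i i = Id C (x i)"
    "\<And>i j. \<lbrakk>i \<le> j; j \<le> q\<rbrakk> \<Longrightarrow> f i j \<in> Hom C (x i) (x j)"
    "\<And>i j k. \<lbrakk>i \<le> j; j \<le> k; k \<le> q\<rbrakk> \<Longrightarrow> f j k \<cdot>\<^bsub>C\<^esub> f i j = f i k"
  using assms unfolding nerve_def by blast

lemma nerve_ar: "\<lbrakk>f \<in> nerve C q; i \<le> j; j \<le> q\<rbrakk> \<Longrightarrow> f i j \<in> Ar C"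
  by (erule nerveE) (auto simp: Hom_def)

lemma nerve_reindex:
  assumes "f \<in> nerve C q" "mono_map r q \<alpha>"
  shows "mk_nerve r (\<lambda>i j. f (\<alpha> i) (\<alpha> j)) \<in> nerve C r"
proof -
  obtain x where x: "\<And>i. i \<le> q \<Longrightarrow> x i \<in> Ob C" "\<And>i. i \<le> q \<Longrightarrow> f i i = Id C (x i)"
    "\<And>i j. \<lbrakk>i \<le> j; j \<le> q\<rbrakk> \<Longrightarrow> f i j \<in> Hom C (x i) (x j)"
    "\<And>i j k. \<lbrakk>i \<le> j; j \<le> k; k \<le> q\<rbrakk> \<Longrightarrow> f j k \<cdot>\<^bsub>C\<^esub> f i j = f i k"
    using nerveE[OF assms(1)] by blast
  have le: "i \<le> r \<Longrightarrow> \<alpha> i \<le> q" and mono: "\<lbrakk>i \<le> j; j \<le> r\<rbrakk> \<Longrightarrow> \<alpha> i \<le> \<alpha> j" for i j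
    using assms(2) by (auto simp: mono_map_def mono_on_def)
  show ?thesis
    unfolding nerve_def mem_Collect_eq
    by (intro conjI exI[of _ "x \<circ> \<alpha>"]) (auto simp: mk_nerve_def le mono x)
qed

text \<open>A functor of two variables takes a pair of chains of arrows to a chain; the case of one variable
  below is the diagonal of a functor that ignores its second argument.\<close>

lemma nerve_map2:
  assumes f: "f \<in> nerve C q" and g: "g \<in> nerve C' q"
    and ob: "\<And>X Y. \<lbrakk>X \<in> Ob C; Y \<in> Ob C'\<rbrakk> \<Longrightarrow> P X Y \<in> Ob D"
    and ar: "\<And>u v X X' Y Y'. \<lbrakk>u \<in> Hom C X X'; v \<in> Hom C' Y Y'\<rbrakk> \<Longrightarrow> F u v \<in> Hom D (P X Y) (P X' Y')"
    and id: "\<And>X Y. \<lbrakk>X \<in> Ob C; Y \<in> Ob C'\<rbrakk> \<Longrightarrow> F (Id C X) (Id C' Y) = Id D (P X Y)"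
    and cmp: "\<And>u v u' v' X X' X'' Y Y' Y''. \<lbrakk>u \<in> Hom C X X'; v \<in> Hom C' Y Y';
        u' \<in> Hom C X' X''; v' \<in> Hom C' Y' Y''\<rbrakk>
      \<Longrightarrow> F (u' \<cdot>\<^bsub>C\<^esub> u) (v' \<cdot>\<^bsub>C'\<^esub> v) = F u' v' \<cdot>\<^bsub>D\<^esub> F u v"
  shows "mk_nerve q (\<lambda>i j. F (f i j) (g i j)) \<in> nerve D q"
proof -
  obtain x where x: "\<And>i. i \<le> q \<Longrightarrow> x i \<in> Ob C" "\<And>i. i \<le> q \<Longrightarrow> f i i = Id C (x i)"
    "\<And>i j. \<lbrakk>i \<le> j; j \<le> q\<rbrakk> \<Longrightarrow> f i j \<in> Hom C (x i) (x j)"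
    "\<And>i j k. \<lbrakk>i \<le> j; j \<le> k; k \<le> q\<rbrakk> \<Longrightarrow> f j k \<cdot>\<^bsub>C\<^esub> f i j = f i k"
    using nerveE[OF f] by blast
  obtain y where y: "\<And>i. i \<le> q \<Longrightarrow> y i \<in> Ob C'" "\<And>i. i \<le> q \<Longrightarrow> g i i = Id C' (y i)"
    "\<And>i j. \<lbrakk>i \<le> j; j \<le> q\<rbrakk> \<Longrightarrow> g i j \<in> Hom C' (y i) (y j)"
    "\<And>i j k. \<lbrakk>i \<le> j; j \<le> k; k \<le> q\<rbrakk> \<Longrightarrow> g j k \<cdot>\<^bsub>C'\<^esub> g i j = g i k"
    using nerveE[OF g] by blast
  have "F (f j k) (g j k) \<cdot>\<^bsub>D\<^esub> F (f i j) (g i j) = F (f i k) (g i k)"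
    if "i \<le> j" "j \<le> k" "k \<le> q" for i j k
    using cmp[of "f i j" "x i" "x j" "g i j" "y i" "y j" "f j k" "x k" "g j k" "y k"] that
    by (simp add: x y)
  then show ?thesis
    unfolding nerve_def mem_Collect_eq
    by (intro conjI exI[of _ "\<lambda>i. P (x i) (y i)"]) (auto simp: mk_nerve_def x y ob id intro!: ar)
qed

lemma nerve_map:
  assumes f: "f \<in> nerve C q"
    and ob: "\<And>X. X \<in> Ob C \<Longrightarrow> P X \<in> Ob D"
    and ar: "\<And>u X X'. u \<in> Hom C X X' \<Longrightarrow> F u \<in> Hom D (P X) (P X')"
    and id: "\<And>X. X \<in> Ob C \<Longrightarrow> F (Id C X) = Id D (P X)"
    and cmp: "\<And>u u' X X' X''. \<lbrakk>u \<in> Hom C X X'; u' \<in> Hom C X' X''\<rbrakk>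
      \<Longrightarrow> F (u' \<cdot>\<^bsub>C\<^esub> u) = F u' \<cdot>\<^bsub>D\<^esub> F u"
  shows "mk_nerve q (\<lambda>i j. F (f i j)) \<in> nerve D q"
  by (rule nerve_map2[OF f f, where P = "\<lambda>X Y. P X" and F = "\<lambda>u v. F u"]) (auto intro: assms)

lemma Ob_sys_cat [simp]: "X \<in> Ob (sys_cat C As) \<longleftrightarrow> is_sys C As X"
  by (simp add: sys_cat_def)

lemma Ar_sys_cat [simp]: "F \<in> Ar (sys_cat C As) \<longleftrightarrow> is_sys_ar C As F"
  by (simp add: sys_cat_def)

lemma Hom_sys_cat: "F \<in> Hom (sys_cat C As) X Y \<longleftrightarrow> (\<exists>\<phi>. F = (X, Y, \<phi>) \<and> is_sys_ar C As F)"
  by (cases F) (auto simp: sys_cat_def Hom_def)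

lemma Id_sys_cat: "Id (sys_cat C As) X = (X, X, \<lambda>Ss \<in> sys_index As. Id C (fst X Ss))"
  by (simp add: sys_cat_def)

lemma Cmp_sys_cat [simp]: "(Y, Z, \<psi>) \<cdot>\<^bsub>sys_cat C As\<^esub> (X, Y', \<phi>)
    = (X, Z, \<lambda>Ss \<in> sys_index As. \<psi> Ss \<cdot>\<^bsub>C\<^esub> \<phi> Ss)"
  by (simp add: sys_cat_def)


section \<open>Reindexing of systems\<close>

text \<open>What makes reindexing along \<open>G\<close> possible; preimages under based maps \<open>{0..q} \<rightarrow> {0..q'}\<close> are the
  motivating example.\<close>

definition set_hom :: "nat \<Rightarrow> nat \<Rightarrow> (nat set \<Rightarrow> nat set) \<Rightarrow> bool" where
  "set_hom q' q G \<longleftrightarrow> (\<forall>S \<subseteq> {1..q'}. G S \<subseteq> {1..q}) \<and> G {} = {}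
     \<and> (\<forall>S T. G (S \<union> T) = G S \<union> G T \<and> G (S \<inter> T) = G S \<inter> G T)"

lemma set_hom_id: "set_hom q q (\<lambda>S. S)"
  by (simp add: set_hom_def)

abbreviation reindex_tuple :: "(nat \<Rightarrow> nat) \<Rightarrow> (nat set \<Rightarrow> nat set) \<Rightarrow> nat set list \<Rightarrow> nat set list" where
  "reindex_tuple \<sigma> G Ss \<equiv> permute_list \<sigma> (map G Ss)"

text \<open>Simplicial operators are the case \<open>\<sigma> = id\<close>, permutations the case in which \<open>G\<close> is the identity.
  As reindexings compose, the relations within and between the two families come out together.\<close>

definition reindex_sys :: "nat \<Rightarrow> nat \<Rightarrow> (nat \<Rightarrow> nat) \<Rightarrow> (nat set \<Rightarrow> nat set)
    \<Rightarrow> ('o, 'm) sys \<Rightarrow> ('o, 'm) sys" where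
  "reindex_sys n q \<sigma> G X = mk_sys (circles n q) (\<lambda>Ss. fst X (reindex_tuple \<sigma> G Ss))
     (\<lambda>Ss i T U. snd X (reindex_tuple \<sigma> G Ss) (inv \<sigma> i) (G T) (G U))"

definition reindex_ar :: "nat \<Rightarrow> nat \<Rightarrow> (nat \<Rightarrow> nat) \<Rightarrow> (nat set \<Rightarrow> nat set)
    \<Rightarrow> ('o, 'm) sys_ar \<Rightarrow> ('o, 'm) sys_ar" where
  "reindex_ar n q \<sigma> G = (\<lambda>(X, Y, \<phi>). (reindex_sys n q \<sigma> G X, reindex_sys n q \<sigma> G Y,
     \<lambda>Ss \<in> tuples n q. \<phi> (reindex_tuple \<sigma> G Ss)))"

locale reindexing =
  fixes n q' q :: nat and \<sigma> :: "nat \<Rightarrow> nat" and G :: "nat set \<Rightarrow> nat set"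
  assumes \<sigma>: "\<sigma> permutes {..<n}" and G: "set_hom q' q G"
begin

lemma reindex_tuple_in [simp]: "Ss \<in> tuples n q' \<Longrightarrow> reindex_tuple \<sigma> G Ss \<in> tuples n q"
  using \<sigma> G unfolding tuples_iff by (auto simp: set_permute_list set_hom_def)

lemma reindex_tuple_update:
  assumes "length Ss = n" "i < n"
  shows "reindex_tuple \<sigma> G (Ss[i := T]) = (reindex_tuple \<sigma> G Ss)[inv \<sigma> i := G T]"
proof (rule nth_equalityI)
  fix k assume "k < length (reindex_tuple \<sigma> G (Ss[i := T]))"
  then have k: "k < n" using assms by simp
  have "\<sigma> k < n" using permutes_in_image[OF \<sigma>, of k] k by simp
  moreover have "inv \<sigma> i = k \<longleftrightarrow> i = \<sigma> k" using permutes_inv_eq[OF \<sigma>] by metis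
  ultimately show "reindex_tuple \<sigma> G (Ss[i := T]) ! k
      = (reindex_tuple \<sigma> G Ss)[inv \<sigma> i := G T] ! k"
    using assms k \<sigma> permutes_inverses(2)[OF \<sigma>, of k]
    by (cases "i = \<sigma> k") (simp_all add: permute_list_nth nth_list_update)
qed simp

lemma split_at_reindex [simp]:
  assumes "Ss \<in> tuples n q'" "split_at Ss i T U"
  shows "split_at (reindex_tuple \<sigma> G Ss) (inv \<sigma> i) (G T) (G U)"
proof -
  have i: "i < n" using assms by (auto simp: split_at_def tuples_iff)
  then have "inv \<sigma> i < n" using permutes_in_image[OF permutes_inv[OF \<sigma>], of i] by simp
  moreover have "\<sigma> (inv \<sigma> i) = i" by (rule permutes_inverses[OF \<sigma>])
  ultimately show ?thesis
    using assms G \<sigma> by (simp add: split_at_def tuples_iff permute_list_nth) (metis set_hom_def)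
qed

lemma empty_in_reindex:
  "\<lbrakk>Ss \<in> tuples n q'; {} \<in> set Ss\<rbrakk> \<Longrightarrow> {} \<in> set (reindex_tuple \<sigma> G Ss)"
  using \<sigma> G by (auto simp: set_permute_list tuples_iff set_hom_def intro!: image_eqI[where x = "{}"])

end

locale system_reindexing = permutative_category C + reindexing n q' q \<sigma> G
  for C :: "('o, 'm, 'z) perm_cat_scheme" (structure) and n q' q \<sigma> G
begin

lemma is_sys_reindex:
  assumes "is_system C n q X"
  shows "is_system C n q' (reindex_sys n q' \<sigma> G X)"
proof -
  interpret X: system C n q "fst X" "snd X" using is_sys_system assms .
  have len: "length Ss = n" if "Ss \<in> tuples n q'" for Ss using that by (simp add: tuples_iff)
  have lt: "i < n" if "Ss \<in> tuples n q'" "split_at Ss i T U" for Ss i T U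
    using that by (auto simp: tuples_iff split_at_def)
  note upd = reindex_tuple_update
  have hom: "G {} = {}" "G (S \<union> T) = G S \<union> G T" "G (S \<inter> T) = G S \<inter> G T" for S T
    using G by (auto simp: set_hom_def)
  have "system C n q' (\<lambda>Ss. fst X (reindex_tuple \<sigma> G Ss))
      (\<lambda>Ss i T U. snd X (reindex_tuple \<sigma> G Ss) (inv \<sigma> i) (G T) (G U))"
  proof (rule systemI, goal_cases)
    case (2 Ss)
    then show ?case by (intro X.obj_zero empty_in_reindex) auto
  next
    case (3 Ss i T U)
    then show ?case using lt[OF 3] len by (simp add: upd)
  next
    case (4 Ss i T U)
    then show ?case using hom(1) empty_in_reindex[of Ss] by (intro X.rho_id) auto
  next
    case (5 Ss i T U)
    then show ?case using lt[OF 5] len X.rho_gam[OF reindex_tuple_in split_at_reindex] by (simp add: upd)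
  next
    case (6 Ss i T U V)
    have i: "i < n" using lt[OF 6(1,2)] .
    show ?case
      using X.rho_assoc[OF reindex_tuple_in[OF 6(1)], of "inv \<sigma> i" "G T" "G U" "G V"]
        split_at_reindex[OF 6(1,2)] 6 i len hom(3)[of T U] by (simp add: upd hom)
  next
    case (7 Ss i j T U V W)
    have ij: "i < n" "j < n" using lt 7 by blast+
    have "inv \<sigma> i \<noteq> inv \<sigma> j" using 7(2) permutes_inverses(1)[OF \<sigma>] by (metis less_irrefl)
    from X.rho_comm[OF reindex_tuple_in[OF 7(1)] this split_at_reindex[OF 7(1,3)] split_at_reindex[OF 7(1,4)]]
    show ?case using 7 ij len by (simp add: upd)
  qed simp
  from system.is_sys_mk_sys[OF this] show ?thesis by (simp add: reindex_sys_def)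
qed

lemma is_sys_ar_reindex:
  assumes "is_system_ar C n q (X, Y, \<phi>)"
  shows "is_system_ar C n q' (reindex_ar n q' \<sigma> G (X, Y, \<phi>))"
proof -
  note F = is_sys_arD[OF assms]
  have len: "length Ss = n" if "Ss \<in> tuples n q'" for Ss using that by (simp add: tuples_iff)
  have lt: "i < n" if "Ss \<in> tuples n q'" "split_at Ss i T U" for Ss i T U
    using that by (auto simp: tuples_iff split_at_def)
  have zero: "\<phi> (reindex_tuple \<sigma> G Ss) = Id C \<zero>" if "Ss \<in> tuples n q'" "{} \<in> set Ss" for Ss
    using F(7)[OF reindex_tuple_in[OF that(1)] empty_in_reindex[OF that]] .
  have comm: "\<phi> (reindex_tuple \<sigma> G Ss) \<cdot> snd X (reindex_tuple \<sigma> G Ss) (inv \<sigma> i) (G T) (G U)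
      = snd Y (reindex_tuple \<sigma> G Ss) (inv \<sigma> i) (G T) (G U)
        \<cdot> (\<phi> (reindex_tuple \<sigma> G (Ss[i := T])) \<boxplus> \<phi> (reindex_tuple \<sigma> G (Ss[i := U])))"
    if "Ss \<in> tuples n q'" "split_at Ss i T U" for Ss i T U
    using F(8)[OF reindex_tuple_in[OF that(1)] split_at_reindex[OF that]]
    unfolding reindex_tuple_update[OF len[OF that(1)] lt[OF that]] .
  show ?thesis
    using is_sys_reindex[OF F(1)] is_sys_reindex[OF F(2)] F(4-6)
    unfolding reindex_ar_def prod.case is_sys_ar_iff by (simp add: reindex_sys_def zero comm)
qed

lemma nerve_reindex_ar:
  assumes "f \<in> nerve (systems C n q) r"
  shows "mk_nerve r (\<lambda>i j. reindex_ar n q' \<sigma> G (f i j)) \<in> nerve (systems C n q') r"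
proof (rule nerve_map[OF assms, where P = "reindex_sys n q' \<sigma> G"])
  show "reindex_ar n q' \<sigma> G (Id (systems C n q) X)
      = Id (systems C n q') (reindex_sys n q' \<sigma> G X)"
    if "X \<in> Ob (systems C n q)" for X
    by (auto simp: Id_sys_cat reindex_ar_def reindex_sys_def intro!: restrict_ext)
next
  fix u u' X X' X''
  assume "u \<in> Hom (systems C n q) X X'" "u' \<in> Hom (systems C n q) X' X''"
  then obtain \<phi> \<psi> where "u = (X, X', \<phi>)" "u' = (X', X'', \<psi>)" by (auto simp: Hom_sys_cat)
  then show "reindex_ar n q' \<sigma> G (u' \<cdot>\<^bsub>systems C n q\<^esub> u)
      = reindex_ar n q' \<sigma> G u' \<cdot>\<^bsub>systems C n q'\<^esub> reindex_ar n q' \<sigma> G u"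
    by (auto simp: reindex_ar_def intro!: restrict_ext)
next
  fix u X X'
  assume "u \<in> Hom (systems C n q) X X'"
  then obtain \<phi> where "u = (X, X', \<phi>)" "is_system_ar C n q u" by (auto simp: Hom_sys_cat)
  then show "reindex_ar n q' \<sigma> G u
      \<in> Hom (systems C n q') (reindex_sys n q' \<sigma> G X) (reindex_sys n q' \<sigma> G X')"
    using is_sys_ar_reindex[of X X' \<phi>] by (simp add: Hom_sys_cat) (simp add: reindex_ar_def)
qed (simp add: is_sys_reindex)

lemma reindex_zero_sys:
  "reindex_sys n q' \<sigma> G (zero_sys C (circles n q)) = zero_sys C (circles n q')"
  unfolding reindex_sys_def zero_sys_def by (rule mk_sys_cong) auto

end


lemma (in system_reindexing) reindex_ar_Id:
  "reindex_ar n q' \<sigma> G (Id (systems C n q) X)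
    = Id (systems C n q') (reindex_sys n q' \<sigma> G X)"
  by (auto simp: Id_sys_cat reindex_ar_def reindex_sys_def intro!: restrict_ext)

lemma length_tuple: "Ss \<in> tuples n q \<Longrightarrow> length Ss = n"
  by (simp add: tuples_iff)

lemma split_at_lt: "\<lbrakk>Ss \<in> tuples n q; split_at Ss i T U\<rbrakk> \<Longrightarrow> i < n"
  by (auto simp: tuples_iff split_at_def)

lemma reindex_reindex:
  assumes "\<sigma> permutes {..<n}" "\<tau> permutes {..<n}" "set_hom q'' q' G" "set_hom q' q H"
  shows "reindex_ar n q'' \<sigma> G (reindex_ar n q' \<tau> H F) = reindex_ar n q'' (\<sigma> \<circ> \<tau>) (\<lambda>S. H (G S)) F"
proof -
  interpret reindexing n q'' q' \<sigma> G using assms by unfold_locales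
  have tup: "reindex_tuple \<tau> H (reindex_tuple \<sigma> G Ss) = reindex_tuple (\<sigma> \<circ> \<tau>) (\<lambda>S. H (G S)) Ss"
    if "Ss \<in> tuples n q''" for Ss
    using assms(1,2) length_tuple[OF that]
      permute_list_compose[of \<tau> "map (\<lambda>S. H (G S)) Ss" \<sigma>] permute_list_map[of \<sigma> "map G Ss" H]
    by (simp add: comp_def)
  have inv: "inv (\<sigma> \<circ> \<tau>) i = inv \<tau> (inv \<sigma> i)" for i
    using assms(1,2) by (simp add: o_inv_distrib permutes_bij)
  have "reindex_sys n q'' \<sigma> G (reindex_sys n q' \<tau> H X) = reindex_sys n q'' (\<sigma> \<circ> \<tau>) (\<lambda>S. H (G S)) X"
    for X :: "('a, 'b) sys"
    unfolding reindex_sys_def by (rule mk_sys_cong) (simp_all add: tup inv)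
  then show ?thesis
    by (cases F) (auto simp: reindex_ar_def tup intro!: restrict_ext)
qed

lemma reindex_ar_cong:
  assumes "\<sigma> permutes {..<n}" "\<And>S. S \<subseteq> {1..q'} \<Longrightarrow> G S = H S"
  shows "reindex_ar n q' \<sigma> G F = reindex_ar n q' \<sigma> H F"
proof -
  have tup: "map G Ss = map H Ss" if "Ss \<in> tuples n q'" for Ss
    using assms that by (auto simp: tuples_iff)
  have spl: "G T = H T" "G U = H U" if "Ss \<in> tuples n q'" "split_at Ss i T U" for Ss i T U
  proof -
    have "Ss ! i \<subseteq> {1..q'}" using that by (simp add: tuples_iff split_at_def)
    then show "G T = H T" "G U = H U" using split_atD[OF that(2)] by (auto intro!: assms(2))
  qed
  have "reindex_sys n q' \<sigma> G X = reindex_sys n q' \<sigma> H X" for X :: "('a, 'b) sys"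
    unfolding reindex_sys_def
  proof (rule mk_sys_cong)
    fix Ss i T U assume "Ss \<in> tuples n q'" "split_at Ss i T U"
    then show "snd X (reindex_tuple \<sigma> G Ss) (inv \<sigma> i) (G T) (G U)
        = snd X (reindex_tuple \<sigma> H Ss) (inv \<sigma> i) (H T) (H U)"
      by (simp only: tup spl)
  qed (simp add: tup)
  then show ?thesis by (cases F) (auto simp: reindex_ar_def tup intro!: restrict_ext)
qed

lemma reindex_ar_id:
  assumes "is_system_ar C n q F"
  shows "reindex_ar n q id (\<lambda>S. S) F = F"
proof -
  obtain X Y \<phi> where F: "F = (X, Y, \<phi>)" by (cases F)
  have "is_system C n q X" "is_system C n q Y" "\<phi> \<in> extensional (tuples n q)"
    using assms F by (auto simp: is_sys_ar_def)
  moreover have "reindex_sys n q id (\<lambda>S. S) X = mk_sys (circles n q) (fst X) (snd X)"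
    for X :: "('a, 'b) sys"
    unfolding reindex_sys_def by (rule mk_sys_cong) (simp_all add: inv_id)
  ultimately show ?thesis
    using F by (auto simp: reindex_ar_def is_sys_ext extensional_restrict)
qed

definition preim :: "nat \<Rightarrow> (nat \<Rightarrow> nat) \<Rightarrow> nat set \<Rightarrow> nat set" where
  "preim q g S = {a \<in> {0..q}. g a \<in> S}"

lemma set_hom_preim: "g 0 = 0 \<Longrightarrow> set_hom r q (preim q g)"
  unfolding set_hom_def preim_def
  by (auto simp: subset_iff) (metis One_nat_def Suc_leI le0 le_neq_implies_less not_one_le_zero)

lemma push_ar_circles:
  "push_ar (circles n q) (circles n r) (replicate n g) F = reindex_ar n r id (preim q g) F"
proof -
  have pre: "preimage (circles n q) (replicate n g) i S = preim q g S" if "i < n" for i S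
    using that by (simp add: preimage_def circles_def preim_def)
  have tup: "preimages (circles n q) (replicate n g) Ss = map (preim q g) Ss" if "Ss \<in> tuples n r" for Ss
    using length_tuple[OF that] by (simp add: preimages_def pre list_eq_iff_nth_eq)
  have "push_sys (circles n q) (circles n r) (replicate n g) X = reindex_sys n r id (preim q g) X"
    for X :: "('a, 'b) sys"
    unfolding push_sys_def reindex_sys_def case_prod_beta
    by (rule mk_sys_cong) (auto simp: tup pre split_at_lt inv_id)
  then show ?thesis by (auto simp: push_ar_def reindex_ar_def tup case_prod_beta intro!: restrict_ext)
qed

lemma K_sact_ar_reindex: "K_sact_ar n \<sigma> q F = reindex_ar n q \<sigma> (\<lambda>S. S) F"
  by (simp add: K_sact_ar_def reindex_ar_def K_sact_sys_def reindex_sys_def case_prod_beta)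


section \<open>The iterated structure map\<close>

abbreviation covers :: "nat list \<Rightarrow> nat set list \<Rightarrow> bool" where
  "covers \<equiv> list_all2 (\<in>)"

text \<open>The closed form of the iterated structure map: \<open>xs\<close> lists the points in the new coordinates,
  which come last, and all structure morphisms in the new coordinates are identities.\<close>

definition iter_sys :: "('o, 'm, 'z) perm_cat_scheme \<Rightarrow> nat \<Rightarrow> nat \<Rightarrow> nat list
    \<Rightarrow> ('o, 'm) sys \<Rightarrow> ('o, 'm) sys" where
  "iter_sys C n q xs X = (let c = (\<lambda>Ss. if covers xs (drop n Ss) then fst X (take n Ss) else \<zero>\<^bsub>C\<^esub>)
     in mk_sys (circles (n + length xs) q) c
          (\<lambda>Ss i T U. if i < n \<and> covers xs (drop n Ss) then snd X (take n Ss) i T U else Id C (c Ss)))"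

definition iter_ar :: "('o, 'm, 'z) perm_cat_scheme \<Rightarrow> nat \<Rightarrow> nat \<Rightarrow> nat list
    \<Rightarrow> ('o, 'm) sys_ar \<Rightarrow> ('o, 'm) sys_ar" where
  "iter_ar C n q xs = (\<lambda>(X, Y, \<phi>). (iter_sys C n q xs X, iter_sys C n q xs Y,
     \<lambda>Ss \<in> tuples (n + length xs) q. if covers xs (drop n Ss) then \<phi> (take n Ss) else Id C \<zero>\<^bsub>C\<^esub>))"

lemma covers_empty: "covers xs Ss \<Longrightarrow> {} \<notin> set Ss"
  by (auto simp: list_all2_conv_all_nth in_set_conv_nth)

lemma covers_update:
  "\<lbrakk>length Ss = length xs; k < length xs\<rbrakk>
    \<Longrightarrow> covers xs (Ss[k := T]) \<longleftrightarrow> (\<forall>j < length xs. j \<noteq> k \<longrightarrow> xs ! j \<in> Ss ! j) \<and> xs ! k \<in> T"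
  by (auto simp: list_all2_conv_all_nth nth_list_update)

text \<open>A point of the index set lies in exactly one of the two parts.\<close>

lemma covers_split:
  assumes "length Ss = length xs" "split_at Ss k T U"
  shows "covers xs Ss \<longleftrightarrow> covers xs (Ss[k := T]) \<or> covers xs (Ss[k := U])"
    and "\<not> (covers xs (Ss[k := T]) \<and> covers xs (Ss[k := U]))"
proof -
  note s = split_atD[OF assms(2)]
  then have k: "k < length xs" using assms(1) by simp
  note upd = covers_update[OF assms(1) k]
  have "covers xs Ss \<longleftrightarrow> (\<forall>j < length xs. j \<noteq> k \<longrightarrow> xs ! j \<in> Ss ! j) \<and> xs ! k \<in> T \<union> U"
    using upd[of "T \<union> U"] list_update_id[of Ss k, unfolded s(5)] by simp
  then show "covers xs Ss \<longleftrightarrow> covers xs (Ss[k := T]) \<or> covers xs (Ss[k := U])"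
    unfolding upd by blast
  show "\<not> (covers xs (Ss[k := T]) \<and> covers xs (Ss[k := U]))"
    using covers_update[OF assms(1) k] s(4) by blast
qed

lemma take_tuple [simp]: "Ss \<in> tuples (n + m) q \<Longrightarrow> take n Ss \<in> tuples n q"
  and drop_tuple [simp]: "Ss \<in> tuples (n + m) q \<Longrightarrow> drop n Ss \<in> tuples m q"
  by (auto simp: tuples_iff dest: in_set_takeD in_set_dropD)

lemma split_at_take [simp]: "split_at Ss i T U \<Longrightarrow> i < n \<Longrightarrow> split_at (take n Ss) i T U"
  by (simp add: split_at_def)

lemma split_at_drop [simp]: "split_at Ss i T U \<Longrightarrow> n \<le> i \<Longrightarrow> split_at (drop n Ss) (i - n) T U"
  by (auto simp: split_at_def)

lemma drop_update: "drop n (Ss[i := T]) = (if i < n then drop n Ss else (drop n Ss)[i - n := T])"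
  by (simp add: drop_update_swap drop_update_cancel)

lemma take_update: "take n (Ss[i := T]) = (if i < n then (take n Ss)[i := T] else take n Ss)"
  by (simp add: take_update_swap list_update_beyond)

context permutative_category
begin

lemma is_sys_iter:
  assumes "is_system C n q X"
  shows "is_system C (n + length xs) q (iter_sys C n q xs X)"
proof -
  interpret X: system C n q "fst X" "snd X" using is_sys_system assms .
  let ?m = "length xs"
  define c where "c Ss = (if covers xs (drop n Ss) then fst X (take n Ss) else \<zero>)" for Ss
  define \<rho> where "\<rho> Ss i T U = (if i < n \<and> covers xs (drop n Ss) then snd X (take n Ss) i T U else Id C (c Ss))"
    for Ss i T U
  have len: "length (drop n Ss) = ?m" if "Ss \<in> tuples (n + ?m) q" for Ss
    using that by (simp add: tuples_iff)
  note upd = drop_update take_update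
  have ob [simp]: "c Ss \<in> Ob C" if "Ss \<in> tuples (n + ?m) q" for Ss
    using that by (simp add: c_def)
  \<comment> \<open>The point of a new coordinate lies in at most one of the two parts of a splitting.\<close>
  have new: "c (Ss[i := T]) = c Ss \<and> c (Ss[i := U]) = \<zero> \<or> c (Ss[i := T]) = \<zero> \<and> c (Ss[i := U]) = c Ss"
    if "Ss \<in> tuples (n + ?m) q" "split_at Ss i T U" "\<not> i < n" for Ss i T U
    using covers_split[OF len[OF that(1)] split_at_drop[OF that(2)]] that(3) by (auto simp: c_def upd)
  have old: "c (Ss[i := T]) = fst X ((take n Ss)[i := T])" "c (Ss[i := U]) = fst X ((take n Ss)[i := U])"
    "\<rho> Ss i T U = snd X (take n Ss) i T U"
    if "covers xs (drop n Ss)" "i < n" for Ss i T U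
    using that by (simp_all add: c_def upd \<rho>_def)
  have out: "c (Ss[i := T]) = \<zero>" "c (Ss[i := U]) = \<zero>" "\<rho> Ss i T U = Id C \<zero>"
    if "\<not> covers xs (drop n Ss)" "i < n" for Ss i T U
    using that by (simp_all add: c_def upd \<rho>_def)
  have rho_new: "\<rho> Ss i T U = Id C (c Ss)" if "\<not> i < n" for Ss i T U
    using that by (simp add: \<rho>_def)
  have "system C (n + ?m) q c \<rho>"
  proof (rule systemI, goal_cases)
    case (1 Ss)
    then show ?case by simp
  next
    case (2 Ss)
    then have "{} \<in> set (take n Ss) \<or> {} \<in> set (drop n Ss)"
      by (metis Un_iff append_take_drop_id set_append)
    then show ?case using 2 covers_empty X.obj_zero by (auto simp: c_def)
  next
    case (3 Ss i T U)
    show ?case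
    proof (cases "i < n")
      case True
      then show ?thesis using 3 by (auto simp: c_def \<rho>_def upd)
    next
      case False
      then show ?thesis using 3 new[OF 3 False] rho_new[OF False] by auto
    qed
  next
    case (4 Ss i T U)
    have "{} \<in> set (take n Ss) \<union> {T, U}" if "covers xs (drop n Ss)"
      using 4(3) covers_empty[OF that] by (metis Un_iff append_take_drop_id set_append)
    then show ?case using 4 X.rho_id by (auto simp: c_def \<rho>_def)
  next
    case (5 Ss i T U)
    show ?case
    proof (cases "i < n")
      case True
      then show ?thesis
        using 5 X.rho_gam[OF take_tuple[OF 5(1)] split_at_take[OF 5(2) True]]
        by (cases "covers xs (drop n Ss)") (simp_all add: old out)
    next
      case False
      then show ?thesis using 5 new[OF 5 False] rho_new[OF False] by auto
    qed
  next
    case (6 Ss i T U V)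
    have tup: "Ss[i := T] \<in> tuples (n + ?m) q" "Ss[i := V] \<in> tuples (n + ?m) q"
      "Ss[i := T \<union> U] \<in> tuples (n + ?m) q" "Ss[i := U \<union> V] \<in> tuples (n + ?m) q"
      "Ss[i := U] \<in> tuples (n + ?m) q"
      using 6 split_at_tuples[OF 6(1,2)] split_at_tuples[OF 6(1,4)]
        split_at_tuples[OF split_at_tuples(1)[OF 6(1,2)] 6(5)] by simp_all
    show ?case
    proof (cases "i < n")
      case True
      note X = X.rho_assoc[OF take_tuple[OF 6(1)] split_at_take[OF 6(2) True] 6(3)]
      show ?thesis
        using 6 True X by (cases "covers xs (drop n Ss)") (simp_all add: old out upd)
    next
      case False
      then show ?thesis
        using 6 tup new[OF 6(1,2) False] new[OF 6(1,4) False] new[OF tup(3) 6(5) False] new[OF tup(4) 6(6) False]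
        by (auto simp: rho_new)
    qed
  next
    case (7 Ss i j T U V W)
    note tup = split_at_tuples[OF 7(1,3)] split_at_tuples[OF 7(1,4)]
    have spl: "split_at (Ss[j := V]) i T U" "split_at (Ss[j := W]) i T U"
      "split_at (Ss[i := T]) j V W" "split_at (Ss[i := U]) j V W" using 7 by simp_all
    have swap: "Ss[i := A, j := B] = Ss[j := B, i := A]" for A B using 7(2) by (simp add: list_update_swap)
    consider "j < n" | "i < n" "\<not> j < n" | "\<not> i < n" "\<not> j < n" using 7(2) by linarith
    then show ?case
    proof cases
      case 1
      then have ij: "i < n" "j < n" using 7(2) by auto
      have "i \<noteq> j" using 7(2) by simp
      note X = X.rho_comm[OF take_tuple[OF 7(1)] this split_at_take[OF 7(3) ij(1)] split_at_take[OF 7(4) ij(2)]]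
      show ?thesis
        using X ij by (cases "covers xs (drop n Ss)") (simp_all add: old out upd)
    next
      case 2
      then show ?thesis
        using 7 covers_split[OF len[OF 7(1)] split_at_drop[OF 7(4)]]
          split_at_tuples[OF take_tuple[OF 7(1)] split_at_take[OF 7(3) 2(1)]]
        by (cases "covers xs ((drop n Ss)[j - n := V])"; cases "covers xs ((drop n Ss)[j - n := W])")
          (simp_all add: c_def \<rho>_def upd)
    next
      case 3
      then show ?thesis
        using new[OF 7(1,3) 3(1)] new[OF 7(1,4) 3(2)] new[OF tup(1) spl(3) 3(2)] new[OF tup(2) spl(4) 3(2)]
          new[OF tup(3) spl(1) 3(1)] new[OF tup(4) spl(2) 3(1)] ob[OF 7(1)]
        by (cases "c Ss = \<zero>") (auto simp: rho_new swap)
    qed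
  qed
  moreover have "iter_sys C n q xs X = mk_sys (circles (n + ?m) q) c \<rho>"
    unfolding iter_sys_def Let_def by (rule mk_sys_cong) (simp_all add: c_def \<rho>_def)
  ultimately show ?thesis using system.is_sys_mk_sys by simp
qed

lemma is_sys_ar_iter:
  assumes "is_system_ar C n q (X, Y, \<phi>)"
  shows "is_system_ar C (n + length xs) q (iter_ar C n q xs (X, Y, \<phi>))"
proof -
  let ?m = "length xs"
  note XY = is_sys_arD(1,2)[OF assms] and ar = is_sys_arD(4-6)[OF assms]
    and zero = is_sys_arD(7)[OF assms] and comm = is_sys_arD(8)[OF assms]
  interpret X: system C n q "fst X" "snd X" using is_sys_system XY(1) .
  interpret Y: system C n q "fst Y" "snd Y" using is_sys_system XY(2) .
  define \<psi> where "\<psi> Ss = (if covers xs (drop n Ss) then \<phi> (take n Ss) else Id C \<zero>)" for Ss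
  have zero': "\<psi> Ss = Id C \<zero>" if "Ss \<in> tuples (n + ?m) q" "{} \<in> set Ss" for Ss
  proof -
    have "{} \<in> set (take n Ss) \<or> {} \<in> set (drop n Ss)"
      using that(2) by (metis Un_iff append_take_drop_id set_append)
    then show ?thesis using that covers_empty zero by (auto simp: \<psi>_def)
  qed
  have comm': "\<psi> Ss \<cdot> snd (iter_sys C n q xs X) Ss i T U
      = snd (iter_sys C n q xs Y) Ss i T U \<cdot> (\<psi> (Ss[i := T]) \<boxplus> \<psi> (Ss[i := U]))"
    if "Ss \<in> tuples (n + ?m) q" "split_at Ss i T U" for Ss i T U
  proof (cases "i < n")
    case True
    then show ?thesis
      using that comm[OF take_tuple[OF that(1)] split_at_take[OF that(2)]]
      by (simp add: iter_sys_def Let_def \<psi>_def drop_update take_update)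
  next
    case False
    have "length (drop n Ss) = ?m" using that by (simp add: tuples_iff)
    from covers_split[OF this split_at_drop[OF that(2)]] show ?thesis
      using that False ar[OF take_tuple[OF that(1)]]
      by (auto simp: iter_sys_def Let_def \<psi>_def drop_update take_update)
  qed
  have "\<psi> Ss \<in> Ar C \<and> Dom C (\<psi> Ss) = fst (iter_sys C n q xs X) Ss \<and> Cod C (\<psi> Ss) = fst (iter_sys C n q xs Y) Ss"
    if "Ss \<in> tuples (n + ?m) q" for Ss
    using that ar[OF take_tuple[OF that]] by (auto simp: \<psi>_def iter_sys_def Let_def)
  then show ?thesis
    unfolding iter_ar_def prod.case is_sys_ar_iff \<psi>_def[symmetric]
    using XY[THEN is_sys_iter] zero' comm' by simp
qed


lemma iter_ar_Id:
  "iter_ar C n q xs (Id (systems C n q) X)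
    = Id (systems C (n + length xs) q) (iter_sys C n q xs X)"
  by (auto simp: Id_sys_cat iter_ar_def iter_sys_def Let_def intro!: restrict_ext)

lemma nerve_iter_ar:
  assumes "f \<in> nerve (systems C n q) r"
  shows "mk_nerve r (\<lambda>i j. iter_ar C n q xs (f i j)) \<in> nerve (systems C (n + length xs) q) r"
proof (rule nerve_map[OF assms, where P = "iter_sys C n q xs"])
  fix u u' X X' X''
  assume "u \<in> Hom (systems C n q) X X'" "u' \<in> Hom (systems C n q) X' X''"
  then obtain \<phi> \<psi> where "u = (X, X', \<phi>)" "u' = (X', X'', \<psi>)" by (auto simp: Hom_sys_cat)
  then show "iter_ar C n q xs (u' \<cdot>\<^bsub>systems C n q\<^esub> u)
      = iter_ar C n q xs u' \<cdot>\<^bsub>systems C (n + length xs) q\<^esub> iter_ar C n q xs u"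
    by (auto simp: iter_ar_def intro!: restrict_ext)
next
  fix u X X'
  assume "u \<in> Hom (systems C n q) X X'"
  then obtain \<phi> where "u = (X, X', \<phi>)" "is_system_ar C n q u" by (auto simp: Hom_sys_cat)
  then show "iter_ar C n q xs u
      \<in> Hom (systems C (n + length xs) q) (iter_sys C n q xs X) (iter_sys C n q xs X')"
    using is_sys_ar_iter[of n q X X' \<phi>] by (simp add: Hom_sys_cat) (simp add: iter_ar_def)
qed (simp_all add: is_sys_iter iter_ar_Id)

lemma zero_sys_parts [simp]:
  "Ss \<in> tuples n q \<Longrightarrow> fst (zero_sys C (circles n q)) Ss = \<zero>"
  "\<lbrakk>Ss \<in> tuples n q; split_at Ss i T U\<rbrakk> \<Longrightarrow> snd (zero_sys C (circles n q)) Ss i T U = Id C \<zero>"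
  by (simp_all add: zero_sys_def)

lemma is_sys_zero: "is_system C n q (zero_sys C (circles n q))"
  unfolding zero_sys_def by (intro system.is_sys_mk_sys systemI) simp_all

lemma iter_sys_zero_sys:
  "iter_sys C n q xs (zero_sys C (circles n q)) = zero_sys C (circles (n + length xs) q)"
  unfolding iter_sys_def Let_def zero_sys_def[of C "circles (n + length xs) q"]
  by (rule mk_sys_cong) auto

lemma iter_ar_zero:
  assumes "0 \<in> set xs"
  shows "iter_ar C n q xs F = Id (systems C (n + length xs) q) (zero_sys C (circles (n + length xs) q))"
proof -
  have "\<not> covers xs (drop n Ss)" if "Ss \<in> tuples (n + length xs) q" for Ss
  proof
    assume "covers xs (drop n Ss)"
    moreover obtain i where "i < length xs" "xs ! i = 0" using assms by (auto simp: in_set_conv_nth)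
    ultimately have "0 \<in> drop n Ss ! i" "drop n Ss ! i \<in> set (drop n Ss)"
      by (metis list_all2_nthD) (metis \<open>covers xs (drop n Ss)\<close> \<open>i < length xs\<close> list_all2_lengthD nth_mem)
    then show False using drop_tuple[OF that] by (auto simp: tuples_iff dest!: bspec subsetD)
  qed
  then have "iter_sys C n q xs X = zero_sys C (circles (n + length xs) q)" for X
    unfolding iter_sys_def Let_def zero_sys_def by (intro mk_sys_cong) auto
  moreover have "(\<lambda>Ss \<in> tuples (n + length xs) q. if covers xs (drop n Ss) then \<phi> (take n Ss) else Id C \<zero>)
      = (\<lambda>Ss \<in> tuples (n + length xs) q. Id C (fst (zero_sys C (circles (n + length xs) q)) Ss))" for \<phi>
    using \<open>\<And>Ss. Ss \<in> _ \<Longrightarrow> \<not> covers xs (drop n Ss)\<close> by (auto intro!: restrict_ext)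
  ultimately show ?thesis by (cases F) (simp add: iter_ar_def Id_sys_cat)
qed

end

lemma iter_ar_Nil:
  assumes "is_system_ar C n q F"
  shows "iter_ar C n q [] F = F"
proof -
  obtain X Y \<phi> where F: "F = (X, Y, \<phi>)" by (cases F)
  have XY: "is_system C n q X" "is_system C n q Y" "\<phi> \<in> extensional (tuples n q)"
    using assms F by (auto simp: is_sys_ar_def)
  have "iter_sys C n q [] X = mk_sys (circles n q) (fst X) (snd X)" for X
    unfolding iter_sys_def Let_def list.size add_0_right
    by (rule mk_sys_cong) (auto simp: tuples_iff split_at_def)
  moreover have "(\<lambda>Ss \<in> tuples n q. if covers [] (drop n Ss) then \<phi> (take n Ss) else Id C \<zero>\<^bsub>C\<^esub>) = \<phi>"
    using XY(3) by (auto simp: tuples_iff fun_eq_iff extensional_def)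
  ultimately show ?thesis
    using F XY by (auto simp: iter_ar_def is_sys_ext)
qed

lemma iter_ar_Cons: "iter_ar C (Suc n) q ss (iter_ar C n q [s] F) = iter_ar C n q (s # ss) F"
proof -
  have idx: "n + length (s # ss) = Suc n + length ss" by simp
  have cov: "covers (s # ss) (drop n Ss) \<longleftrightarrow> covers ss (drop (Suc n) Ss) \<and> covers [s] (drop n (take (Suc n) Ss))"
    and tup: "take (Suc n) Ss \<in> tuples (Suc n) q" "min n (Suc n) = n"
    and dom: "Ss \<in> tuples (Suc n + length ss) q"
    if "Ss \<in> tuples (n + length (s # ss)) q" for Ss
  proof -
    have "n < length Ss" using that by (simp add: tuples_iff)
    then have "drop n Ss = Ss ! n # drop (Suc n) Ss" "drop n (take (Suc n) Ss) = [Ss ! n]"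
      by (simp_all add: Cons_nth_drop_Suc take_Suc_conv_app_nth)
    then show "covers (s # ss) (drop n Ss)
        \<longleftrightarrow> covers ss (drop (Suc n) Ss) \<and> covers [s] (drop n (take (Suc n) Ss))"
      by auto
    show "Ss \<in> tuples (Suc n + length ss) q" using that by simp
    then show "take (Suc n) Ss \<in> tuples (Suc n) q" by (rule take_tuple)
  qed simp
  have "iter_sys C (Suc n) q ss (iter_sys C n q [s] X) = iter_sys C n q (s # ss) X" for X
    unfolding iter_sys_def[of C "Suc n"] iter_sys_def[of C n q "s # ss"] Let_def idx
  proof (rule mk_sys_cong, goal_cases)
    case (1 Ss)
    then show ?case
      using cov[of Ss] tup[of Ss] by (simp add: iter_sys_def Let_def)
  next
    case (2 Ss i T U)
    then show ?case
      using cov[of Ss] tup[of Ss] by (cases "i < Suc n") (simp_all add: iter_sys_def Let_def)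
  qed
  then show ?thesis
    by (cases F) (auto simp: iter_ar_def cov tup dom intro!: restrict_ext)
qed

lemma K_smap_ar_iter: "K_smap_ar C n q F s = iter_ar C n q [s] F"
proof -
  have facts: "s \<in> last Ss \<longleftrightarrow> covers [s] (drop n Ss)" "butlast Ss = take n Ss"
    if "Ss \<in> tuples (Suc n) q" for Ss
  proof -
    have n: "length Ss = Suc n" using that by (simp add: tuples_iff)
    then show "butlast Ss = take n Ss" by (simp add: butlast_conv_take)
    have "Ss = take n Ss @ [Ss ! n]" using n take_Suc_conv_app_nth[of n Ss] by simp
    then have "last Ss = Ss ! n" "drop n Ss = [Ss ! n]"
      using n by (metis last_snoc, simp add: Cons_nth_drop_Suc[symmetric])
    then show "s \<in> last Ss \<longleftrightarrow> covers [s] (drop n Ss)" by simp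
  qed
  have "K_smap_sys C n q X s = iter_sys C n q [s] X" for X
    unfolding K_smap_sys_def iter_sys_def Let_def case_prod_beta list.size add_Suc_right add_0_right
    by (rule mk_sys_cong) (auto simp: facts)
  then show ?thesis
    by (cases F) (auto simp: K_smap_ar_def iter_ar_def facts intro!: restrict_ext)
qed

lemma reindex_block_sum:
  assumes "\<sigma> permutes {..<n}" "\<tau> permutes {..<m}" "length Ss = n + m"
  shows "take n (reindex_tuple (block_sum n \<sigma> \<tau>) G Ss) = reindex_tuple \<sigma> G (take n Ss)"
    and "drop n (reindex_tuple (block_sum n \<sigma> \<tau>) G Ss) = reindex_tuple \<tau> G (drop n Ss)"
proof -
  have p: "block_sum n \<sigma> \<tau> permutes {..<n + m}" using assms by (rule_tac block_sum_permutes)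
  have lt: "\<sigma> i < n" if "i < n" for i using permutes_in_image[OF assms(1), of i] that by simp
  have lt': "\<tau> i < m" if "i < m" for i using permutes_in_image[OF assms(2), of i] that by simp
  show "take n (reindex_tuple (block_sum n \<sigma> \<tau>) G Ss) = reindex_tuple \<sigma> G (take n Ss)"
    using assms p lt by (auto simp: list_eq_iff_nth_eq permute_list_nth block_sum_def trans_less_add1)
  show "drop n (reindex_tuple (block_sum n \<sigma> \<tau>) G Ss) = reindex_tuple \<tau> G (drop n Ss)"
    using assms p lt' by (auto simp: list_eq_iff_nth_eq permute_list_nth block_sum_def)
qed

text \<open>Reindexing moves the \<open>j\<close>-th new coordinate to place \<open>\<tau> j\<close>, whence the condition on the lists of
  points.  For a simplicial operator of the circle the points themselves change as well.\<close>

lemma iter_reindex: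
  assumes \<sigma>: "\<sigma> permutes {..<n}" and \<tau>: "\<tau> permutes {..<m}" and G: "set_hom q' q G"
    and xs: "length xs = m" "length xs' = m"
    and compat: "\<And>j S. \<lbrakk>j < m; S \<subseteq> {1..q'}\<rbrakk> \<Longrightarrow> xs' ! \<tau> j \<in> S \<longleftrightarrow> xs ! j \<in> G S"
  shows "iter_ar C n q' xs' (reindex_ar n q' \<sigma> G F)
    = reindex_ar (n + m) q' (block_sum n \<sigma> \<tau>) G (iter_ar C n q xs F)"
proof -
  interpret \<sigma>: reindexing n q' q \<sigma> G using \<sigma> G by unfold_locales
  interpret s: reindexing "n + m" q' q "block_sum n \<sigma> \<tau>" G
    using block_sum_permutes[OF \<sigma> \<tau>] G by unfold_locales
  have cov: "covers xs' (drop n Ss) \<longleftrightarrow> covers xs (reindex_tuple \<tau> G (drop n Ss))"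
    if "Ss \<in> tuples (n + m) q'" for Ss
  proof -
    have sub: "drop n Ss ! j \<subseteq> {1..q'}" if "j < m" for j
      using drop_tuple[OF \<open>Ss \<in> tuples (n + m) q'\<close>] that by (auto simp: tuples_iff)
    have len: "length (drop n Ss) = m" using drop_tuple[OF that] by (rule length_tuple)
    have lt: "\<tau> j < m" if "j < m" for j using permutes_in_image[OF \<tau>, of j] that by simp
    have "covers xs' (drop n Ss) \<longleftrightarrow> (\<forall>j \<in> {..<m}. xs' ! j \<in> drop n Ss ! j)"
      using xs len by (simp add: list_all2_conv_all_nth Ball_def)
    also have "\<dots> \<longleftrightarrow> (\<forall>j \<in> \<tau> ` {..<m}. xs' ! j \<in> drop n Ss ! j)"
      using permutes_image[OF \<tau>] by simp
    also have "\<dots> \<longleftrightarrow> (\<forall>j < m. xs ! j \<in> G (drop n Ss ! \<tau> j))"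
      using compat[OF _ sub[OF lt]] by auto
    also have "\<dots> \<longleftrightarrow> covers xs (reindex_tuple \<tau> G (drop n Ss))"
      using xs len lt \<tau> by (simp add: list_all2_conv_all_nth permute_list_nth)
    finally show ?thesis .
  qed
  note blk = reindex_block_sum[OF \<sigma> \<tau> length_tuple]
  have inv: "inv (block_sum n \<sigma> \<tau>) i = (if i < n then inv \<sigma> i else n + inv \<tau> (i - n))" for i
    by (simp add: inv_block_sum[OF \<sigma> \<tau>] block_sum_def)
  have s': "inv \<sigma> i < n \<longleftrightarrow> i < n" for i
    using permutes_in_image[OF permutes_inv[OF \<sigma>], of i] by simp
  have "iter_sys C n q' xs' (reindex_sys n q' \<sigma> G X)
      = reindex_sys (n + m) q' (block_sum n \<sigma> \<tau>) G (iter_sys C n q xs X)" for X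
    unfolding reindex_sys_def[of "n + m"] iter_sys_def[of C n q'] Let_def xs
  proof (rule mk_sys_cong, goal_cases)
    case (1 Ss)
    then show ?case using s.reindex_tuple_in[OF 1]
      by (simp add: iter_sys_def Let_def xs cov blk reindex_sys_def)
  next
    case (2 Ss i T U)
    then show ?case using s.reindex_tuple_in[OF 2(1)] s.split_at_reindex[OF 2]
      by (simp add: iter_sys_def Let_def xs cov blk reindex_sys_def inv s')
  qed
  then show ?thesis
    using s.reindex_tuple_in
    by (cases F) (auto simp: iter_ar_def reindex_ar_def xs cov blk intro!: restrict_ext)
qed


section \<open>The spectrum of a permutative category\<close>

lemma circle_op_0 [simp]: "circle_op r \<alpha> 0 = 0"
  unfolding circle_op_def by (auto intro!: Least_equality)

lemma circle_op_id: "x \<le> q \<Longrightarrow> circle_op q id x = x"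
  unfolding circle_op_def by (auto intro!: Least_equality)

lemma circle_op_eqI:
  assumes "\<And>i. i \<le> r \<Longrightarrow> x \<le> \<alpha> i \<longleftrightarrow> y \<le> \<beta> i"
  shows "circle_op r \<alpha> x = circle_op r \<beta> y"
proof (cases "\<exists>i\<le>r. x \<le> \<alpha> i")
  case True
  then obtain i where i: "i \<le> r" "x \<le> \<alpha> i" by blast
  let ?k = "LEAST i. x \<le> \<alpha> i"
  have k: "?k \<le> r" "x \<le> \<alpha> ?k" using i Least_le[of "\<lambda>i. x \<le> \<alpha> i" i] LeastI[of "\<lambda>i. x \<le> \<alpha> i" i] by auto
  have "(LEAST i. y \<le> \<beta> i) = ?k"
  proof (rule Least_equality)
    show "y \<le> \<beta> ?k" using k assms by blast
    show "?k \<le> j" if "y \<le> \<beta> j" for j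
      using assms[of j] that k(1) by (cases "j \<le> r") (auto intro: Least_le)
  qed
  then show ?thesis using True i assms by (auto simp: circle_op_def)
next
  case False
  then show ?thesis using assms by (auto simp: circle_op_def)
qed

text \<open>If \<open>x \<le> \<alpha> j\<close> for some \<open>j \<le> r\<close>, then by monotonicity this holds exactly for the \<open>j\<close> from
  \<open>circle_op r \<alpha> x\<close> on; otherwise both sides are the basepoint.\<close>

lemma circle_op_comp:
  assumes "mono_map r q \<alpha>" "mono_map s r \<beta>"
  shows "circle_op s (\<alpha> \<circ> \<beta>) x = circle_op s \<beta> (circle_op r \<alpha> x)"
proof (cases "\<exists>i\<le>r. x \<le> \<alpha> i")
  case True
  then obtain i where i: "i \<le> r" "x \<le> \<alpha> i" by blast
  let ?k = "LEAST i. x \<le> \<alpha> i"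
  have k: "?k \<le> r" "x \<le> \<alpha> ?k" using i Least_le[of "\<lambda>i. x \<le> \<alpha> i" i] LeastI[of "\<lambda>i. x \<le> \<alpha> i" i] by auto
  have "x \<le> \<alpha> j \<longleftrightarrow> ?k \<le> j" if "j \<le> r" for j
    using assms(1) that k by (auto simp: mono_map_def mono_on_def intro: Least_le order.trans)
  then have "circle_op s (\<alpha> \<circ> \<beta>) x = circle_op s \<beta> ?k"
    using assms(2) by (intro circle_op_eqI) (auto simp: mono_map_def)
  then show ?thesis using True by (simp add: circle_op_def[of r \<alpha>])
next
  case False
  then have "circle_op r \<alpha> x = 0" "circle_op s (\<alpha> \<circ> \<beta>) x = 0"
    using assms(2) by (auto simp: circle_op_def mono_map_def Pi_iff)
  then show ?thesis by simp
qed

context permutative_category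
begin

abbreviation KC :: "('o, 'm) K_simplex spectrum" where
  "KC \<equiv> K_spectrum C"

abbreviation K_level :: "nat \<Rightarrow> nat \<Rightarrow> ('o, 'm) K_simplex set" where
  "K_level n q \<equiv> nerve (systems C n q) q"

definition K_zero :: "nat \<Rightarrow> nat \<Rightarrow> ('o, 'm) K_simplex" where
  "K_zero n q = mk_nerve q (\<lambda>i j. Id (systems C n q) (zero_sys C (circles n q)))"

definition K_reindex :: "nat \<Rightarrow> nat \<Rightarrow> (nat \<Rightarrow> nat) \<Rightarrow> (nat set \<Rightarrow> nat set) \<Rightarrow> (nat \<Rightarrow> nat)
    \<Rightarrow> ('o, 'm) K_simplex \<Rightarrow> ('o, 'm) K_simplex" where
  "K_reindex n r \<sigma> G \<alpha> f = mk_nerve r (\<lambda>i j. reindex_ar n r \<sigma> G (f (\<alpha> i) (\<alpha> j)))"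

definition K_iter :: "nat \<Rightarrow> nat \<Rightarrow> nat list \<Rightarrow> ('o, 'm) K_simplex \<Rightarrow> ('o, 'm) K_simplex" where
  "K_iter n q xs f = mk_nerve q (\<lambda>i j. iter_ar C n q xs (f i j))"

lemma K_simps [simp]:
  "simplices (lev (K_spectrum C) n) q = K_level n q"
  "pt (lev (K_spectrum C) n) q = K_zero n q"
  "sop (lev (K_spectrum C) n) q r \<alpha> = K_reindex n r id (preim q (circle_op r \<alpha>)) \<alpha>"
  "sact (K_spectrum C) n \<sigma> q = K_reindex n q \<sigma> (\<lambda>S. S) id"
  "smap (K_spectrum C) n q f s = K_iter n q [s] f"
  by (simp_all add: K_spectrum_def K_zero_def K_reindex_def K_iter_def push_ar_circles
      K_sact_ar_reindex K_smap_ar_iter fun_eq_iff)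

lemma K_level_ar: "\<lbrakk>f \<in> K_level n q; i \<le> j; j \<le> q\<rbrakk> \<Longrightarrow> is_system_ar C n q (f i j)"
  by (metis Ar_sys_cat nerve_ar)

lemma nerve_constant:
  assumes "is_system C n q X"
  shows "mk_nerve s (\<lambda>i j. Id (systems C n q) X) \<in> nerve (systems C n q) s"
proof -
  interpret X: system C n q "fst X" "snd X" using is_sys_system assms .
  have "is_system_ar C n q (X, X, \<lambda>Ss \<in> tuples n q. Id C (fst X Ss))"
    by (simp add: is_sys_ar_iff assms X.obj_zero)
  then have "Id (systems C n q) X \<in> Hom (systems C n q) X X"
    unfolding Hom_sys_cat Id_sys_cat by blast
  moreover have "Id (systems C n q) X \<cdot>\<^bsub>systems C n q\<^esub> Id (systems C n q) X
      = Id (systems C n q) X"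
    by (auto simp: Id_sys_cat intro!: restrict_ext)
  ultimately show ?thesis
    unfolding nerve_def mem_Collect_eq
    by (intro conjI exI[of _ "\<lambda>i. X"]) (simp_all add: assms)
qed

lemma K_zero_in: "K_zero n q \<in> K_level n q"
  unfolding K_zero_def by (rule nerve_constant[OF is_sys_zero])

lemma set_hom_circle: "set_hom r q (preim q (circle_op r \<alpha>))"
  by (rule set_hom_preim) simp

lemma K_reindex_in:
  assumes "\<sigma> permutes {..<n}" "set_hom r q G" "mono_map r q \<alpha>" "f \<in> K_level n q"
  shows "K_reindex n r \<sigma> G \<alpha> f \<in> K_level n r"
proof -
  interpret system_reindexing C n r q \<sigma> G using assms by unfold_locales
  show ?thesis
    using nerve_reindex_ar[OF nerve_reindex[OF assms(4,3)]]
    by (simp add: K_reindex_def cong: mk_nerve_cong)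
qed

lemma mono_map_id: "mono_map q q id"
  by (simp add: mono_map_def mono_on_def)

lemma mono_mapD: "mono_map r q \<alpha> \<Longrightarrow> i \<le> j \<Longrightarrow> j \<le> r \<Longrightarrow> \<alpha> i \<le> \<alpha> j \<and> \<alpha> j \<le> q"
  by (auto simp: mono_map_def mono_on_def)

lemma K_reindex_zero:
  assumes "\<sigma> permutes {..<n}" "set_hom r q G" "mono_map r q \<alpha>"
  shows "K_reindex n r \<sigma> G \<alpha> (K_zero n q) = K_zero n r"
proof -
  interpret system_reindexing C n r q \<sigma> G using assms by unfold_locales
  show ?thesis
    using mono_mapD[OF assms(3)]
    by (auto simp: K_reindex_def K_zero_def reindex_ar_Id reindex_zero_sys intro!: mk_nerve_cong)
qed

lemma K_reindex_id: "f \<in> K_level n q \<Longrightarrow> K_reindex n q id (\<lambda>S. S) id f = f"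
  using mk_nerve_cong[of q "\<lambda>i j. reindex_ar n q id (\<lambda>S. S) (f i j)" f] nerve_ext[of f]
    reindex_ar_id[OF K_level_ar[of f n q]]
  by (simp add: K_reindex_def)

lemma K_reindex_reindex:
  assumes "\<sigma> permutes {..<n}" "\<tau> permutes {..<n}" "set_hom s r G" "set_hom r q H" "mono_map s r \<beta>"
  shows "K_reindex n s \<sigma> G \<beta> (K_reindex n r \<tau> H \<alpha> f) = K_reindex n s (\<sigma> \<circ> \<tau>) (\<lambda>S. H (G S)) (\<alpha> \<circ> \<beta>) f"
  using mono_mapD[OF assms(5)]
  by (auto simp: K_reindex_def reindex_reindex[OF assms(1-4)] intro!: mk_nerve_cong)

lemma K_reindex_cong:
  assumes "\<sigma> permutes {..<n}" "\<And>S. S \<subseteq> {1..r} \<Longrightarrow> G S = H S" "\<And>i. i \<le> r \<Longrightarrow> \<alpha> i = \<beta> i"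
  shows "K_reindex n r \<sigma> G \<alpha> f = K_reindex n r \<sigma> H \<beta> f"
  using assms(3) reindex_ar_cong[OF assms(1), of r G H, OF assms(2)]
  unfolding K_reindex_def by (intro mk_nerve_cong) simp

lemma K_iter_in: "f \<in> K_level n q \<Longrightarrow> K_iter n q xs f \<in> K_level (n + length xs) q"
  unfolding K_iter_def by (rule nerve_iter_ar)

lemma K_iter_zero_elem: "0 \<in> set xs \<Longrightarrow> K_iter n q xs f = K_zero (n + length xs) q"
  by (simp add: K_iter_def K_zero_def iter_ar_zero)

lemma K_iter_zero: "K_iter n q xs (K_zero n q) = K_zero (n + length xs) q"
  by (auto simp: K_iter_def K_zero_def iter_ar_Id iter_sys_zero_sys intro!: mk_nerve_cong)

lemma K_iter_reindex:
  assumes "\<sigma> permutes {..<n}" "\<tau> permutes {..<m}" "set_hom r q G" "length xs = m" "length xs' = m"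
    and "\<And>j S. \<lbrakk>j < m; S \<subseteq> {1..r}\<rbrakk> \<Longrightarrow> xs' ! \<tau> j \<in> S \<longleftrightarrow> xs ! j \<in> G S" and "mono_map r q \<alpha>"
  shows "K_iter n r xs' (K_reindex n r \<sigma> G \<alpha> f)
    = K_reindex (n + m) r (block_sum n \<sigma> \<tau>) G \<alpha> (K_iter n q xs f)"
  using mono_mapD[OF assms(7)] iter_reindex[OF assms(1-6)]
  unfolding K_reindex_def K_iter_def by (intro mk_nerve_cong) simp

lemma iter_smap_K: "f \<in> K_level n q \<Longrightarrow> iter_smap (K_spectrum C) n q f xs = K_iter n q xs f"
proof (induction xs arbitrary: n f)
  case Nil
  have "K_iter n q [] f = mk_nerve q f"
    using iter_ar_Nil[OF K_level_ar[OF Nil]] by (auto simp: K_iter_def intro!: mk_nerve_cong)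
  then show ?case using nerve_ext[OF Nil] by simp
next
  case (Cons s ss)
  have "K_iter (Suc n) q ss (K_iter n q [s] f) = K_iter n q (s # ss) f"
    by (auto simp: K_iter_def iter_ar_Cons intro!: mk_nerve_cong)
  then show ?case using Cons.IH[of "K_iter n q [s] f" "Suc n"] K_iter_in[OF Cons.prems, of "[s]"] by simp
qed

lemma sph_act_K:
  "f \<in> K_level n q \<Longrightarrow> sph_act (K_spectrum C) n m q f u
    = (case u of None \<Rightarrow> K_zero (n + m) q | Some xs \<Rightarrow> K_iter n q xs f)"
  by (simp add: sph_act_def iter_smap_K split: option.split)

text \<open>All axioms are instances of the composition laws for reindexing and of the rules for reindexing
  an iterated structure map.\<close>

lemma symmetric_spectrum_K: "symmetric_spectrum (K_spectrum C)"
proof (rule symmetric_spectrum.intro)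
  fix n
  show "based_simplicial_set (lev KC n)"
  proof
    fix q r \<alpha> \<beta> f
    assume \<alpha>: "mono_map r q \<alpha>" and eq: "\<And>i. i \<le> r \<Longrightarrow> \<alpha> i = \<beta> i"
    have "circle_op r \<alpha> = circle_op r \<beta>" using circle_op_eqI[of r _ \<alpha> _ \<beta>] eq by auto
    then show "sop (lev KC n) q r \<alpha> f = sop (lev KC n) q r \<beta> f"
      using eq by (auto intro: K_reindex_cong permutes_id)
  next
    fix f q assume "f \<in> simplices (lev KC n) q"
    moreover have "K_reindex n q id (preim q (circle_op q id)) id f = K_reindex n q id (\<lambda>S. S) id f"
      by (rule K_reindex_cong) (auto simp: preim_def circle_op_id permutes_id subset_iff)
    ultimately show "sop (lev KC n) q q id f = f" by (simp add: K_reindex_id)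
  next
    fix q r s \<alpha> \<beta> f
    assume a: "mono_map r q \<alpha>" "mono_map s r \<beta>" "f \<in> simplices (lev KC n) q"
    have "preim q (circle_op r \<alpha>) (preim r (circle_op s \<beta>) S) = preim q (circle_op s (\<alpha> \<circ> \<beta>)) S" for S
      using circle_op_le by (auto simp: preim_def circle_op_comp[OF a(1,2)])
    then show "sop (lev KC n) q s (\<alpha> \<circ> \<beta>) f
        = sop (lev KC n) r s \<beta> (sop (lev KC n) q r \<alpha> f)"
      using K_reindex_reindex[OF permutes_id permutes_id set_hom_circle set_hom_circle a(2)] by simp
  qed (auto simp: K_zero_in K_reindex_zero permutes_id set_hom_circle
      intro: K_reindex_in[OF permutes_id set_hom_circle])
next
  fix n q r f and \<sigma> \<alpha> :: "nat \<Rightarrow> nat"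
  assume a: "\<sigma> permutes {..<n}" "mono_map r q \<alpha>" "f \<in> simplices (lev KC n) q"
  show "sact KC n \<sigma> r (sop (lev KC n) q r \<alpha> f)
      = sop (lev KC n) q r \<alpha> (sact KC n \<sigma> q f)"
    using K_reindex_reindex[OF a(1) permutes_id set_hom_id set_hom_circle mono_map_id]
      K_reindex_reindex[OF permutes_id a(1) set_hom_circle set_hom_id a(2)] by simp
next
  fix n q f and \<sigma> \<tau> :: "nat \<Rightarrow> nat"
  assume a: "\<sigma> permutes {..<n}" "\<tau> permutes {..<n}"
  show "sact KC n (\<sigma> \<circ> \<tau>) q f = sact KC n \<sigma> q (sact KC n \<tau> q f)"
    using K_reindex_reindex[OF a set_hom_id set_hom_id mono_map_id] by simp
next
  fix n f q and s :: nat
  assume "f \<in> simplices (lev KC n) q"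
  then show "smap KC n q f s \<in> simplices (lev KC (Suc n)) q"
    using K_iter_in[of f n q "[s]"] by simp
next
  fix n q and s :: nat
  show "smap KC n q (pt (lev KC n) q) s = pt (lev KC (Suc n)) q"
    using K_iter_zero[of n q "[s]"] by simp
next
  fix n q f
  show "smap KC n q f 0 = pt (lev KC (Suc n)) q"
    using K_iter_zero_elem[of "[0]" n q f] by simp
next
  fix n q r \<alpha> f s
  assume a: "mono_map r q \<alpha>" "f \<in> simplices (lev KC n) q" "s \<le> q"
  have "K_iter n r [circle_op r \<alpha> s] (K_reindex n r id (preim q (circle_op r \<alpha>)) \<alpha> f)
    = K_reindex (n + 1) r (block_sum n id id) (preim q (circle_op r \<alpha>)) \<alpha> (K_iter n q [s] f)"
    using a by (intro K_iter_reindex) (auto simp: permutes_id set_hom_circle preim_def)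
  then show "sop (lev KC (Suc n)) q r \<alpha> (smap KC n q f s)
      = smap KC n r (sop (lev KC n) q r \<alpha> f) (circle_op r \<alpha> s)"
    by (simp add: block_sum_id_right permutes_id)
next
  fix n m q f u and \<sigma> \<tau> :: "nat \<Rightarrow> nat"
  assume a: "\<sigma> permutes {..<n}" "\<tau> permutes {..<m}" "f \<in> simplices (lev KC n) q"
    "u \<in> simplices (lev sphere m) q"
  note in' = K_reindex_in[OF a(1) set_hom_id mono_map_id a(3)[simplified]]
  show "sph_act KC n m q (sact KC n \<sigma> q f) (sact sphere m \<tau> q u)
      = sact KC (n + m) (block_sum n \<sigma> \<tau>) q (sph_act KC n m q f u)"
  proof (cases u)
    case None
    then show ?thesis
      using a in' block_sum_permutes[OF a(1,2)]
      by (simp add: sph_act_K sphere_def K_reindex_zero[OF _ set_hom_id mono_map_id])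
  next
    case (Some xs)
    then have m: "length xs = m" using a(4) by (auto simp: sphere_def)
    have "permute_list (inv \<tau>) xs ! \<tau> j = xs ! j" if "j < m" for j
      using that m permutes_in_image[OF a(2), of j] permutes_inverses(2)[OF a(2)] permutes_inv[OF a(2)]
      by (simp add: permute_list_nth)
    then show ?thesis
      using a in' Some m K_iter_reindex[OF a(1,2) set_hom_id m _ _ mono_map_id, where xs' = "permute_list (inv \<tau>) xs" and f = f]
      by (simp add: sph_act_K sphere_def)
  qed
qed (auto simp: K_reindex_zero set_hom_id mono_map_id K_reindex_id
    intro: K_reindex_in[OF _ set_hom_id mono_map_id])

end


section \<open>Linear functors\<close>

text \<open>This captures \<open>- \<otimes> b\<close> and \<open>a \<otimes> -\<close> simultaneously, with \<open>\<delta>\<close> the respective distributivity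
  map.  A structure map \<open>\<rho> : a \<oplus> b \<rightarrow> c\<close> is carried to \<open>Fa \<rho> \<cdot> \<delta> a b : F a \<oplus> F b \<rightarrow> F c\<close>.\<close>

locale linear_functor = permutative_category C for C :: "('o, 'm, 'z) perm_cat_scheme" (structure) +
  fixes F :: "'o \<Rightarrow> 'o" and Fa :: "'m \<Rightarrow> 'm" and \<delta> :: "'o \<Rightarrow> 'o \<Rightarrow> 'm"
  assumes F_ob [simp]: "a \<in> Ob C \<Longrightarrow> F a \<in> Ob C"
    and F_zero [simp]: "F \<zero> = \<zero>"
    and Fa_ar [simp]: "f \<in> Ar C \<Longrightarrow> Fa f \<in> Ar C"
    and dom_Fa [simp]: "f \<in> Ar C \<Longrightarrow> Dom C (Fa f) = F (Dom C f)"
    and cod_Fa [simp]: "f \<in> Ar C \<Longrightarrow> Cod C (Fa f) = F (Cod C f)"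
    and Fa_id [simp]: "a \<in> Ob C \<Longrightarrow> Fa (Id C a) = Id C (F a)"
    and Fa_cmp: "\<lbrakk>f \<in> Ar C; g \<in> Ar C; Dom C g = Cod C f\<rbrakk> \<Longrightarrow> Fa (g \<cdot> f) = Fa g \<cdot> Fa f"
    and \<delta>_ar [simp]: "\<lbrakk>a \<in> Ob C; b \<in> Ob C\<rbrakk> \<Longrightarrow> \<delta> a b \<in> Ar C"
    and dom_\<delta> [simp]: "\<lbrakk>a \<in> Ob C; b \<in> Ob C\<rbrakk> \<Longrightarrow> Dom C (\<delta> a b) = F a \<oplus> F b"
    and cod_\<delta> [simp]: "\<lbrakk>a \<in> Ob C; b \<in> Ob C\<rbrakk> \<Longrightarrow> Cod C (\<delta> a b) = F (a \<oplus> b)"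
    and \<delta>_nat: "\<lbrakk>f \<in> Ar C; g \<in> Ar C\<rbrakk>
      \<Longrightarrow> \<delta> (Cod C f) (Cod C g) \<cdot> (Fa f \<boxplus> Fa g) = Fa (f \<boxplus> g) \<cdot> \<delta> (Dom C f) (Dom C g)"
    and \<delta>_zero: "\<lbrakk>a \<in> Ob C; b \<in> Ob C; \<zero> \<in> {a, b}\<rbrakk> \<Longrightarrow> \<delta> a b = Id C (F (a \<oplus> b))"
    and \<delta>_assoc: "\<lbrakk>a \<in> Ob C; b \<in> Ob C; c \<in> Ob C\<rbrakk>
      \<Longrightarrow> \<delta> (a \<oplus> b) c \<cdot> (\<delta> a b \<boxplus> Id C (F c)) = \<delta> a (b \<oplus> c) \<cdot> (Id C (F a) \<boxplus> \<delta> b c)"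
    and \<delta>_gam: "\<lbrakk>a \<in> Ob C; b \<in> Ob C\<rbrakk> \<Longrightarrow> Fa (\<gamma> a b) \<cdot> \<delta> a b = \<delta> b a \<cdot> \<gamma> (F a) (F b)"
begin

lemma lift_id:
  "\<lbrakk>a \<in> Ob C; b \<in> Ob C; \<zero> \<in> {a, b}\<rbrakk> \<Longrightarrow> Fa (Id C (a \<oplus> b)) \<cdot> \<delta> a b = Id C (F (a \<oplus> b))"
  by (subst \<delta>_zero) simp_all

lemma lift_gam:
  assumes "a \<in> Ob C" "b \<in> Ob C" "\<rho> \<in> Ar C" "Dom C \<rho> = b \<oplus> a"
  shows "(Fa \<rho> \<cdot> \<delta> b a) \<cdot> \<gamma> (F a) (F b) = Fa (\<rho> \<cdot> \<gamma> a b) \<cdot> \<delta> a b"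
proof -
  have "(Fa \<rho> \<cdot> \<delta> b a) \<cdot> \<gamma> (F a) (F b) = Fa \<rho> \<cdot> (\<delta> b a \<cdot> \<gamma> (F a) (F b))"
    using assms by (simp add: cmp_assoc')
  also have "\<dots> = Fa \<rho> \<cdot> (Fa (\<gamma> a b) \<cdot> \<delta> a b)"
    using assms by (simp add: \<delta>_gam)
  also have "\<dots> = Fa (\<rho> \<cdot> \<gamma> a b) \<cdot> \<delta> a b"
    using assms by (simp add: cmp_assoc' Fa_cmp)
  finally show ?thesis .
qed

text \<open>Naturality collects the distributivity maps of a nested sum on the right.\<close>

lemma lift_lift:
  assumes "a \<in> Ob C" "b \<in> Ob C" "c \<in> Ob C" "d \<in> Ob C"
    and f: "f \<in> Ar C" "Dom C f = a \<oplus> b" and g: "g \<in> Ar C" "Dom C g = c \<oplus> d"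
    and \<rho>: "\<rho> \<in> Ar C" "Dom C \<rho> = Cod C f \<oplus> Cod C g"
  shows "(Fa \<rho> \<cdot> \<delta> (Cod C f) (Cod C g)) \<cdot> ((Fa f \<cdot> \<delta> a b) \<boxplus> (Fa g \<cdot> \<delta> c d))
    = Fa (\<rho> \<cdot> (f \<boxplus> g)) \<cdot> (\<delta> (a \<oplus> b) (c \<oplus> d) \<cdot> (\<delta> a b \<boxplus> \<delta> c d))"
proof -
  have "(Fa \<rho> \<cdot> \<delta> (Cod C f) (Cod C g)) \<cdot> ((Fa f \<cdot> \<delta> a b) \<boxplus> (Fa g \<cdot> \<delta> c d))
      = Fa \<rho> \<cdot> (\<delta> (Cod C f) (Cod C g) \<cdot> (Fa f \<boxplus> Fa g)) \<cdot> (\<delta> a b \<boxplus> \<delta> c d)"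
    using assms by (simp add: cmp_assoc' asum_cmp_asum)
  also have "\<dots> = Fa \<rho> \<cdot> (Fa (f \<boxplus> g) \<cdot> \<delta> (a \<oplus> b) (c \<oplus> d)) \<cdot> (\<delta> a b \<boxplus> \<delta> c d)"
    using assms by (simp add: \<delta>_nat)
  also have "\<dots> = Fa (\<rho> \<cdot> (f \<boxplus> g)) \<cdot> (\<delta> (a \<oplus> b) (c \<oplus> d) \<cdot> (\<delta> a b \<boxplus> \<delta> c d))"
    using assms by (simp add: cmp_assoc' Fa_cmp)
  finally show ?thesis .
qed

lemma lift_assoc:
  assumes ob: "a \<in> Ob C" "b \<in> Ob C" "c \<in> Ob C"
    and f: "f \<in> Ar C" "Dom C f = a \<oplus> b" and g: "g \<in> Ar C" "Dom C g = b \<oplus> c"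
    and \<rho>: "\<rho> \<in> Ar C" "Dom C \<rho> = Cod C f \<oplus> c" and \<rho>': "\<rho>' \<in> Ar C" "Dom C \<rho>' = a \<oplus> Cod C g"
    and eq: "\<rho> \<cdot> (f \<boxplus> Id C c) = \<rho>' \<cdot> (Id C a \<boxplus> g)"
  shows "(Fa \<rho> \<cdot> \<delta> (Cod C f) c) \<cdot> ((Fa f \<cdot> \<delta> a b) \<boxplus> Id C (F c))
    = (Fa \<rho>' \<cdot> \<delta> a (Cod C g)) \<cdot> (Id C (F a) \<boxplus> (Fa g \<cdot> \<delta> b c))"
proof -
  have 1: "(Fa \<rho> \<cdot> \<delta> (Cod C f) c) \<cdot> ((Fa f \<cdot> \<delta> a b) \<boxplus> Id C (F c))
      = Fa (\<rho> \<cdot> (f \<boxplus> Id C c)) \<cdot> (\<delta> (a \<oplus> b) c \<cdot> (\<delta> a b \<boxplus> Id C (F c)))"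
    using lift_lift[of a b c \<zero> f "Id C c" \<rho>] assms by (simp add: \<delta>_zero)
  have 2: "(Fa \<rho>' \<cdot> \<delta> a (Cod C g)) \<cdot> (Id C (F a) \<boxplus> (Fa g \<cdot> \<delta> b c))
      = Fa (\<rho>' \<cdot> (Id C a \<boxplus> g)) \<cdot> (\<delta> a (b \<oplus> c) \<cdot> (Id C (F a) \<boxplus> \<delta> b c))"
    using lift_lift[of a \<zero> b c "Id C a" g \<rho>'] assms by (simp add: \<delta>_zero)
  show ?thesis unfolding 1 2 eq using ob by (simp add: \<delta>_assoc)
qed

text \<open>In this form the two middle summands are added first, so that their symmetry can be slid through
  \<open>\<delta> b c\<close>.\<close>

lemma \<delta>_four:
  assumes "a \<in> Ob C" "b \<in> Ob C" "c \<in> Ob C" "d \<in> Ob C"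
  shows "\<delta> (a \<oplus> b) (c \<oplus> d) \<cdot> (\<delta> a b \<boxplus> \<delta> c d)
    = \<delta> a (b \<oplus> c \<oplus> d) \<cdot> (Id C (F a) \<boxplus> (\<delta> (b \<oplus> c) d \<cdot> (\<delta> b c \<boxplus> Id C (F d))))"
proof -
  have "\<delta> (a \<oplus> b) (c \<oplus> d) \<cdot> (\<delta> a b \<boxplus> \<delta> c d)
      = (\<delta> (a \<oplus> b) (c \<oplus> d) \<cdot> (\<delta> a b \<boxplus> Id C (F (c \<oplus> d)))) \<cdot> (Id C (F a \<oplus> F b) \<boxplus> \<delta> c d)"
    using assms by (simp add: cmp_assoc' asum_cmp_asum)
  also have "\<dots> = (\<delta> a (b \<oplus> c \<oplus> d) \<cdot> (Id C (F a) \<boxplus> \<delta> b (c \<oplus> d))) \<cdot> (Id C (F a) \<boxplus> (Id C (F b) \<boxplus> \<delta> c d))"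
    using assms by (simp add: \<delta>_assoc asum_assoc flip: asum_id)
  also have "\<dots> = \<delta> a (b \<oplus> c \<oplus> d) \<cdot> (Id C (F a) \<boxplus> (\<delta> b (c \<oplus> d) \<cdot> (Id C (F b) \<boxplus> \<delta> c d)))"
    using assms by (simp add: cmp_assoc' asum_cmp_asum osum_assoc)
  finally show ?thesis using assms by (simp add: \<delta>_assoc)
qed

lemma \<delta>_mid_swap:
  assumes "a \<in> Ob C" "b \<in> Ob C" "c \<in> Ob C" "d \<in> Ob C"
  shows "Fa (mid_swap C a b c d) \<cdot> (\<delta> (a \<oplus> b) (c \<oplus> d) \<cdot> (\<delta> a b \<boxplus> \<delta> c d))
    = (\<delta> (a \<oplus> c) (b \<oplus> d) \<cdot> (\<delta> a c \<boxplus> \<delta> b d)) \<cdot> mid_swap C (F a) (F b) (F c) (F d)"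
proof -
  let ?k = "\<gamma> b c \<boxplus> Id C d"
  have inner: "Fa ?k \<cdot> (\<delta> (b \<oplus> c) d \<cdot> (\<delta> b c \<boxplus> Id C (F d)))
      = (\<delta> (c \<oplus> b) d \<cdot> (\<delta> c b \<boxplus> Id C (F d))) \<cdot> (\<gamma> (F b) (F c) \<boxplus> Id C (F d))"
  proof -
    have "Fa ?k \<cdot> (\<delta> (b \<oplus> c) d \<cdot> (\<delta> b c \<boxplus> Id C (F d)))
        = (Fa ?k \<cdot> \<delta> (b \<oplus> c) d) \<cdot> (\<delta> b c \<boxplus> Id C (F d))"
      using assms by (simp add: cmp_assoc')
    also have "Fa ?k \<cdot> \<delta> (b \<oplus> c) d = \<delta> (c \<oplus> b) d \<cdot> (Fa (\<gamma> b c) \<boxplus> Id C (F d))"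
      using assms \<delta>_nat[of "\<gamma> b c" "Id C d"] by simp
    also have "\<dots> \<cdot> (\<delta> b c \<boxplus> Id C (F d)) = \<delta> (c \<oplus> b) d \<cdot> ((Fa (\<gamma> b c) \<cdot> \<delta> b c) \<boxplus> Id C (F d))"
      using assms by (simp add: cmp_assoc' asum_cmp_asum)
    also have "\<dots> = (\<delta> (c \<oplus> b) d \<cdot> (\<delta> c b \<boxplus> Id C (F d))) \<cdot> (\<gamma> (F b) (F c) \<boxplus> Id C (F d))"
      using assms by (simp add: \<delta>_gam cmp_assoc' asum_cmp_asum)
    finally show ?thesis .
  qed
  have "Fa (mid_swap C a b c d) \<cdot> (\<delta> (a \<oplus> b) (c \<oplus> d) \<cdot> (\<delta> a b \<boxplus> \<delta> c d))
      = (Fa (Id C a \<boxplus> ?k) \<cdot> \<delta> a (b \<oplus> c \<oplus> d)) \<cdot> (Id C (F a) \<boxplus> (\<delta> (b \<oplus> c) d \<cdot> (\<delta> b c \<boxplus> Id C (F d))))"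
    using assms by (simp add: \<delta>_four cmp_assoc' mid_swap_def osum_assoc)
  also have "Fa (Id C a \<boxplus> ?k) \<cdot> \<delta> a (b \<oplus> c \<oplus> d) = \<delta> a (c \<oplus> b \<oplus> d) \<cdot> (Id C (F a) \<boxplus> Fa ?k)"
    using assms \<delta>_nat[of "Id C a" ?k] by (simp add: osum_assoc)
  also have "\<dots> \<cdot> (Id C (F a) \<boxplus> (\<delta> (b \<oplus> c) d \<cdot> (\<delta> b c \<boxplus> Id C (F d))))
      = \<delta> a (c \<oplus> b \<oplus> d) \<cdot> (Id C (F a) \<boxplus> (Fa ?k \<cdot> (\<delta> (b \<oplus> c) d \<cdot> (\<delta> b c \<boxplus> Id C (F d)))))"
    using assms by (simp add: cmp_assoc' asum_cmp_asum osum_assoc)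
  also have "\<dots> = (\<delta> (a \<oplus> c) (b \<oplus> d) \<cdot> (\<delta> a c \<boxplus> \<delta> b d)) \<cdot> mid_swap C (F a) (F b) (F c) (F d)"
    unfolding inner using assms
    by (simp add: \<delta>_four cmp_assoc' asum_cmp_asum mid_swap_def osum_assoc)
  finally show ?thesis .
qed

lemma lift_comm:
  assumes ob: "a \<in> Ob C" "b \<in> Ob C" "c \<in> Ob C" "d \<in> Ob C"
    and f: "f \<in> Ar C" "Dom C f = a \<oplus> b" and g: "g \<in> Ar C" "Dom C g = c \<oplus> d"
    and \<rho>: "\<rho> \<in> Ar C" "Dom C \<rho> = Cod C f \<oplus> Cod C g"
    and f': "f' \<in> Ar C" "Dom C f' = a \<oplus> c" and g': "g' \<in> Ar C" "Dom C g' = b \<oplus> d"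
    and \<rho>': "\<rho>' \<in> Ar C" "Dom C \<rho>' = Cod C f' \<oplus> Cod C g'"
    and eq: "\<rho> \<cdot> (f \<boxplus> g) = \<rho>' \<cdot> (f' \<boxplus> g') \<cdot> mid_swap C a b c d"
  shows "(Fa \<rho> \<cdot> \<delta> (Cod C f) (Cod C g)) \<cdot> ((Fa f \<cdot> \<delta> a b) \<boxplus> (Fa g \<cdot> \<delta> c d))
    = (Fa \<rho>' \<cdot> \<delta> (Cod C f') (Cod C g')) \<cdot> ((Fa f' \<cdot> \<delta> a c) \<boxplus> (Fa g' \<cdot> \<delta> b d))
        \<cdot> mid_swap C (F a) (F b) (F c) (F d)"
proof -
  have "(Fa \<rho> \<cdot> \<delta> (Cod C f) (Cod C g)) \<cdot> ((Fa f \<cdot> \<delta> a b) \<boxplus> (Fa g \<cdot> \<delta> c d))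
      = Fa (\<rho>' \<cdot> (f' \<boxplus> g')) \<cdot> (Fa (mid_swap C a b c d) \<cdot> (\<delta> (a \<oplus> b) (c \<oplus> d) \<cdot> (\<delta> a b \<boxplus> \<delta> c d)))"
  proof -
    have "Fa (\<rho> \<cdot> (f \<boxplus> g)) = Fa (\<rho>' \<cdot> (f' \<boxplus> g')) \<cdot> Fa (mid_swap C a b c d)"
      unfolding eq using assms(1-16) by (intro Fa_cmp) simp_all
    then show ?thesis
      unfolding lift_lift[OF ob f g \<rho>] using assms(1-16) by (simp add: cmp_assoc')
  qed
  also have "\<dots> = (Fa (\<rho>' \<cdot> (f' \<boxplus> g')) \<cdot> (\<delta> (a \<oplus> c) (b \<oplus> d) \<cdot> (\<delta> a c \<boxplus> \<delta> b d)))
      \<cdot> mid_swap C (F a) (F b) (F c) (F d)"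
    using assms by (simp add: \<delta>_mid_swap cmp_assoc')
  finally show ?thesis using assms by (simp add: lift_lift)
qed

text \<open>Each axiom is preserved by the corresponding lemma above.  For the normalization note that in a
  splitting with an empty index set or an empty part at least one summand is zero.\<close>

lemma system_image:
  assumes "system C n q c \<rho>"
  shows "system C n q (\<lambda>Ss. F (c Ss))
    (\<lambda>Ss i T U. Fa (\<rho> Ss i T U) \<cdot> \<delta> (c (Ss[i := T])) (c (Ss[i := U])))"
proof -
  interpret X: system C n q c \<rho> by fact
  show ?thesis
  proof (rule systemI, goal_cases)
    case (3 Ss i T U)
    then show ?case using split_at_tuples[OF 3] by simp
  next
    case (4 Ss i T U)
    have lt: "i < length Ss" using 4(2) by (simp add: split_at_def)
    have "c (Ss[i := T]) = \<zero> \<or> c (Ss[i := U]) = \<zero>"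
    proof (cases "{} \<in> {T, U}")
      case True
      then show ?thesis
        using X.obj_zero split_at_tuples[OF 4(1,2)] set_update_memI[OF lt] by auto
    next
      case False
      then obtain k where k: "k < length Ss" "Ss ! k = {}" using 4(3) by (auto simp: in_set_conv_nth)
      then have "k \<noteq> i" using False split_atD[OF 4(2)] by auto
      then have "Ss[i := T] ! k = {}" "k < length (Ss[i := T])" using k by simp_all
      then have "{} \<in> set (Ss[i := T])" by (metis nth_mem)
      then show ?thesis using X.obj_zero split_at_tuples[OF 4(1,2)] by blast
    qed
    moreover have "c (Ss[i := T]) \<oplus> c (Ss[i := U]) = c Ss"
      using X.dom_rho[OF 4(1,2)] X.rho_id[OF 4] 4(1) by simp
    ultimately show ?case
      using lift_id[of "c (Ss[i := T])" "c (Ss[i := U])"] split_at_tuples[OF 4(1,2)] X.rho_id[OF 4]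
      by auto
  next
    case (5 Ss i T U)
    then show ?case
      using split_at_tuples[OF 5] split_at_sym[OF 5(2)] X.rho_gam[OF 5]
        lift_gam[of "c (Ss[i := T])" "c (Ss[i := U])" "\<rho> Ss i U T"] by simp
  next
    case (6 Ss i T U V)
    note tup = split_at_tuples[OF 6(1,2)] split_at_tuples[OF 6(1,4)]
    note f = X.rho_ar[OF tup(1) 6(5)] X.dom_rho[OF tup(1) 6(5)] X.cod_rho[OF tup(1) 6(5)]
    note g = X.rho_ar[OF tup(4) 6(6)] X.dom_rho[OF tup(4) 6(6)] X.cod_rho[OF tup(4) 6(6)]
    note k = X.rho_ar[OF 6(1,2)] X.dom_rho[OF 6(1,2)]
    note l = X.rho_ar[OF 6(1,4)] X.dom_rho[OF 6(1,4)]
    have U: "Ss[i := U] \<in> tuples n q" using split_at_tuples(2)[OF tup(1) 6(5)] by simp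
    show ?case
      using lift_assoc[of "c (Ss[i := T])" "c (Ss[i := U])" "c (Ss[i := V])",
          OF _ _ _ f(1) _ g(1) _ k(1) _ l(1) _ X.rho_assoc[OF 6(1-3)]] f g k l tup U
      by simp
  next
    case (7 Ss i j T U V W)
    note tup = split_at_tuples[OF 7(1,3)] split_at_tuples[OF 7(1,4)]
    have ij: "i \<noteq> j" using 7(2) by simp
    have spl: "split_at (Ss[j := V]) i T U" "split_at (Ss[j := W]) i T U"
      "split_at (Ss[i := T]) j V W" "split_at (Ss[i := U]) j V W" using 7 ij by simp_all
    have swap: "Ss[j := B, i := B'] = Ss[i := B', j := B]" for B B' using ij by (simp add: list_update_swap)
    have tup': "Ss[i := B, j := B'] \<in> tuples n q" if "B \<in> {T, U}" "B' \<in> {V, W}" for B B'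
      using that split_at_tuples[OF tup(1) spl(3)] split_at_tuples[OF tup(2) spl(4)] by auto
    note f = X.rho_ar[OF tup(3) spl(1)] X.dom_rho[OF tup(3) spl(1)] X.cod_rho[OF tup(3) spl(1)]
    note g = X.rho_ar[OF tup(4) spl(2)] X.dom_rho[OF tup(4) spl(2)] X.cod_rho[OF tup(4) spl(2)]
    note f' = X.rho_ar[OF tup(1) spl(3)] X.dom_rho[OF tup(1) spl(3)] X.cod_rho[OF tup(1) spl(3)]
    note g' = X.rho_ar[OF tup(2) spl(4)] X.dom_rho[OF tup(2) spl(4)] X.cod_rho[OF tup(2) spl(4)]
    note k = X.rho_ar[OF 7(1,4)] X.dom_rho[OF 7(1,4)]
    note l = X.rho_ar[OF 7(1,3)] X.dom_rho[OF 7(1,3)]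
    show ?case
      using lift_comm[of "c (Ss[i := T, j := V])" "c (Ss[i := U, j := V])"
          "c (Ss[i := T, j := W])" "c (Ss[i := U, j := W])",
          OF _ _ _ _ f(1) _ g(1) _ k(1) _ f'(1) _ g'(1) _ l(1) _ X.rho_comm[OF 7(1) ij 7(3,4)]]
        f g f' g' k l tup'
      by (simp add: swap)
  qed (simp_all add: X.obj_zero)
qed

end


section \<open>The two linear functors of an associative category\<close>

context associative_category
begin

declare oten_ob [simp] one_ob [simp]

lemma aten_ar [simp]:
  assumes "f \<in> Ar A" "g \<in> Ar A"
  shows "f \<boxtimes> g \<in> Ar A" "Dom A (f \<boxtimes> g) = Dom A f \<otimes> Dom A g"
    "Cod A (f \<boxtimes> g) = Cod A f \<otimes> Cod A g"
  using assms aten_hom[of f "Dom A f" "Cod A f" g "Dom A g" "Cod A g"] by (auto simp: Hom_def)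

lemma aten_cmp_aten: "\<lbrakk>f \<in> Ar A; g \<in> Ar A; f' \<in> Ar A; g' \<in> Ar A; Dom A g = Cod A f; Dom A g' = Cod A f'\<rbrakk>
    \<Longrightarrow> (g \<boxtimes> g') \<cdot> (f \<boxtimes> f') = (g \<cdot> f) \<boxtimes> (g' \<cdot> f')"
  by (rule aten_cmp[symmetric]) (auto intro: HomI)

declare aten_id [simp] dl_one [simp] dr_one [simp]

lemma zero_oten_simps [simp]: "a \<in> Ob A \<Longrightarrow> a \<otimes> \<zero> = \<zero>" "a \<in> Ob A \<Longrightarrow> \<zero> \<otimes> a = \<zero>"
  "f \<in> Ar A \<Longrightarrow> f \<boxtimes> Id A \<zero> = Id A \<zero>" "f \<in> Ar A \<Longrightarrow> Id A \<zero> \<boxtimes> f = Id A \<zero>"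
  using zero_oten zero_aten by auto

lemma one_oten_simps [simp]: "a \<in> Ob A \<Longrightarrow> a \<otimes> \<one> = a" "a \<in> Ob A \<Longrightarrow> \<one> \<otimes> a = a"
  "f \<in> Ar A \<Longrightarrow> f \<boxtimes> Id A \<one> = f" "f \<in> Ar A \<Longrightarrow> Id A \<one> \<boxtimes> f = f"
  using oten_one aten_one by auto

lemma dl_ar [simp]:
  assumes "a \<in> Ob A" "a' \<in> Ob A" "b \<in> Ob A"
  shows "dl A a a' b \<in> Ar A" "Dom A (dl A a a' b) = (a \<otimes> b) \<oplus> (a' \<otimes> b)"
    "Cod A (dl A a a' b) = (a \<oplus> a') \<otimes> b"
  using assms dl_hom[of a a' b] by (auto simp: Hom_def)

lemma dr_ar [simp]:
  assumes "a \<in> Ob A" "b \<in> Ob A" "b' \<in> Ob A"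
  shows "dr A a b b' \<in> Ar A" "Dom A (dr A a b b') = (a \<otimes> b) \<oplus> (a \<otimes> b')"
    "Cod A (dr A a b b') = a \<otimes> (b \<oplus> b')"
  using assms dr_hom[of a b b'] by (auto simp: Hom_def)

lemma dl_zero_simps [simp]:
  "\<lbrakk>a \<in> Ob A; b \<in> Ob A\<rbrakk> \<Longrightarrow> dl A a \<zero> b = Id A (a \<otimes> b)"
  "\<lbrakk>a \<in> Ob A; b \<in> Ob A\<rbrakk> \<Longrightarrow> dl A \<zero> a b = Id A (a \<otimes> b)"
  "\<lbrakk>a \<in> Ob A; a' \<in> Ob A\<rbrakk> \<Longrightarrow> dl A a a' \<zero> = Id A \<zero>"
  by (simp_all add: dl_zero)

lemma dr_zero_simps [simp]:
  "\<lbrakk>a \<in> Ob A; b \<in> Ob A\<rbrakk> \<Longrightarrow> dr A a b \<zero> = Id A (a \<otimes> b)"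
  "\<lbrakk>a \<in> Ob A; b \<in> Ob A\<rbrakk> \<Longrightarrow> dr A a \<zero> b = Id A (a \<otimes> b)"
  "\<lbrakk>b \<in> Ob A; b' \<in> Ob A\<rbrakk> \<Longrightarrow> dr A \<zero> b b' = Id A \<zero>"
  by (simp_all add: dr_zero)

lemma dl_natural:
  assumes "f \<in> Ar A" "f' \<in> Ar A" "g \<in> Ar A"
  shows "dl A (Cod A f) (Cod A f') (Cod A g) \<cdot> ((f \<boxtimes> g) \<boxplus> (f' \<boxtimes> g))
    = ((f \<boxplus> f') \<boxtimes> g) \<cdot> dl A (Dom A f) (Dom A f') (Dom A g)"
  using assms by (intro dl_nat) (auto intro: HomI)

lemma dr_natural:
  assumes "f \<in> Ar A" "g \<in> Ar A" "g' \<in> Ar A"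
  shows "dr A (Cod A f) (Cod A g) (Cod A g') \<cdot> ((f \<boxtimes> g) \<boxplus> (f \<boxtimes> g'))
    = (f \<boxtimes> (g \<boxplus> g')) \<cdot> dr A (Dom A f) (Dom A g) (Dom A g')"
  using assms by (intro dr_nat) (auto intro: HomI)

lemma linear_functor_left:
  assumes "b \<in> Ob A"
  shows "linear_functor A (\<lambda>a. a \<otimes> b) (\<lambda>f. f \<boxtimes> Id A b) (\<lambda>a a'. dl A a a' b)"
proof
  fix f g assume "f \<in> Ar A" "g \<in> Ar A"
  then show "dl A (Cod A f) (Cod A g) b \<cdot> ((f \<boxtimes> Id A b) \<boxplus> (g \<boxtimes> Id A b))
      = ((f \<boxplus> g) \<boxtimes> Id A b) \<cdot> dl A (Dom A f) (Dom A g) b"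
    using dl_natural[of f g "Id A b"] assms by simp
qed (use assms dl_zero dl_assoc dl_gam in \<open>auto simp: aten_cmp_aten\<close>)

lemma linear_functor_right:
  assumes "a \<in> Ob A"
  shows "linear_functor A (\<lambda>b. a \<otimes> b) (\<lambda>f. Id A a \<boxtimes> f) (dr A a)"
proof
  fix f g assume "f \<in> Ar A" "g \<in> Ar A"
  then show "dr A a (Cod A f) (Cod A g) \<cdot> ((Id A a \<boxtimes> f) \<boxplus> (Id A a \<boxtimes> g))
      = (Id A a \<boxtimes> (f \<boxplus> g)) \<cdot> dr A a (Dom A f) (Dom A g)"
    using dr_natural[of "Id A a" f g] assms by simp
qed (use assms dr_zero dr_assoc dr_gam in \<open>auto simp: aten_cmp_aten\<close>)

text \<open>By naturality both sides are \<open>f \<boxtimes> g\<close> after a composite that distributes over both sums; the two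
  orders in which this can be done are compared by \<open>dl_dr_sum\<close>.\<close>

lemma dl_dr_comm:
  assumes ob: "a \<in> Ob A" "a' \<in> Ob A" "b \<in> Ob A" "b' \<in> Ob A"
    and f: "f \<in> Ar A" "Dom A f = a \<oplus> a'" "Cod A f = x" and g: "g \<in> Ar A" "Dom A g = b \<oplus> b'" "Cod A g = y"
  shows "((Id A x \<boxtimes> g) \<cdot> dr A x b b')
        \<cdot> (((f \<boxtimes> Id A b) \<cdot> dl A a a' b) \<boxplus> ((f \<boxtimes> Id A b') \<cdot> dl A a a' b'))
    = ((f \<boxtimes> Id A y) \<cdot> dl A a a' y)
        \<cdot> (((Id A a \<boxtimes> g) \<cdot> dr A a b b') \<boxplus> ((Id A a' \<boxtimes> g) \<cdot> dr A a' b b'))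
        \<cdot> mid_swap A (a \<otimes> b) (a' \<otimes> b) (a \<otimes> b') (a' \<otimes> b')"
proof -
  have [simp]: "x \<in> Ob A" "y \<in> Ob A" using f g by auto
  let ?D = "dr A (a \<oplus> a') b b' \<cdot> (dl A a a' b \<boxplus> dl A a a' b')"
  let ?E = "dl A a a' (b \<oplus> b') \<cdot> (dr A a b b' \<boxplus> dr A a' b b')"
  have "((Id A x \<boxtimes> g) \<cdot> dr A x b b')
        \<cdot> (((f \<boxtimes> Id A b) \<cdot> dl A a a' b) \<boxplus> ((f \<boxtimes> Id A b') \<cdot> dl A a a' b'))
      = (Id A x \<boxtimes> g) \<cdot> (dr A x b b' \<cdot> ((f \<boxtimes> Id A b) \<boxplus> (f \<boxtimes> Id A b')))
        \<cdot> (dl A a a' b \<boxplus> dl A a a' b')"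
    using assms by (simp add: cmp_assoc' asum_cmp_asum)
  also have "dr A x b b' \<cdot> ((f \<boxtimes> Id A b) \<boxplus> (f \<boxtimes> Id A b')) = (f \<boxtimes> Id A (b \<oplus> b')) \<cdot> dr A (a \<oplus> a') b b'"
    using dr_natural[of f "Id A b" "Id A b'"] assms by simp
  also have "(Id A x \<boxtimes> g) \<cdot> \<dots> \<cdot> (dl A a a' b \<boxplus> dl A a a' b') = (f \<boxtimes> g) \<cdot> ?D"
    using assms by (simp add: cmp_assoc' aten_cmp_aten flip: cmp_assoc'[of _ "f \<boxtimes> Id A (b \<oplus> b')" "Id A x \<boxtimes> g"])
  finally have lhs: "((Id A x \<boxtimes> g) \<cdot> dr A x b b')
        \<cdot> (((f \<boxtimes> Id A b) \<cdot> dl A a a' b) \<boxplus> ((f \<boxtimes> Id A b') \<cdot> dl A a a' b')) = (f \<boxtimes> g) \<cdot> ?D" .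
  have "((f \<boxtimes> Id A y) \<cdot> dl A a a' y)
        \<cdot> (((Id A a \<boxtimes> g) \<cdot> dr A a b b') \<boxplus> ((Id A a' \<boxtimes> g) \<cdot> dr A a' b b'))
      = (f \<boxtimes> Id A y) \<cdot> (dl A a a' y \<cdot> ((Id A a \<boxtimes> g) \<boxplus> (Id A a' \<boxtimes> g)))
        \<cdot> (dr A a b b' \<boxplus> dr A a' b b')"
    using assms by (simp add: cmp_assoc' asum_cmp_asum)
  also have "dl A a a' y \<cdot> ((Id A a \<boxtimes> g) \<boxplus> (Id A a' \<boxtimes> g)) = (Id A (a \<oplus> a') \<boxtimes> g) \<cdot> dl A a a' (b \<oplus> b')"
    using dl_natural[of "Id A a" "Id A a'" g] assms by simp
  also have "(f \<boxtimes> Id A y) \<cdot> \<dots> \<cdot> (dr A a b b' \<boxplus> dr A a' b b') = (f \<boxtimes> g) \<cdot> ?E"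
    using assms by (simp add: cmp_assoc' aten_cmp_aten flip: cmp_assoc'[of _ "Id A (a \<oplus> a') \<boxtimes> g" "f \<boxtimes> Id A y"])
  also have "?E = ?D \<cdot> mid_swap A (a \<otimes> b) (a \<otimes> b') (a' \<otimes> b) (a' \<otimes> b')"
    using ob by (rule dl_dr_sum)
  finally have "((f \<boxtimes> Id A y) \<cdot> dl A a a' y)
        \<cdot> (((Id A a \<boxtimes> g) \<cdot> dr A a b b') \<boxplus> ((Id A a' \<boxtimes> g) \<cdot> dr A a' b b'))
        \<cdot> mid_swap A (a \<otimes> b) (a' \<otimes> b) (a \<otimes> b') (a' \<otimes> b') = (f \<boxtimes> g) \<cdot> ?D"
    using assms by (simp add: cmp_assoc' mid_swap_mid_swap)
  then show ?thesis using lhs by simp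
qed

text \<open>A pair of maps of systems \<open>\<phi>\<close>, \<open>\<psi>\<close> gives a map of external products.  This is the square for a
  splitting in the first block, and the next lemma that for a splitting in the second.\<close>

lemma dl_map:
  assumes "\<phi> \<in> Ar A" "\<phi>T \<in> Ar A" "\<phi>U \<in> Ar A" "\<psi> \<in> Ar A" "\<rho> \<in> Ar A" "\<rho>' \<in> Ar A"
    and "Dom A \<rho> = Dom A \<phi>T \<oplus> Dom A \<phi>U" "Cod A \<rho> = Dom A \<phi>" "Dom A \<rho>' = Cod A \<phi>T \<oplus> Cod A \<phi>U"
    and eq: "\<phi> \<cdot> \<rho> = \<rho>' \<cdot> (\<phi>T \<boxplus> \<phi>U)" and y: "Dom A \<psi> = y" "Cod A \<psi> = y'"
  shows "(\<phi> \<boxtimes> \<psi>) \<cdot> ((\<rho> \<boxtimes> Id A y) \<cdot> dl A (Dom A \<phi>T) (Dom A \<phi>U) y)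
    = ((\<rho>' \<boxtimes> Id A y') \<cdot> dl A (Cod A \<phi>T) (Cod A \<phi>U) y') \<cdot> ((\<phi>T \<boxtimes> \<psi>) \<boxplus> (\<phi>U \<boxtimes> \<psi>))"
proof -
  have yo [simp]: "y \<in> Ob A" "y' \<in> Ob A" using assms by auto
  have "((\<rho>' \<boxtimes> Id A y') \<cdot> dl A (Cod A \<phi>T) (Cod A \<phi>U) y') \<cdot> ((\<phi>T \<boxtimes> \<psi>) \<boxplus> (\<phi>U \<boxtimes> \<psi>))
      = (\<rho>' \<boxtimes> Id A y') \<cdot> (((\<phi>T \<boxplus> \<phi>U) \<boxtimes> \<psi>) \<cdot> dl A (Dom A \<phi>T) (Dom A \<phi>U) y)"
    using assms dl_natural[of \<phi>T \<phi>U \<psi>] by (simp add: cmp_assoc')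
  also have "\<dots> = ((\<phi> \<cdot> \<rho>) \<boxtimes> \<psi>) \<cdot> dl A (Dom A \<phi>T) (Dom A \<phi>U) y"
    using assms by (simp add: aten_cmp_aten flip: cmp_assoc')
  also have "\<dots> = (\<phi> \<boxtimes> \<psi>) \<cdot> ((\<rho> \<boxtimes> Id A y) \<cdot> dl A (Dom A \<phi>T) (Dom A \<phi>U) y)"
    using assms(1-9) y by (simp add: aten_cmp_aten flip: cmp_assoc')
  finally show ?thesis by simp
qed

lemma dr_map:
  assumes "\<phi> \<in> Ar A" "\<phi>T \<in> Ar A" "\<phi>U \<in> Ar A" "\<psi> \<in> Ar A" "\<rho> \<in> Ar A" "\<rho>' \<in> Ar A"
    and "Dom A \<rho> = Dom A \<phi>T \<oplus> Dom A \<phi>U" "Cod A \<rho> = Dom A \<phi>" "Dom A \<rho>' = Cod A \<phi>T \<oplus> Cod A \<phi>U"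
    and eq: "\<phi> \<cdot> \<rho> = \<rho>' \<cdot> (\<phi>T \<boxplus> \<phi>U)" and y: "Dom A \<psi> = y" "Cod A \<psi> = y'"
  shows "(\<psi> \<boxtimes> \<phi>) \<cdot> ((Id A y \<boxtimes> \<rho>) \<cdot> dr A y (Dom A \<phi>T) (Dom A \<phi>U))
    = ((Id A y' \<boxtimes> \<rho>') \<cdot> dr A y' (Cod A \<phi>T) (Cod A \<phi>U)) \<cdot> ((\<psi> \<boxtimes> \<phi>T) \<boxplus> (\<psi> \<boxtimes> \<phi>U))"
proof -
  have yo [simp]: "y \<in> Ob A" "y' \<in> Ob A" using assms by auto
  have "((Id A y' \<boxtimes> \<rho>') \<cdot> dr A y' (Cod A \<phi>T) (Cod A \<phi>U)) \<cdot> ((\<psi> \<boxtimes> \<phi>T) \<boxplus> (\<psi> \<boxtimes> \<phi>U))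
      = (Id A y' \<boxtimes> \<rho>') \<cdot> ((\<psi> \<boxtimes> (\<phi>T \<boxplus> \<phi>U)) \<cdot> dr A y (Dom A \<phi>T) (Dom A \<phi>U))"
    using assms dr_natural[of \<psi> \<phi>T \<phi>U] by (simp add: cmp_assoc')
  also have "\<dots> = (\<psi> \<boxtimes> (\<phi> \<cdot> \<rho>)) \<cdot> dr A y (Dom A \<phi>T) (Dom A \<phi>U)"
    using assms by (simp add: aten_cmp_aten flip: cmp_assoc')
  also have "\<dots> = (\<psi> \<boxtimes> \<phi>) \<cdot> ((Id A y \<boxtimes> \<rho>) \<cdot> dr A y (Dom A \<phi>T) (Dom A \<phi>U))"
    using assms(1-9) y by (simp add: aten_cmp_aten flip: cmp_assoc')
  finally show ?thesis by simp
qed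

text \<open>The structure maps of a triple product: the coordinate that is split may lie in the first, in
  the second or in the third block.\<close>

lemma dl_dl:
  assumes "a \<in> Ob A" "a' \<in> Ob A" "b \<in> Ob A" "c \<in> Ob A" "\<rho> \<in> Ar A" "Dom A \<rho> = a \<oplus> a'"
  shows "(((\<rho> \<boxtimes> Id A b) \<cdot> dl A a a' b) \<boxtimes> Id A c) \<cdot> dl A (a \<otimes> b) (a' \<otimes> b) c
    = (\<rho> \<boxtimes> Id A (b \<otimes> c)) \<cdot> dl A a a' (b \<otimes> c)"
proof -
  have "((\<rho> \<boxtimes> Id A b) \<cdot> dl A a a' b) \<boxtimes> Id A c
      = ((\<rho> \<boxtimes> Id A b) \<boxtimes> Id A c) \<cdot> (dl A a a' b \<boxtimes> Id A c)"
    using assms by (simp add: aten_cmp_aten)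
  then show ?thesis
    using assms by (simp add: dl_ten cmp_assoc' aten_assoc oten_assoc)
qed

lemma dr_dl:
  assumes "a \<in> Ob A" "b \<in> Ob A" "b' \<in> Ob A" "c \<in> Ob A" "\<rho> \<in> Ar A" "Dom A \<rho> = b \<oplus> b'"
  shows "(((Id A a \<boxtimes> \<rho>) \<cdot> dr A a b b') \<boxtimes> Id A c) \<cdot> dl A (a \<otimes> b) (a \<otimes> b') c
    = (Id A a \<boxtimes> ((\<rho> \<boxtimes> Id A c) \<cdot> dl A b b' c)) \<cdot> dr A a (b \<otimes> c) (b' \<otimes> c)"
proof -
  have 1: "((Id A a \<boxtimes> \<rho>) \<cdot> dr A a b b') \<boxtimes> Id A c
      = ((Id A a \<boxtimes> \<rho>) \<boxtimes> Id A c) \<cdot> (dr A a b b' \<boxtimes> Id A c)"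
    using assms by (simp add: aten_cmp_aten)
  have 2: "Id A a \<boxtimes> ((\<rho> \<boxtimes> Id A c) \<cdot> dl A b b' c)
      = (Id A a \<boxtimes> (\<rho> \<boxtimes> Id A c)) \<cdot> (Id A a \<boxtimes> dl A b b' c)"
    using assms by (simp add: aten_cmp_aten)
  show ?thesis
    using assms unfolding 1 2 by (simp add: dl_dr_ten cmp_assoc' aten_assoc oten_assoc)
qed

lemma dr_dr:
  assumes "a \<in> Ob A" "b \<in> Ob A" "c \<in> Ob A" "c' \<in> Ob A" "\<rho> \<in> Ar A" "Dom A \<rho> = c \<oplus> c'"
  shows "(Id A (a \<otimes> b) \<boxtimes> \<rho>) \<cdot> dr A (a \<otimes> b) c c'
    = (Id A a \<boxtimes> ((Id A b \<boxtimes> \<rho>) \<cdot> dr A b c c')) \<cdot> dr A a (b \<otimes> c) (b \<otimes> c')"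
proof -
  have 1: "Id A a \<boxtimes> ((Id A b \<boxtimes> \<rho>) \<cdot> dr A b c c')
      = (Id A a \<boxtimes> (Id A b \<boxtimes> \<rho>)) \<cdot> (Id A a \<boxtimes> dr A b c c')"
    using assms by (simp add: aten_cmp_aten)
  have 2: "Id A (a \<otimes> b) \<boxtimes> \<rho> = Id A a \<boxtimes> (Id A b \<boxtimes> \<rho>)"
    using assms aten_assoc[of "Id A a" "Id A b" \<rho>] by simp
  show ?thesis
    using assms unfolding 1 2 by (simp add: dr_ten cmp_assoc' oten_assoc)
qed

end


section \<open>The external product of systems\<close>

text \<open>The first \<open>p\<close> coordinates of an index tuple belong to \<open>X\<close>, the others to \<open>Y\<close>.\<close>

definition ext_ob :: "('o, 'm, 'z) assoc_cat_scheme \<Rightarrow> nat \<Rightarrow> ('o, 'm) sys \<Rightarrow> ('o, 'm) sys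
    \<Rightarrow> nat set list \<Rightarrow> 'o" where
  "ext_ob A p X Y Ss = fst X (take p Ss) \<otimes>\<^bsub>A\<^esub> fst Y (drop p Ss)"

definition ext_rho :: "('o, 'm, 'z) assoc_cat_scheme \<Rightarrow> nat \<Rightarrow> ('o, 'm) sys \<Rightarrow> ('o, 'm) sys
    \<Rightarrow> nat set list \<Rightarrow> nat \<Rightarrow> nat set \<Rightarrow> nat set \<Rightarrow> 'm" where
  "ext_rho A p X Y Ss i T U = (let P = take p Ss; R = drop p Ss; j = i - p in
     if i < p
     then (snd X P i T U \<boxtimes>\<^bsub>A\<^esub> Id A (fst Y R)) \<cdot>\<^bsub>A\<^esub> dl A (fst X (P[i := T])) (fst X (P[i := U])) (fst Y R)
     else (Id A (fst X P) \<boxtimes>\<^bsub>A\<^esub> snd Y R j T U) \<cdot>\<^bsub>A\<^esub> dr A (fst X P) (fst Y (R[j := T])) (fst Y (R[j := U])))"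

definition ext_sys :: "('o, 'm, 'z) assoc_cat_scheme \<Rightarrow> nat \<Rightarrow> nat \<Rightarrow> nat
    \<Rightarrow> ('o, 'm) sys \<Rightarrow> ('o, 'm) sys \<Rightarrow> ('o, 'm) sys" where
  "ext_sys A q p r X Y = mk_sys (circles (p + r) q) (ext_ob A p X Y) (ext_rho A p X Y)"

definition ext_ar :: "('o, 'm, 'z) assoc_cat_scheme \<Rightarrow> nat \<Rightarrow> nat \<Rightarrow> nat
    \<Rightarrow> ('o, 'm) sys_ar \<Rightarrow> ('o, 'm) sys_ar \<Rightarrow> ('o, 'm) sys_ar" where
  "ext_ar A q p r = (\<lambda>(X, X', \<phi>) (Y, Y', \<psi>). (ext_sys A q p r X Y, ext_sys A q p r X' Y',
     \<lambda>Ss \<in> tuples (p + r) q. \<phi> (take p Ss) \<boxtimes>\<^bsub>A\<^esub> \<psi> (drop p Ss)))"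

lemma empty_take_or_drop: "{} \<in> set Ss \<Longrightarrow> {} \<in> set (take n Ss) \<or> {} \<in> set (drop n Ss)"
  by (metis Un_iff append_take_drop_id set_append)

context associative_category
begin

lemma is_sys_ext_sys:
  assumes X: "is_system A p q X" and Y: "is_system A r q Y"
  shows "is_system A (p + r) q (ext_sys A q p r X Y)"
proof -
  interpret X: system A p q "fst X" "snd X" using is_sys_system X .
  interpret Y: system A r q "fst Y" "snd Y" using is_sys_system Y .
  \<comment> \<open>As long as only the coordinates of one block vary, the product is the image of a system
    under a linear functor.\<close>
  note left = linear_functor.system_image[OF linear_functor_left X.system_axioms]
  note right = linear_functor.system_image[OF linear_functor_right Y.system_axioms]
  note defs = ext_ob_def ext_rho_def Let_def take_update drop_update
  note tup = take_tuple[of _ p r q] drop_tuple[of _ p r q]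
  note spl = split_at_take[of _ _ _ _ p] split_at_drop[of _ _ _ _ p]
  have "system A (p + r) q (ext_ob A p X Y) (ext_rho A p X Y)"
  proof (rule systemI, goal_cases)
    case (1 Ss)
    then show ?case by (simp add: ext_ob_def)
  next
    case (2 Ss)
    then show ?case
      using empty_take_or_drop[OF 2(2), of p] X.obj_zero Y.obj_zero by (auto simp: ext_ob_def)
  next
    case (3 Ss i T U)
    then have ob: "fst X (take p Ss) \<in> Ob A" "fst Y (drop p Ss) \<in> Ob A" by simp_all
    show ?case
    proof (cases "i < p")
      case True
      then show ?thesis
        using system.rho_hom[OF left[OF ob(2)] tup(1)[OF 3(1)] spl(1)[OF 3(2) True]]
        by (simp add: defs Hom_def)
    next
      case False
      then show ?thesis
        using system.rho_hom[OF right[OF ob(1)] tup(2)[OF 3(1)] spl(2)[OF 3(2)]]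
        by (simp add: defs Hom_def)
    qed
  next
    case (4 Ss i T U)
    then have ob: "fst X (take p Ss) \<in> Ob A" "fst Y (drop p Ss) \<in> Ob A" by simp_all
    note e = empty_take_or_drop[of Ss p]
    show ?case
    proof (cases "i < p")
      case True
      note s = spl(1)[OF 4(2) True]
      show ?thesis
      proof (cases "{} \<in> set (drop p Ss)")
        case empty: True
        then show ?thesis
          using True tup[OF 4(1)] split_at_tuples[OF tup(1)[OF 4(1)] s] s Y.obj_zero
          by (simp add: defs)
      next
        case False
        then have "{} \<in> set (take p Ss) \<union> {T, U}" using 4(3) e by blast
        then show ?thesis
          using system.rho_id[OF left[OF ob(2)] tup(1)[OF 4(1)] s] True by (simp add: defs)
      qed
    next
      case False
      then have s: "split_at (drop p Ss) (i - p) T U" using spl(2)[OF 4(2)] by simp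
      show ?thesis
      proof (cases "{} \<in> set (take p Ss)")
        case empty: True
        then show ?thesis
          using False tup[OF 4(1)] split_at_tuples[OF tup(2)[OF 4(1)] s] s X.obj_zero
          by (simp add: defs)
      next
        case non_empty: False
        then have "{} \<in> set (drop p Ss) \<union> {T, U}" using 4(3) e by blast
        then show ?thesis
          using system.rho_id[OF right[OF ob(1)] tup(2)[OF 4(1)] s] False by (simp add: defs)
      qed
    qed
  next
    case (5 Ss i T U)
    then have ob: "fst X (take p Ss) \<in> Ob A" "fst Y (drop p Ss) \<in> Ob A" by simp_all
    show ?case
    proof (cases "i < p")
      case True
      then show ?thesis
        using system.rho_gam[OF left[OF ob(2)] tup(1)[OF 5(1)] spl(1)[OF 5(2) True]] by (simp add: defs)
    next
      case False
      then show ?thesis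
        using system.rho_gam[OF right[OF ob(1)] tup(2)[OF 5(1)] spl(2)[OF 5(2)]] by (simp add: defs)
    qed
  next
    case (6 Ss i T U V)
    then have ob: "fst X (take p Ss) \<in> Ob A" "fst Y (drop p Ss) \<in> Ob A" by simp_all
    show ?case
    proof (cases "i < p")
      case True
      then show ?thesis
        using system.rho_assoc[OF left[OF ob(2)] tup(1)[OF 6(1)] spl(1)[OF 6(2) True] 6(3)] ob
        by (simp add: defs)
    next
      case False
      then show ?thesis
        using system.rho_assoc[OF right[OF ob(1)] tup(2)[OF 6(1)] spl(2)[OF 6(2)] 6(3)] ob
        by (simp add: defs)
    qed
  next
    case (7 Ss i j T U V W)
    then have ob: "fst X (take p Ss) \<in> Ob A" "fst Y (drop p Ss) \<in> Ob A" by simp_all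
    consider "i < p" "j < p" | "i < p" "\<not> j < p" | "\<not> i < p" "\<not> j < p" using 7(2) by linarith
    then show ?case
    proof cases
      case 1
      have "i \<noteq> j" using 7(2) by simp
      from system.rho_comm[OF left[OF ob(2)] tup(1)[OF 7(1)] this spl(1)[OF 7(3) 1(1)] spl(1)[OF 7(4) 1(2)]]
      show ?thesis using 1 by (simp add: defs)
    next
      case 2
      note sX = spl(1)[OF 7(3) 2(1)]
      have sY: "split_at (drop p Ss) (j - p) V W" using spl(2)[OF 7(4)] 2(2) by simp
      note tX = split_at_tuples[OF tup(1)[OF 7(1)] sX] and tY = split_at_tuples[OF tup(2)[OF 7(1)] sY]
      show ?thesis
        using 2 dl_dr_comm[of "fst X ((take p Ss)[i := T])" "fst X ((take p Ss)[i := U])"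
            "fst Y ((drop p Ss)[j - p := V])" "fst Y ((drop p Ss)[j - p := W])"
            "snd X (take p Ss) i T U" "fst X (take p Ss)" "snd Y (drop p Ss) (j - p) V W" "fst Y (drop p Ss)"]
          tX tY tup[OF 7(1)] sX sY
        by (simp add: defs)
    next
      case 3
      then have "i - p \<noteq> j - p" and s: "split_at (drop p Ss) (i - p) T U" "split_at (drop p Ss) (j - p) V W"
        using 7(2) spl(2)[OF 7(3)] spl(2)[OF 7(4)] by auto
      from system.rho_comm[OF right[OF ob(1)] tup(2)[OF 7(1)] this]
      show ?thesis using 3 by (simp add: defs)
    qed
  qed
  from system.is_sys_mk_sys[OF this] show ?thesis by (simp add: ext_sys_def)
qed

end


context associative_category
begin

lemma is_sys_ar_ext_ar:
  assumes F: "is_system_ar A p q (X, X', \<phi>)" and G: "is_system_ar A r q (Y, Y', \<psi>)"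
  shows "is_system_ar A (p + r) q (ext_ar A q p r (X, X', \<phi>) (Y, Y', \<psi>))"
proof -
  note X = is_sys_arD(1,2)[OF F] and \<phi> = is_sys_arD(4-6)[OF F]
    and \<phi>_zero = is_sys_arD(7)[OF F] and \<phi>_comm = is_sys_arD(8)[OF F]
  note Y = is_sys_arD(1,2)[OF G] and \<psi> = is_sys_arD(4-6)[OF G]
    and \<psi>_zero = is_sys_arD(7)[OF G] and \<psi>_comm = is_sys_arD(8)[OF G]
  interpret X: system A p q "fst X" "snd X" using is_sys_system X(1) .
  interpret X': system A p q "fst X'" "snd X'" using is_sys_system X(2) .
  interpret Y: system A r q "fst Y" "snd Y" using is_sys_system Y(1) .
  interpret Y': system A r q "fst Y'" "snd Y'" using is_sys_system Y(2) .
  let ?\<theta> = "\<lambda>Ss. \<phi> (take p Ss) \<boxtimes> \<psi> (drop p Ss)"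
  have zero: "?\<theta> Ss = Id A \<zero>" if "Ss \<in> tuples (p + r) q" "{} \<in> set Ss" for Ss
    using empty_take_or_drop[OF that(2), of p] \<phi>_zero \<psi>_zero \<phi>(1) \<psi>(1) that(1) by auto
  have comm: "?\<theta> Ss \<cdot> ext_rho A p X Y Ss i T U
      = ext_rho A p X' Y' Ss i T U \<cdot> (?\<theta> (Ss[i := T]) \<boxplus> ?\<theta> (Ss[i := U]))"
    if Ss: "Ss \<in> tuples (p + r) q" and s: "split_at Ss i T U" for Ss i T U
  proof (cases "i < p")
    case True
    note s' = split_at_take[OF s True]
    note tup = take_tuple[OF Ss] drop_tuple[OF Ss] split_at_tuples[OF take_tuple[OF Ss] s']
    show ?thesis
      using True tup s' \<phi> \<psi> \<phi>_comm[OF tup(1) s']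
        dl_map[of "\<phi> (take p Ss)" "\<phi> ((take p Ss)[i := T])" "\<phi> ((take p Ss)[i := U])" "\<psi> (drop p Ss)"
          "snd X (take p Ss) i T U" "snd X' (take p Ss) i T U" "fst Y (drop p Ss)" "fst Y' (drop p Ss)"]
      by (simp add: ext_rho_def Let_def take_update drop_update)
  next
    case False
    then have s': "split_at (drop p Ss) (i - p) T U" using split_at_drop[OF s] by simp
    note tup = take_tuple[OF Ss] drop_tuple[OF Ss] split_at_tuples[OF drop_tuple[OF Ss] s']
    show ?thesis
      using False tup s' \<phi> \<psi> \<psi>_comm[OF tup(2) s']
        dr_map[of "\<psi> (drop p Ss)" "\<psi> ((drop p Ss)[i - p := T])" "\<psi> ((drop p Ss)[i - p := U])" "\<phi> (take p Ss)"
          "snd Y (drop p Ss) (i - p) T U" "snd Y' (drop p Ss) (i - p) T U" "fst X (take p Ss)" "fst X' (take p Ss)"]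
      by (simp add: ext_rho_def Let_def take_update drop_update)
  qed
  show ?thesis
    unfolding ext_ar_def prod.case is_sys_ar_iff
    using is_sys_ext_sys[OF X(1) Y(1)] is_sys_ext_sys[OF X(2) Y(2)] zero comm \<phi> \<psi>
    by (simp add: ext_sys_def ext_ob_def)
qed

lemma ext_ar_Id:
  assumes "is_system A p q X" "is_system A r q Y"
  shows "ext_ar A q p r (Id (systems A p q) X) (Id (systems A r q) Y)
    = Id (systems A (p + r) q) (ext_sys A q p r X Y)"
proof -
  interpret X: system A p q "fst X" "snd X" using is_sys_system assms(1) .
  interpret Y: system A r q "fst Y" "snd Y" using is_sys_system assms(2) .
  show ?thesis by (auto simp: Id_sys_cat ext_ar_def ext_sys_def ext_ob_def intro!: restrict_ext)
qed

lemma nerve_ext_ar: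
  assumes "f \<in> nerve (systems A p q) s" "g \<in> nerve (systems A r q) s"
  shows "mk_nerve s (\<lambda>i j. ext_ar A q p r (f i j) (g i j)) \<in> nerve (systems A (p + r) q) s"
proof (rule nerve_map2[OF assms, where P = "ext_sys A q p r"])
  fix u v u' v' X X' X'' Y Y' Y''
  assume "u \<in> Hom (systems A p q) X X'" "v \<in> Hom (systems A r q) Y Y'"
    "u' \<in> Hom (systems A p q) X' X''" "v' \<in> Hom (systems A r q) Y' Y''"
  then obtain \<phi> \<psi> \<phi>' \<psi>' where uv: "u = (X, X', \<phi>)" "v = (Y, Y', \<psi>)" "u' = (X', X'', \<phi>')" "v' = (Y', Y'', \<psi>')"
    and ar: "is_system_ar A p q (X, X', \<phi>)" "is_system_ar A r q (Y, Y', \<psi>)"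
      "is_system_ar A p q (X', X'', \<phi>')" "is_system_ar A r q (Y', Y'', \<psi>')"
    by (auto simp: Hom_sys_cat)
  have "(\<phi>' P \<cdot> \<phi> P) \<boxtimes> (\<psi>' R \<cdot> \<psi> R) = (\<phi>' P \<boxtimes> \<psi>' R) \<cdot> (\<phi> P \<boxtimes> \<psi> R)"
    if "P \<in> tuples p q" "R \<in> tuples r q" for P R
    using that ar[unfolded is_sys_ar_iff] by (simp add: aten_cmp_aten)
  then show "ext_ar A q p r (u' \<cdot>\<^bsub>systems A p q\<^esub> u) (v' \<cdot>\<^bsub>systems A r q\<^esub> v)
      = ext_ar A q p r u' v' \<cdot>\<^bsub>systems A (p + r) q\<^esub> ext_ar A q p r u v"
    unfolding uv by (auto simp: ext_ar_def intro!: restrict_ext)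
next
  fix u v X X' Y Y'
  assume "u \<in> Hom (systems A p q) X X'" "v \<in> Hom (systems A r q) Y Y'"
  then obtain \<phi> \<psi> where uv: "u = (X, X', \<phi>)" "v = (Y, Y', \<psi>)"
    and ar: "is_system_ar A p q (X, X', \<phi>)" "is_system_ar A r q (Y, Y', \<psi>)"
    by (auto simp: Hom_sys_cat)
  show "ext_ar A q p r u v \<in> Hom (systems A (p + r) q) (ext_sys A q p r X Y) (ext_sys A q p r X' Y')"
    using is_sys_ar_ext_ar[OF ar] unfolding uv by (simp add: Hom_sys_cat) (simp add: ext_ar_def)
qed (simp_all add: is_sys_ext_sys ext_ar_Id)

lemma is_sys_arE:
  assumes "is_system_ar A n q F"
  obtains X Y \<phi> where "F = (X, Y, \<phi>)" "is_system A n q X" "is_system A n q Y"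
    "\<And>Ss. Ss \<in> tuples n q \<Longrightarrow> \<phi> Ss \<in> Ar A"
  using is_sys_arD[of n q] assms by (cases F) blast

section \<open>Compatibility of the external product with the spectrum structure\<close>

lemma ext_zero_left:
  assumes "is_system_ar A r q G"
  shows "ext_ar A q p r (Id (systems A p q) (zero_sys A (circles p q))) G
    = Id (systems A (p + r) q) (zero_sys A (circles (p + r) q))"
proof -
  obtain Y Y' \<psi> where G: "G = (Y, Y', \<psi>)" "is_system A r q Y" "is_system A r q Y'"
    "\<And>Ss. Ss \<in> tuples r q \<Longrightarrow> \<psi> Ss \<in> Ar A" by (rule is_sys_arE[OF assms]) (rule that)
  have "ext_sys A q p r (zero_sys A (circles p q)) Y = zero_sys A (circles (p + r) q)"
    if "is_system A r q Y" for Y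
  proof -
    interpret Y: system A r q "fst Y" "snd Y" using is_sys_system that .
    show ?thesis
      unfolding ext_sys_def zero_sys_def[of A "circles (p + r) q"]
    proof (rule mk_sys_cong, goal_cases)
      case (2 Ss i T U)
      then show ?case
        using split_at_tuples[OF take_tuple[OF 2(1)] split_at_take[OF 2(2)]]
          split_at_tuples[OF drop_tuple[OF 2(1)] split_at_drop[OF 2(2)]]
        by (simp add: ext_rho_def Let_def)
    qed (simp add: ext_ob_def)
  qed
  then show ?thesis using G by (auto simp: ext_ar_def Id_sys_cat intro!: restrict_ext)
qed

lemma ext_zero_right:
  assumes "is_system_ar A p q F"
  shows "ext_ar A q p r F (Id (systems A r q) (zero_sys A (circles r q)))
    = Id (systems A (p + r) q) (zero_sys A (circles (p + r) q))"
proof -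
  obtain X X' \<phi> where F: "F = (X, X', \<phi>)" "is_system A p q X" "is_system A p q X'"
    "\<And>Ss. Ss \<in> tuples p q \<Longrightarrow> \<phi> Ss \<in> Ar A" by (rule is_sys_arE[OF assms]) (rule that)
  have "ext_sys A q p r X (zero_sys A (circles r q)) = zero_sys A (circles (p + r) q)"
    if "is_system A p q X" for X
  proof -
    interpret X: system A p q "fst X" "snd X" using is_sys_system that .
    show ?thesis
      unfolding ext_sys_def zero_sys_def[of A "circles (p + r) q"]
    proof (rule mk_sys_cong, goal_cases)
      case (2 Ss i T U)
      then show ?case
        using split_at_tuples[OF take_tuple[OF 2(1)] split_at_take[OF 2(2)]]
          split_at_tuples[OF drop_tuple[OF 2(1)] split_at_drop[OF 2(2)]]
        by (simp add: ext_rho_def Let_def)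
    qed (simp add: ext_ob_def)
  qed
  then show ?thesis using F by (auto simp: ext_ar_def Id_sys_cat intro!: restrict_ext)
qed

lemma ext_reindex:
  assumes \<sigma>: "\<sigma> permutes {..<p}" and \<tau>: "\<tau> permutes {..<r}" and G: "set_hom q' q G"
  shows "ext_ar A q' p r (reindex_ar p q' \<sigma> G F) (reindex_ar r q' \<tau> G F')
    = reindex_ar (p + r) q' (block_sum p \<sigma> \<tau>) G (ext_ar A q p r F F')"
proof -
  interpret \<sigma>: reindexing p q' q \<sigma> G using \<sigma> G by unfold_locales
  interpret \<tau>: reindexing r q' q \<tau> G using \<tau> G by unfold_locales
  interpret s: reindexing "p + r" q' q "block_sum p \<sigma> \<tau>" G
    using block_sum_permutes[OF \<sigma> \<tau>] G by unfold_locales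
  note blk = reindex_block_sum[OF \<sigma> \<tau> length_tuple]
  have inv: "inv (block_sum p \<sigma> \<tau>) i = (if i < p then inv \<sigma> i else p + inv \<tau> (i - p))" for i
    by (simp add: inv_block_sum[OF \<sigma> \<tau>] block_sum_def)
  have s': "inv \<sigma> i < p \<longleftrightarrow> i < p" for i
    using permutes_in_image[OF permutes_inv[OF \<sigma>], of i] by simp
  have "ext_sys A q' p r (reindex_sys p q' \<sigma> G X) (reindex_sys r q' \<tau> G Y)
      = reindex_sys (p + r) q' (block_sum p \<sigma> \<tau>) G (ext_sys A q p r X Y)" for X Y
    unfolding reindex_sys_def[of "p + r"] ext_sys_def[of A q']
  proof (rule mk_sys_cong, goal_cases)
    case (1 Ss)
    then show ?case using s.reindex_tuple_in[OF 1]
      by (simp add: ext_sys_def ext_ob_def blk reindex_sys_def)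
  next
    case (2 Ss i T U)
    note len = length_tuple[OF take_tuple[OF 2(1)]] length_tuple[OF drop_tuple[OF 2(1)]]
    show ?case
    proof (cases "i < p")
      case True
      then show ?thesis
        using 2 s.reindex_tuple_in[OF 2(1)] s.split_at_reindex[OF 2] len
          split_at_tuples[OF take_tuple[OF 2(1)] split_at_take[OF 2(2) True]]
        by (simp add: ext_sys_def ext_rho_def Let_def blk reindex_sys_def inv s' \<sigma>.reindex_tuple_update)
    next
      case False
      then have "i - p < r" using split_at_lt[OF 2] by simp
      then show ?thesis
        using False 2 s.reindex_tuple_in[OF 2(1)] s.split_at_reindex[OF 2] len
          split_at_tuples[OF drop_tuple[OF 2(1)] split_at_drop[OF 2(2)]]
        by (simp add: ext_sys_def ext_rho_def Let_def blk reindex_sys_def inv s' \<tau>.reindex_tuple_update)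
    qed
  qed
  then show ?thesis
    using s.reindex_tuple_in
    by (cases F; cases F') (auto simp: ext_ar_def reindex_ar_def blk intro!: restrict_ext)
qed

lemma tuple_blocks:
  assumes "Ss \<in> tuples (a + b + c) q"
  shows "take (a + b) Ss \<in> tuples (a + b) q" "drop a (take (a + b) Ss) = take b (drop a Ss)"
    "drop b (drop a Ss) = drop (a + b) Ss" "take a (take (a + b) Ss) = take a Ss"
    "take a Ss \<in> tuples a q" "drop a Ss \<in> tuples (b + c) q" "drop (a + b) Ss \<in> tuples c q"
    "take b (drop a Ss) \<in> tuples b q"
proof -
  have "Ss \<in> tuples (a + (b + c)) q" using assms by (simp only: add.assoc)
  from take_tuple[OF this] drop_tuple[OF this] take_tuple[OF drop_tuple[OF this]]
  show "take a Ss \<in> tuples a q" "drop a Ss \<in> tuples (b + c) q" "take b (drop a Ss) \<in> tuples b q" .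
  show "take (a + b) Ss \<in> tuples (a + b) q" "drop (a + b) Ss \<in> tuples c q"
    using take_tuple[OF assms] drop_tuple[OF assms] .
qed (simp_all add: drop_take add.commute)

lemma iter_sys_parts:
  "Ss \<in> tuples (n + length xs) q
    \<Longrightarrow> fst (iter_sys A n q xs X) Ss = (if covers xs (drop n Ss) then fst X (take n Ss) else \<zero>)"
  "\<lbrakk>Ss \<in> tuples (n + length xs) q; split_at Ss i T U\<rbrakk> \<Longrightarrow> snd (iter_sys A n q xs X) Ss i T U
    = (if i < n \<and> covers xs (drop n Ss) then snd X (take n Ss) i T U
       else Id A (if covers xs (drop n Ss) then fst X (take n Ss) else \<zero>))"
  by (simp_all add: iter_sys_def Let_def)

lemma ext_sys_parts:
  "Ss \<in> tuples (p + r) q \<Longrightarrow> fst (ext_sys A q p r X Y) Ss = ext_ob A p X Y Ss"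
  "\<lbrakk>Ss \<in> tuples (p + r) q; split_at Ss i T U\<rbrakk>
    \<Longrightarrow> snd (ext_sys A q p r X Y) Ss i T U = ext_rho A p X Y Ss i T U"
  by (simp_all add: ext_sys_def)

lemma ext_iter:
  assumes F: "is_system_ar A p q F" and F': "is_system_ar A r q F'"
  shows "ext_ar A q p (r + length xs) F (iter_ar A r q xs F')
    = iter_ar A (p + r) q xs (ext_ar A q p r F F')"
proof -
  let ?m = "length xs"
  note cut = tuple_blocks[where a = p and b = r and c = "length xs" and q = q]
  have sys: "ext_sys A q p (r + ?m) X (iter_sys A r q xs Y) = iter_sys A (p + r) q xs (ext_sys A q p r X Y)"
    if XY: "is_system A p q X" "is_system A r q Y" for X Y
  proof -
    interpret X: system A p q "fst X" "snd X" using is_sys_system XY(1) .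
    interpret Y: system A r q "fst Y" "snd Y" using is_sys_system XY(2) .
    show ?thesis
      unfolding ext_sys_def[of A q p "r + ?m"] iter_sys_def[of A "p + r"] Let_def add.assoc[symmetric, of p r]
    proof (rule mk_sys_cong, goal_cases)
      case (1 Ss)
      note c = cut[OF 1]
      show ?case using c by (simp add: ext_ob_def iter_sys_parts ext_sys_parts)
    next
      case (2 Ss i T U)
      note c = cut[OF 2(1)]
      consider "i < p" | "\<not> i < p" "i < p + r" | "\<not> i < p + r" by linarith
      then show ?case
      proof cases
        case 1
        then have s: "split_at (take p Ss) i T U" "split_at (take (p + r) Ss) i T U" using 2(2) by simp_all
        show ?thesis
          using 1 c s split_at_tuples[OF c(5) s(1)]
          by (simp add: ext_rho_def Let_def ext_ob_def iter_sys_parts ext_sys_parts)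
      next
        case k: 2
        then have s: "split_at (drop p Ss) (i - p) T U" "split_at (take (p + r) Ss) i T U"
          "split_at (take r (drop p Ss)) (i - p) T U"
          using 2(2) split_at_drop[OF 2(2), of p] split_at_take[OF split_at_drop[OF 2(2), of p], of r]
          by simp_all
        show ?thesis
          using k c s split_at_tuples[OF c(6) s(1)] split_at_tuples[OF c(8) s(3)]
          by (simp add: ext_rho_def Let_def ext_ob_def iter_sys_parts ext_sys_parts drop_update take_update)
      next
        case k: 3
        then have s: "split_at (drop p Ss) (i - p) T U" "split_at (drop (p + r) Ss) (i - (p + r)) T U"
          using 2(2) split_at_drop[OF 2(2)] by simp_all
        have "length (drop (p + r) Ss) = ?m" using 2(1) by (simp add: tuples_iff)
        from covers_split[OF this s(2)] show ?thesis
          using k c s split_at_tuples[OF c(6) s(1)]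
          by (auto simp: ext_rho_def Let_def ext_ob_def iter_sys_parts ext_sys_parts drop_update take_update)
      qed
    qed
  qed
  obtain X X' \<phi> where F: "F = (X, X', \<phi>)" "is_system A p q X" "is_system A p q X'"
    "\<And>Ss. Ss \<in> tuples p q \<Longrightarrow> \<phi> Ss \<in> Ar A" by (rule is_sys_arE[OF F]) (rule that)
  obtain Y Y' \<psi> where F': "F' = (Y, Y', \<psi>)" "is_system A r q Y" "is_system A r q Y'"
    "\<And>Ss. Ss \<in> tuples r q \<Longrightarrow> \<psi> Ss \<in> Ar A" by (rule is_sys_arE[OF F']) (rule that)
  show ?thesis
    unfolding F(1) F'(1) using F(4) cut
    by (auto simp: ext_ar_def iter_ar_def sys F(2,3) F'(2,3) add.assoc[symmetric] intro!: restrict_ext)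
qed

lemma permute_list_block_swap:
  assumes "length Ss = m + r"
  shows "permute_list (block_swap r m) Ss = drop m Ss @ take m Ss"
proof -
  have p: "block_swap r m permutes {..<length Ss}"
    using block_swap_permutes[of r m] assms by (simp add: add.commute)
  show ?thesis
    using assms
    by (intro nth_equalityI) (auto simp: permute_list_nth[OF p] nth_append block_swap_def add.commute)
qed

lemma inv_block_swap: "inv (block_swap r m) = block_swap m r"
  by (rule inv_unique_comp) (auto simp: block_swap_def fun_eq_iff)

text \<open>On both sides the new coordinates stand between those of \<open>X\<close> and those of \<open>Y\<close>: on the left
  they are appended to \<open>X\<close>, on the right they are appended to \<open>Y\<close> and then moved to the front.
  If the points are not covered, the left side vanishes through \<open>X\<close> and the right side through \<open>Y\<close>.\<close>

lemma ext_balance: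
  assumes F: "is_system_ar A p q F" and F': "is_system_ar A r q F'" and m: "length xs = m"
  shows "ext_ar A q (p + m) r (iter_ar A p q xs F) F'
    = ext_ar A q p (m + r) F (reindex_ar (m + r) q (block_swap r m) (\<lambda>S. S) (iter_ar A r q xs F'))"
proof -
  note cut = tuple_blocks[where a = p and b = m and c = r and q = q]
  interpret sw: reindexing "m + r" q q "block_swap r m" "\<lambda>S. S"
    using block_swap_permutes[of r m] by unfold_locales (simp_all add: add.commute set_hom_id)
  have rot: "drop m D @ take m D \<in> tuples (r + m) q" if "D \<in> tuples (m + r) q" for D
    using sw.reindex_tuple_in[OF that] permute_list_block_swap[OF length_tuple[OF that]]
    by (simp add: add.commute)
  have swap_parts: "fst (reindex_sys (m + r) q (block_swap r m) (\<lambda>S. S) (iter_sys A r q xs Y)) D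
      = (if covers xs (take m D) then fst Y (drop m D) else \<zero>)"
    "split_at D k T U \<Longrightarrow> snd (reindex_sys (m + r) q (block_swap r m) (\<lambda>S. S) (iter_sys A r q xs Y)) D k T U
      = (if \<not> k < m \<and> covers xs (take m D) then snd Y (drop m D) (k - m) T U
         else Id A (if covers xs (take m D) then fst Y (drop m D) else \<zero>))"
    if D: "D \<in> tuples (m + r) q" for D k T U Y
  proof -
    note r = rot[OF D] length_tuple[OF D]
    show "fst (reindex_sys (m + r) q (block_swap r m) (\<lambda>S. S) (iter_sys A r q xs Y)) D
        = (if covers xs (take m D) then fst Y (drop m D) else \<zero>)"
      using D r by (simp add: reindex_sys_def permute_list_block_swap iter_sys_parts m)
    assume s: "split_at D k T U"
    have "split_at (drop m D @ take m D) (block_swap m r k) T U"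
      using sw.split_at_reindex[OF D s] r(2) by (simp add: permute_list_block_swap inv_block_swap)
    moreover have "block_swap m r k < r \<longleftrightarrow> \<not> k < m" "\<not> k < m \<Longrightarrow> block_swap m r k = k - m"
      using split_at_lt[OF D s] by (auto simp: block_swap_def)
    ultimately show "snd (reindex_sys (m + r) q (block_swap r m) (\<lambda>S. S) (iter_sys A r q xs Y)) D k T U
      = (if \<not> k < m \<and> covers xs (take m D) then snd Y (drop m D) (k - m) T U
         else Id A (if covers xs (take m D) then fst Y (drop m D) else \<zero>))"
      using D s r by (auto simp: reindex_sys_def permute_list_block_swap inv_block_swap iter_sys_parts m)
  qed
  have sys: "ext_sys A q (p + m) r (iter_sys A p q xs X) Y
      = ext_sys A q p (m + r) X (reindex_sys (m + r) q (block_swap r m) (\<lambda>S. S) (iter_sys A r q xs Y))"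
    if XY: "is_system A p q X" "is_system A r q Y" for X Y
  proof -
    interpret X: system A p q "fst X" "snd X" using is_sys_system XY(1) .
    interpret Y: system A r q "fst Y" "snd Y" using is_sys_system XY(2) .
    show ?thesis
      unfolding ext_sys_def add.assoc[symmetric, of p m]
    proof (rule mk_sys_cong, goal_cases)
      case (1 Ss)
      note c = cut[OF 1]
      show ?case using c by (simp add: ext_ob_def iter_sys_parts swap_parts m)
    next
      case (2 Ss i T U)
      note c = cut[OF 2(1)]
      consider "i < p" | "\<not> i < p" "i < p + m" | "\<not> i < p + m" by linarith
      then show ?case
      proof cases
        case 1
        then have s: "split_at (take p Ss) i T U" "split_at (take (p + m) Ss) i T U" using 2(2) by simp_all
        show ?thesis
          using 1 c s split_at_tuples[OF c(5) s(1)] split_at_tuples[OF c(1) s(2)]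
          by (simp add: ext_rho_def Let_def iter_sys_parts swap_parts m drop_update take_update)
      next
        case k: 2
        then have s: "split_at (drop p Ss) (i - p) T U" "split_at (take (p + m) Ss) i T U"
          "split_at (take m (drop p Ss)) (i - p) T U"
          using 2(2) split_at_drop[OF 2(2), of p] split_at_take[OF split_at_drop[OF 2(2), of p], of m]
          by simp_all
        have "length (take m (drop p Ss)) = length xs" using length_tuple[OF c(8)] m by (simp only:)
        from covers_split[OF this s(3)] show ?thesis
          using k c s split_at_tuples[OF c(6) s(1)] split_at_tuples[OF c(1) s(2)]
          by (auto simp: ext_rho_def Let_def iter_sys_parts swap_parts m drop_update take_update)
      next
        case k: 3
        then have s: "split_at (drop p Ss) (i - p) T U" "split_at (drop (p + m) Ss) (i - (p + m)) T U"
          using 2(2) split_at_drop[OF 2(2)] by simp_all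
        have "\<not> i - p < m" using k by simp
        then show ?thesis
          using k c s split_at_tuples[OF c(6) s(1)] split_at_tuples[OF c(7) s(2)]
          by (simp add: ext_rho_def Let_def iter_sys_parts swap_parts m drop_update take_update)
      qed
    qed
  qed
  obtain X X' \<phi> where F: "F = (X, X', \<phi>)" "is_system A p q X" "is_system A p q X'"
    "\<And>Ss. Ss \<in> tuples p q \<Longrightarrow> \<phi> Ss \<in> Ar A" by (rule is_sys_arE[OF F]) (rule that)
  obtain Y Y' \<psi> where F': "F' = (Y, Y', \<psi>)" "is_system A r q Y" "is_system A r q Y'"
    "\<And>Ss. Ss \<in> tuples r q \<Longrightarrow> \<psi> Ss \<in> Ar A" by (rule is_sys_arE[OF F']) (rule that)
  have "(\<lambda>Ss \<in> tuples (p + m) q. if covers xs (drop p Ss) then \<phi> (take p Ss) else Id A \<zero>) (take (p + m) Ss)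
        \<boxtimes> \<psi> (drop (p + m) Ss)
      = \<phi> (take p Ss) \<boxtimes> (\<lambda>Ss \<in> tuples (m + r) q. (\<lambda>Ss \<in> tuples (r + m) q.
          if covers xs (drop r Ss) then \<psi> (take r Ss) else Id A \<zero>) (reindex_tuple (block_swap r m) (\<lambda>S. S) Ss)) (drop p Ss)"
    if "Ss \<in> tuples (p + m + r) q" for Ss
    using cut[OF that] rot[OF cut(6)[OF that]] F(4) F'(4) length_tuple[OF cut(6)[OF that]]
    by (simp add: permute_list_block_swap)
  then show ?thesis
    unfolding F(1) F'(1)
    by (auto simp: ext_ar_def iter_ar_def reindex_ar_def sys F(2,3) F'(2,3) m add.assoc[symmetric] intro!: restrict_ext)
qed

lemma ext_assoc:
  assumes F: "is_system_ar A p q F" and F': "is_system_ar A r q F'"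
    and F'': "is_system_ar A t q F''"
  shows "ext_ar A q (p + r) t (ext_ar A q p r F F') F'' = ext_ar A q p (r + t) F (ext_ar A q r t F' F'')"
proof -
  note cut = tuple_blocks[where a = p and b = r and c = t and q = q]
  have sys: "ext_sys A q (p + r) t (ext_sys A q p r X Y) Z = ext_sys A q p (r + t) X (ext_sys A q r t Y Z)"
    if XYZ: "is_system A p q X" "is_system A r q Y" "is_system A t q Z" for X Y Z
  proof -
    interpret X: system A p q "fst X" "snd X" using is_sys_system XYZ(1) .
    interpret Y: system A r q "fst Y" "snd Y" using is_sys_system XYZ(2) .
    interpret Z: system A t q "fst Z" "snd Z" using is_sys_system XYZ(3) .
    show ?thesis
      unfolding ext_sys_def[of A q "p + r" t] ext_sys_def[of A q p "r + t"] add.assoc[symmetric, of p r]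
    proof (rule mk_sys_cong, goal_cases)
      case (1 Ss)
      note c = cut[OF 1]
      show ?case using c by (simp add: ext_ob_def ext_sys_parts oten_assoc)
    next
      case (2 Ss i T U)
      note c = cut[OF 2(1)]
      consider "i < p" | "\<not> i < p" "i < p + r" | "\<not> i < p + r" by linarith
      then show ?case
      proof cases
        case 1
        then have s: "split_at (take p Ss) i T U" "split_at (take (p + r) Ss) i T U" using 2(2) by simp_all
        show ?thesis
          using 1 c s split_at_tuples[OF c(5) s(1)] split_at_tuples[OF c(1) s(2)]
          by (simp add: ext_rho_def Let_def ext_ob_def ext_sys_parts drop_update take_update dl_dl)
      next
        case k: 2
        then have s: "split_at (drop p Ss) (i - p) T U" "split_at (take (p + r) Ss) i T U"
          "split_at (take r (drop p Ss)) (i - p) T U"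
          using 2(2) split_at_drop[OF 2(2), of p] split_at_take[OF split_at_drop[OF 2(2), of p], of r]
          by simp_all
        have "i - p < r" using k by simp
        then show ?thesis
          using k c s split_at_tuples[OF c(6) s(1)] split_at_tuples[OF c(1) s(2)] split_at_tuples[OF c(8) s(3)]
          by (simp add: ext_rho_def Let_def ext_ob_def ext_sys_parts drop_update take_update dr_dl)
      next
        case k: 3
        then have s: "split_at (drop p Ss) (i - p) T U" "split_at (drop (p + r) Ss) (i - (p + r)) T U"
          using 2(2) split_at_drop[OF 2(2)] by simp_all
        have "\<not> i - p < r" using k by simp
        then show ?thesis
          using k c s split_at_tuples[OF c(6) s(1)] split_at_tuples[OF c(7) s(2)]
          by (simp add: ext_rho_def Let_def ext_ob_def ext_sys_parts drop_update take_update dr_dr)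
      qed
    qed
  qed
  obtain X X' \<phi> where F: "F = (X, X', \<phi>)" "is_system A p q X" "is_system A p q X'"
    "\<And>Ss. Ss \<in> tuples p q \<Longrightarrow> \<phi> Ss \<in> Ar A" by (rule is_sys_arE[OF F]) (rule that)
  obtain Y Y' \<psi> where F': "F' = (Y, Y', \<psi>)" "is_system A r q Y" "is_system A r q Y'"
    "\<And>Ss. Ss \<in> tuples r q \<Longrightarrow> \<psi> Ss \<in> Ar A" by (rule is_sys_arE[OF F']) (rule that)
  obtain Z Z' \<chi> where F'': "F'' = (Z, Z', \<chi>)" "is_system A t q Z" "is_system A t q Z'"
    "\<And>Ss. Ss \<in> tuples t q \<Longrightarrow> \<chi> Ss \<in> Ar A" by (rule is_sys_arE[OF F'']) (rule that)
  show ?thesis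
    unfolding F(1) F'(1) F''(1) using F(4) F'(4) F''(4) cut
    by (auto simp: ext_ar_def sys F(2,3) F'(2,3) F''(2,3) aten_assoc add.assoc[symmetric] intro!: restrict_ext)
qed


section \<open>The unit of the external product\<close>

definition unit_sys :: "nat \<Rightarrow> ('o, 'm) sys" where
  "unit_sys q = mk_sys (circles 0 q) (\<lambda>Ss. \<one>) (\<lambda>Ss i T U. Id A \<one>)"

lemma tuples_0 [simp]: "Ss \<in> tuples 0 q \<longleftrightarrow> Ss = []"
  by (auto simp: tuples_iff)

lemma split_at_Nil [simp]: "\<not> split_at [] i T U"
  by (simp add: split_at_def)

lemma is_sys_unit: "is_system A 0 q (unit_sys q)"
  unfolding unit_sys_def by (intro system.is_sys_mk_sys systemI) auto

lemma unit_sys_eq: "mk_sys (circles 0 q) (\<lambda>Ss. c Ss) \<rho> = unit_sys q" if "c [] = \<one>"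
  unfolding unit_sys_def using that by (intro mk_sys_cong) auto

text \<open>The structure maps of the product with the unit are those of the other factor because \<open>dr\<close> and,
  in the next lemma, \<open>dl\<close> are identities next to \<open>\<one>\<close>.\<close>

lemma ext_unit_left:
  assumes "is_system_ar A r q G"
  shows "ext_ar A q 0 r (Id (systems A 0 q) (unit_sys q)) G = G"
proof -
  obtain Y Y' \<psi> where G: "G = (Y, Y', \<psi>)" "is_system A r q Y" "is_system A r q Y'"
    "\<And>Ss. Ss \<in> tuples r q \<Longrightarrow> \<psi> Ss \<in> Ar A" by (rule is_sys_arE[OF assms]) (rule that)
  have ext: "\<psi> \<in> extensional (tuples r q)" using assms G(1) by (simp add: is_sys_ar_iff)
  have "ext_sys A q 0 r (unit_sys q) Y = Y" if "is_system A r q Y" for Y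
  proof -
    interpret Y: system A r q "fst Y" "snd Y" using is_sys_system that .
    have "ext_sys A q 0 r (unit_sys q) Y = mk_sys (circles r q) (fst Y) (snd Y)"
      unfolding ext_sys_def add_0
      by (rule mk_sys_cong) (simp_all add: ext_ob_def ext_rho_def unit_sys_def Let_def)
    then show ?thesis using is_sys_ext[OF that] by simp
  qed
  then show ?thesis
    using G ext by (auto simp: ext_ar_def Id_sys_cat unit_sys_def fun_eq_iff extensional_def)
qed

lemma ext_unit_right:
  assumes "is_system_ar A p q F"
  shows "ext_ar A q p 0 F (Id (systems A 0 q) (unit_sys q)) = F"
proof -
  obtain X X' \<phi> where F: "F = (X, X', \<phi>)" "is_system A p q X" "is_system A p q X'"
    "\<And>Ss. Ss \<in> tuples p q \<Longrightarrow> \<phi> Ss \<in> Ar A" by (rule is_sys_arE[OF assms]) (rule that)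
  have ext: "\<phi> \<in> extensional (tuples p q)" using assms F(1) by (simp add: is_sys_ar_iff)
  have "ext_sys A q p 0 X (unit_sys q) = X" if "is_system A p q X" for X
  proof -
    interpret X: system A p q "fst X" "snd X" using is_sys_system that .
    have "ext_sys A q p 0 X (unit_sys q) = mk_sys (circles p q) (fst X) (snd X)"
      unfolding ext_sys_def add_0_right
      by (rule mk_sys_cong)
        (simp_all add: ext_ob_def ext_rho_def unit_sys_def Let_def length_tuple split_at_lt)
    then show ?thesis using is_sys_ext[OF that] by simp
  qed
  then show ?thesis
    using F ext by (auto simp: ext_ar_def Id_sys_cat unit_sys_def fun_eq_iff extensional_def length_tuple)
qed


section \<open>The multiplication and the unit of \<open>K A\<close>\<close>

lemma structure_mf_2 [simp]:
  "\<lbrakk>a \<in> Ob A; b \<in> Ob A\<rbrakk> \<Longrightarrow> lin_ob (structure_mf A 2 id) [a, b] = a \<otimes> b"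
  "\<lbrakk>f \<in> Ar A; g \<in> Ar A\<rbrakk> \<Longrightarrow> lin_ar (structure_mf A 2 id) [f, g] = f \<boxtimes> g"
  "\<lbrakk>a \<in> Ob A; a' \<in> Ob A; b \<in> Ob A\<rbrakk> \<Longrightarrow> lin_dist (structure_mf A 2 id) 0 [a, b] a' = dl A a a' b"
  "\<lbrakk>a \<in> Ob A; b \<in> Ob A; b' \<in> Ob A\<rbrakk> \<Longrightarrow> lin_dist (structure_mf A 2 id) (Suc 0) [a, b] b' = dr A a b b'"
  by (simp_all add: structure_mf_def oten_list_def aten_list_def inv_id Let_def)

lemma block_of_pair:
  assumes "i < p + r"
  shows "block_of [p, r] i = (if i < p then 0 else Suc 0)"
proof -
  have "0 < b" if "\<not> i < p" "i < offset [p, r] (Suc b)" for b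
    using that by (cases b) (simp_all add: offset_def)
  then show ?thesis
    unfolding block_of_def using assms
    by (auto intro!: Least_equality simp: Suc_le_eq) (simp_all add: offset_def)
qed

lemma blocks_pair:
  "length Ss = p + r \<Longrightarrow> block [p, r] 0 Ss = take p Ss"
  "length Ss = p + r \<Longrightarrow> block [p, r] (Suc 0) Ss = drop p Ss"
  by (simp_all add: block_def offset_def)

lemma K_map_ob_pair:
  "length Ss = p + r \<Longrightarrow> K_map_ob f [p, r] [X, Y] Ss = [fst X (take p Ss), fst Y (drop p Ss)]"
  by (simp add: K_map_ob_def blocks_pair)

text \<open>In the product of two factors one of the products \<open>L\<close> and \<open>R\<close> around the variable is empty, so
  one of the two distributivity maps in \<^const>\<open>structure_mf\<close> is an identity by \<open>dl_one\<close> or \<open>dr_one\<close>.\<close>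

lemma K_map_sys_pair:
  assumes "is_system A p q X" "is_system A r q Y"
  shows "K_map_sys [A, A] A (structure_mf A 2 id) q [p, r] [X, Y] = ext_sys A q p r X Y"
proof -
  interpret X: system A p q "fst X" "snd X" using is_sys_system assms(1) .
  interpret Y: system A r q "fst Y" "snd Y" using is_sys_system assms(2) .
  have sum: "sum_list [p, r] = p + r" by simp
  show ?thesis
    unfolding K_map_sys_def ext_sys_def sum
  proof (rule mk_sys_cong, goal_cases)
    case (1 Ss)
    then show ?case by (simp add: K_map_ob_pair length_tuple ext_ob_def)
  next
    case (2 Ss i T U)
    note len = length_tuple[OF 2(1)] length_tuple[OF split_at_tuples(1)[OF 2]]
      length_tuple[OF split_at_tuples(2)[OF 2]]
    have i: "i < p + r" using split_at_lt[OF 2] .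
    show ?case
    proof (cases "i < p")
      case True
      note s = split_at_take[OF 2(2) True]
      show ?thesis
        using True i len s 2 split_at_tuples[OF take_tuple[OF 2(1)] s]
        by (simp add: block_of_pair K_map_ob_pair blocks_pair offset_def Let_def ext_rho_def
            drop_update take_update)
    next
      case False
      then have s: "split_at (drop p Ss) (i - p) T U" using split_at_drop[OF 2(2)] by simp
      show ?thesis
        using False i len s 2 split_at_tuples[OF drop_tuple[OF 2(1)] s]
        by (simp add: block_of_pair K_map_ob_pair blocks_pair offset_def Let_def ext_rho_def
            drop_update take_update)
    qed
  qed
qed

lemma K_map_ar_pair:
  assumes "is_system_ar A p q F" "is_system_ar A r q G"
  shows "K_map_ar [A, A] A (structure_mf A 2 id) q [p, r] [F, G] = ext_ar A q p r F G"
proof -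
  obtain X X' \<phi> where F: "F = (X, X', \<phi>)" "is_system A p q X" "is_system A p q X'"
    "\<And>Ss. Ss \<in> tuples p q \<Longrightarrow> \<phi> Ss \<in> Ar A" by (rule is_sys_arE[OF assms(1)]) (rule that)
  obtain Y Y' \<psi> where G: "G = (Y, Y', \<psi>)" "is_system A r q Y" "is_system A r q Y'"
    "\<And>Ss. Ss \<in> tuples r q \<Longrightarrow> \<psi> Ss \<in> Ar A" by (rule is_sys_arE[OF assms(2)]) (rule that)
  show ?thesis
    using F G
    by (auto simp: K_map_ar_def ext_ar_def K_map_sys_pair blocks_pair length_tuple intro!: restrict_ext)
qed

abbreviation K_mult :: "nat \<Rightarrow> nat \<Rightarrow> nat \<Rightarrow> ('o, 'm) K_simplex \<Rightarrow> ('o, 'm) K_simplex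
    \<Rightarrow> ('o, 'm) K_simplex" where
  "K_mult p r q x y \<equiv> K_map [A, A] A (structure_mf A 2 id) q [p, r] [x, y]"

lemma K_mult_eq:
  assumes "x \<in> K_level p q" "y \<in> K_level r q"
  shows "K_mult p r q x y = mk_nerve q (\<lambda>i j. ext_ar A q p r (x i j) (y i j))"
  unfolding K_map_def
  by (rule mk_nerve_cong) (simp add: K_map_ar_pair K_level_ar[OF assms(1)] K_level_ar[OF assms(2)])

lemma K_mult_in:
  "\<lbrakk>x \<in> K_level p q; y \<in> K_level r q\<rbrakk> \<Longrightarrow> K_mult p r q x y \<in> K_level (p + r) q"
  by (simp add: K_mult_eq nerve_ext_ar)

lemma K_mult_reindex:
  assumes "\<sigma> permutes {..<p}" "\<tau> permutes {..<r}" "set_hom q' q G" "mono_map q' q \<alpha>"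
    and x: "x \<in> K_level p q" and y: "y \<in> K_level r q"
  shows "K_mult p r q' (K_reindex p q' \<sigma> G \<alpha> x) (K_reindex r q' \<tau> G \<alpha> y)
    = K_reindex (p + r) q' (block_sum p \<sigma> \<tau>) G \<alpha> (K_mult p r q x y)"
  using K_reindex_in[OF assms(1,3,4) x] K_reindex_in[OF assms(2,3,4) y] x y
    mono_mapD[OF assms(4)] ext_reindex[OF assms(1-3)]
  by (simp add: K_mult_eq K_reindex_def cong: mk_nerve_cong)

lemma K_mult_iter:
  assumes x: "x \<in> K_level p q" and y: "y \<in> K_level r q"
  shows "K_mult p (r + length xs) q x (K_iter r q xs y) = K_iter (p + r) q xs (K_mult p r q x y)"
  using K_iter_in[OF y, of xs] x y ext_iter[OF K_level_ar[OF x] K_level_ar[OF y]]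
  by (simp add: K_mult_eq K_iter_def cong: mk_nerve_cong)

lemma K_mult_zero_left:
  assumes y: "y \<in> K_level r q"
  shows "K_mult p r q (K_zero p q) y = K_zero (p + r) q"
  using K_zero_in[of p q] y ext_zero_left[OF K_level_ar[OF y]]
  by (simp add: K_mult_eq K_zero_def cong: mk_nerve_cong)

lemma K_mult_zero_right:
  assumes x: "x \<in> K_level p q"
  shows "K_mult p r q x (K_zero r q) = K_zero (p + r) q"
  using K_zero_in[of r q] x ext_zero_right[OF K_level_ar[OF x]]
  by (simp add: K_mult_eq K_zero_def cong: mk_nerve_cong)

lemma bimorphism_K_mult: "bimorphism (K_spectrum A) (K_spectrum A) (K_spectrum A) K_mult"
proof (rule bimorphism.intro[OF symmetric_spectrum_K symmetric_spectrum_K symmetric_spectrum_K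
      bimorphism_axioms.intro], unfold K_simps, goal_cases)
  case (1 x p q y r)
  then show ?case by (rule K_mult_in)
next
  case (2 y r q p)
  then show ?case by (rule K_mult_zero_left)
next
  case (3 x p q r)
  then show ?case by (rule K_mult_zero_right)
next
  case (4 q' q \<alpha> x p y r)
  show ?case
    using K_mult_reindex[OF permutes_id permutes_id set_hom_circle 4]
    by (simp add: block_sum_id_right permutes_id)
next
  case (5 \<sigma> p \<tau> r x q y)
  then show ?case by (intro K_mult_reindex set_hom_id mono_map_id)
next
  case (6 x p q y r s)
  then show ?case using K_mult_iter[of x p q y r "[s]"] by simp
next
  case (7 x p q y r u m)
  interpret K: symmetric_spectrum "K_spectrum A" by (rule symmetric_spectrum_K)
  have perm: "block_swap r m permutes {..<m + r}" using block_swap_permutes[of r m] by (simp add: add.commute)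
  show ?case
  proof (cases u)
    case None
    then show ?thesis
      using 7 K_reindex_zero[OF perm set_hom_id mono_map_id, of q]
      by (simp add: sph_act_left_def sph_act_K K_mult_zero_left K_mult_zero_right ac_simps)
  next
    case (Some xs)
    then have m: "length xs = m" using 7(3) by (auto simp: sphere_def)
    have in1: "K_iter p q xs x \<in> K_level (p + m) q" and in2: "K_iter r q xs y \<in> K_level (m + r) q"
      using K_iter_in[OF 7(1), of xs] K_iter_in[OF 7(2), of xs] m by (simp_all add: add.commute)
    have in3: "K_reindex (m + r) q (block_swap r m) (\<lambda>S. S) id (K_iter r q xs y) \<in> K_level (m + r) q"
      by (rule K_reindex_in[OF perm set_hom_id mono_map_id in2])
    have "K_mult (p + m) r q (K_iter p q xs x) y
        = K_mult p (m + r) q x (K_reindex (m + r) q (block_swap r m) (\<lambda>S. S) id (K_iter r q xs y))"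
      unfolding K_mult_eq[OF in1 7(2)] K_mult_eq[OF 7(1) in3]
      using ext_balance[OF K_level_ar[OF 7(1)] K_level_ar[OF 7(2)] m]
      by (simp add: K_iter_def K_reindex_def cong: mk_nerve_cong)
    then show ?thesis
      using Some 7 by (simp add: sph_act_left_def sph_act_K)
  qed
qed

lemma K_mult_assoc:
  assumes x: "x \<in> K_level p q" and y: "y \<in> K_level r q" and z: "z \<in> K_level t q"
  shows "K_mult (p + r) t q (K_mult p r q x y) z = K_mult p (r + t) q x (K_mult r t q y z)"
  unfolding K_mult_eq[OF K_mult_in[OF x y] z] K_mult_eq[OF x K_mult_in[OF y z]]
  using ext_assoc[OF K_level_ar[OF x] K_level_ar[OF y] K_level_ar[OF z]]
  by (simp add: K_mult_eq[OF x y] K_mult_eq[OF y z] cong: mk_nerve_cong)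

definition K_unit :: "nat \<Rightarrow> ('o, 'm) K_simplex" where
  "K_unit q = mk_nerve q (\<lambda>i j. Id (systems A 0 q) (unit_sys q))"

lemma K_unit_in: "K_unit q \<in> K_level 0 q"
  unfolding K_unit_def by (rule nerve_constant[OF is_sys_unit])

lemma K_map_nullary: "K_map [] A (structure_mf A 0 id) 0 [] [] = K_unit 0"
proof -
  have "K_map_sys [] A (structure_mf A 0 id) 0 [] [] = unit_sys 0"
    unfolding K_map_sys_def sum_list.Nil
    by (rule unit_sys_eq) (simp add: structure_mf_def K_map_ob_def oten_list_def inv_id)
  moreover have "lin_ar (structure_mf A 0 id) [] = Id A \<one>"
    by (simp add: structure_mf_def aten_list_def inv_id)
  ultimately show ?thesis
    by (auto simp: K_map_def K_unit_def K_map_ar_def Id_sys_cat unit_sys_def intro!: mk_nerve_cong restrict_ext)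
qed

lemma sop_K_unit: "sop (lev (K_spectrum A) 0) 0 q (\<lambda>i. 0) (K_unit 0) = K_unit q"
proof -
  let ?G = "preim 0 (circle_op q (\<lambda>i. 0))"
  interpret system_reindexing A 0 q 0 id ?G
    by unfold_locales (auto simp: permutes_id set_hom_circle)
  have "reindex_sys 0 q id ?G (unit_sys 0) = unit_sys q"
    unfolding reindex_sys_def by (rule unit_sys_eq) (simp add: unit_sys_def)
  then show ?thesis
    by (simp add: K_reindex_def K_unit_def reindex_ar_Id cong: mk_nerve_cong)
qed

lemma ring_spectrum_K:
  "ring_spectrum (K_spectrum A) (K_bilinear A A A (structure_mf A 2 id)) (K_nullary A (structure_mf A 0 id))"
  unfolding K_bilinear_def K_nullary_def K_map_nullary
proof (rule ring_spectrumI[OF bimorphism_K_mult], unfold sop_K_unit, unfold K_simps, goal_cases)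
  case 1
  show ?case by (rule K_unit_in)
next
  case (2 p r t q x y z)
  then show ?case by (rule K_mult_assoc)
next
  case (3 r q x)
  have "mk_nerve q (\<lambda>i j. ext_ar A q 0 r (K_unit q i j) (x i j)) = mk_nerve q x"
    by (rule mk_nerve_cong) (simp add: K_unit_def ext_unit_left[OF K_level_ar[OF 3]])
  then show ?case using K_mult_eq[OF K_unit_in 3] nerve_ext[OF 3] by simp
next
  case (4 r q x)
  have "mk_nerve q (\<lambda>i j. ext_ar A q r 0 (x i j) (K_unit q i j)) = mk_nerve q x"
    by (rule mk_nerve_cong) (simp add: K_unit_def ext_unit_right[OF K_level_ar[OF 4]])
  then show ?case using K_mult_eq[OF 4 K_unit_in] nerve_ext[OF 4] by simp
qed

end

theorem corollary3p5:
  fixes A :: "('o, 'm) assoc_cat"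
  assumes "associative_category A"
  shows "ring_spectrum (K_spectrum A)
           (K_bilinear A A A (structure_mf A 2 id))
           (K_nullary A (structure_mf A 0 id))"
  using assms by (rule associative_category.ring_spectrum_K)

end
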